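(* There is a faithful functor $\mathsf{ProDet}(\mathsf{FinKer})\to\mathsf{Kleisli}(R)$, where $R$ is the Radon monad on compact Hausdorff spaces. On objects it sends (the formal limit of) a cofiltered diagram to its limit in compact Hausdorff spaces, a Stone space. On morphisms it sends $f:\lim_iX_i\to\lim_jY_j$ to the function $p:\lim_iX_i\to R(\lim_jY_j)$ that maps a point $x$ to the Kolmogorov extension, on the Stone space $\lim_jY_j$, of the compatible family of distributions $p_j(x)$ on $Y_j$, where $p_j(x)\in\mathsf{FinKer}(1,Y_j)$ is the composite of the deterministic point $x:1\to\lim_iX_i$, the morphism $f$ and the projection $\lim_jY_j\to Y_j$.
   Context: $\mathsf{FinKer}$ is the Markov category of finite sets and stochastic matrices (finite probability kernels); its deterministic subcategory $\mathsf{det}(\mathsf{FinKer})$ is $\mathsf{Fin}$, the category of finite sets and functions. $\mathsf{Pro}(-)$ denotes the category of pro-objects (free completion under small cofiltered limits), with $\mathsf{Pro}(\mathcal{C})(\lim_iX_i,\lim_jY_j)=\lim_j\operatorname{colim}_i\mathcal{C}(X_i,Y_j)$. $\mathsf{Pro}(\mathsf{Fin})$ is equivalent to the category of Stone spaces. $\mathsf{ProDet}(\mathsf{FinKer})$ is the full subcategory of $\mathsf{Pro}(\mathsf{FinKer})$ on the limits of cofiltered diagrams that factorize through $\mathsf{Fin}$. Thus a morphism $\lim_iX_i\to\lim_jY_j$ in it is given by, for each $j$, a choice of $i$ and a morphism in $\mathsf{FinKer}(X_i,Y_j)$, compatibly in $j$ and modulo the choice of $i$. The Radon monad $R$ on the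 category of compact Hausdorff spaces and continuous maps sends a space to the space of its Radon probability measures, with the weak topology, and $\mathsf{Kleisli}(R)$ is its Kleisli category. The Kolmogorov extension of a compatible family of distributions on the $Y_j$ is the unique Radon probability measure on $\lim_jY_j$ whose pushforward to each $Y_j$ is the given distribution. *)

theory Defs
  imports "HOL-Probability.Probability"
begin

section \<open>Categories and functors\<close>

text \<open>
  Morphisms do not carry their source and target: one value may belong to several hom-sets, so
  composition \<open>Cmp C X Y Z g f\<close> (\<open>g\<close> after \<open>f\<close>, for \<open>f : X \<rightarrow> Y\<close>, \<open>g : Y \<rightarrow> Z\<close>) and the action of a
  functor on morphisms take the objects involved as arguments.
\<close>

record ('o, 'm) cat =
  Obj :: "'o set"
  Hom :: "'o \<Rightarrow> 'o \<Rightarrow> 'm set"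
  Idn :: "'o \<Rightarrow> 'm"
  Cmp :: "'o \<Rightarrow> 'o \<Rightarrow> 'o \<Rightarrow> 'm \<Rightarrow> 'm \<Rightarrow> 'm"

locale category =
  fixes C :: "('o, 'm) cat"
  assumes Idn_in_Hom: "X \<in> Obj C \<Longrightarrow> Idn C X \<in> Hom C X X"
    and Cmp_in_Hom: "\<lbrakk>X \<in> Obj C; Y \<in> Obj C; Z \<in> Obj C; f \<in> Hom C X Y; g \<in> Hom C Y Z\<rbrakk>
      \<Longrightarrow> Cmp C X Y Z g f \<in> Hom C X Z"
    and Cmp_Idn_left: "\<lbrakk>X \<in> Obj C; Y \<in> Obj C; f \<in> Hom C X Y\<rbrakk> \<Longrightarrow> Cmp C X Y Y (Idn C Y) f = f"
    and Cmp_Idn_right: "\<lbrakk>X \<in> Obj C; Y \<in> Obj C; f \<in> Hom C X Y\<rbrakk> \<Longrightarrow> Cmp C X X Y f (Idn C X) = f"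
    and Cmp_assoc: "\<lbrakk>W \<in> Obj C; X \<in> Obj C; Y \<in> Obj C; Z \<in> Obj C;
        f \<in> Hom C W X; g \<in> Hom C X Y; h \<in> Hom C Y Z\<rbrakk>
      \<Longrightarrow> Cmp C W X Z (Cmp C X Y Z h g) f = Cmp C W Y Z h (Cmp C W X Y g f)"

record ('o, 'm, 'p, 'n) functor_data =
  fobj :: "'o \<Rightarrow> 'p"
  fmor :: "'o \<Rightarrow> 'o \<Rightarrow> 'm \<Rightarrow> 'n"

locale cat_functor = source: category C + target: category D
  for C :: "('o, 'm) cat" and D :: "('p, 'n) cat" +
  fixes F :: "('o, 'm, 'p, 'n) functor_data"
  assumes fobj_in_Obj: "X \<in> Obj C \<Longrightarrow> fobj F X \<in> Obj D"
    and fmor_in_Hom: "\<lbrakk>X \<in> Obj C; Y \<in> Obj C; f \<in> Hom C X Y\<rbrakk>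
      \<Longrightarrow> fmor F X Y f \<in> Hom D (fobj F X) (fobj F Y)"
    and fmor_Idn: "X \<in> Obj C \<Longrightarrow> fmor F X X (Idn C X) = Idn D (fobj F X)"
    and fmor_Cmp: "\<lbrakk>X \<in> Obj C; Y \<in> Obj C; Z \<in> Obj C; f \<in> Hom C X Y; g \<in> Hom C Y Z\<rbrakk>
      \<Longrightarrow> fmor F X Z (Cmp C X Y Z g f) =
          Cmp D (fobj F X) (fobj F Y) (fobj F Z) (fmor F Y Z g) (fmor F X Y f)"

locale faithful_functor = cat_functor C D F
  for C :: "('o, 'm) cat" and D :: "('p, 'n) cat" and F :: "('o, 'm, 'p, 'n) functor_data" +
  assumes inj_on_Hom: "\<lbrakk>X \<in> Obj C; Y \<in> Obj C\<rbrakk> \<Longrightarrow> inj_on (fmor F X Y) (Hom C X Y)"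

definition full_subcat :: "('o, 'm) cat \<Rightarrow> 'o set \<Rightarrow> ('o, 'm) cat" where
  "full_subcat C S = C\<lparr>Obj := Obj C \<inter> S\<rparr>"

locale cofiltered = category I for I :: "('i, 'k) cat" +
  assumes nonempty: "Obj I \<noteq> {}"
    and cone_objects: "\<lbrakk>i \<in> Obj I; j \<in> Obj I\<rbrakk>
      \<Longrightarrow> \<exists>k\<in>Obj I. Hom I k i \<noteq> {} \<and> Hom I k j \<noteq> {}"
    and cone_arrows: "\<lbrakk>i \<in> Obj I; j \<in> Obj I; u \<in> Hom I i j; v \<in> Hom I i j\<rbrakk>
      \<Longrightarrow> \<exists>k\<in>Obj I. \<exists>w\<in>Hom I k i. Cmp I k i j u w = Cmp I k i j v w"

section \<open>Pro-objects\<close>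

text \<open>
  The index categories of pro-objects live in two arbitrary types \<open>'i\<close> (objects) and \<open>'k\<close>
  (morphisms), which play the role of the universe of small sets.
\<close>

record ('i, 'k, 'o, 'm) diagram =
  idx :: "('i, 'k) cat"
  dia :: "('i, 'k, 'o, 'm) functor_data"

abbreviation dob :: "('i, 'k, 'o, 'm) diagram \<Rightarrow> 'i \<Rightarrow> 'o" where
  "dob D \<equiv> fobj (dia D)"

abbreviation dmo :: "('i, 'k, 'o, 'm) diagram \<Rightarrow> 'i \<Rightarrow> 'i \<Rightarrow> 'k \<Rightarrow> 'm" where
  "dmo D \<equiv> fmor (dia D)"

text \<open>
  The filtered colimit \<open>colim\<^sub>i C(X\<^sub>i, c)\<close> of sets: pairs \<open>(i, a)\<close> with \<open>a : X\<^sub>i \<rightarrow> c\<close>, two of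
  them being identified if they agree on some \<open>X\<^sub>k\<close>.
\<close>

definition germ_rel ::
  "('o, 'm) cat \<Rightarrow> ('i, 'k, 'o, 'm) diagram \<Rightarrow> 'o \<Rightarrow> (('i \<times> 'm) \<times> ('i \<times> 'm)) set" where
  "germ_rel C X c = {((i, a), (i', a')).
     i \<in> Obj (idx X) \<and> i' \<in> Obj (idx X) \<and> a \<in> Hom C (dob X i) c \<and> a' \<in> Hom C (dob X i') c \<and>
     (\<exists>k\<in>Obj (idx X). \<exists>u\<in>Hom (idx X) k i. \<exists>v\<in>Hom (idx X) k i'.
        Cmp C (dob X k) (dob X i) c a (dmo X k i u) =
        Cmp C (dob X k) (dob X i') c a' (dmo X k i' v))}"

definition germ ::
  "('o, 'm) cat \<Rightarrow> ('i, 'k, 'o, 'm) diagram \<Rightarrow> 'o \<Rightarrow> 'i \<times> 'm \<Rightarrow> ('i \<times> 'm) set" where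
  "germ C X c r = germ_rel C X c `` {r}"

definition colim_hom ::
  "('o, 'm) cat \<Rightarrow> ('i, 'k, 'o, 'm) diagram \<Rightarrow> 'o \<Rightarrow> ('i \<times> 'm) set set" where
  "colim_hom C X c = (SIGMA i:Obj (idx X). Hom C (dob X i) c) // germ_rel C X c"

text \<open>The limit over \<open>j\<close> of the sets \<open>colim\<^sub>i C(X\<^sub>i, Y\<^sub>j)\<close>.\<close>

definition pro_hom ::
  "('o, 'm) cat \<Rightarrow> ('i, 'k, 'o, 'm) diagram \<Rightarrow> ('i, 'k, 'o, 'm) diagram
    \<Rightarrow> ('i \<Rightarrow> ('i \<times> 'm) set) set" where
  "pro_hom C X Y = {f \<in> (\<Pi>\<^sub>E j\<in>Obj (idx Y). colim_hom C X (dob Y j)).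
     \<forall>j\<in>Obj (idx Y). \<forall>j'\<in>Obj (idx Y). \<forall>w\<in>Hom (idx Y) j j'. \<forall>(i, a)\<in>f j.
       germ C X (dob Y j') (i, Cmp C (dob X i) (dob Y j) (dob Y j') (dmo Y j j' w) a) = f j'}"

text \<open>
  The \<open>k\<close>-th component of a composite is the class of \<open>b \<circ> a\<close> for any \<open>(j, b)\<close> representing
  \<open>g k\<close> and any \<open>(i, a)\<close> representing \<open>f j\<close>; all these choices give the same class, so that their
  union is that class.
\<close>

definition Pro ::
  "('o, 'm) cat \<Rightarrow> (('i, 'k, 'o, 'm) diagram, 'i \<Rightarrow> ('i \<times> 'm) set) cat" where
  "Pro C = \<lparr>
     Obj = {X. cofiltered (idx X) \<and> cat_functor (idx X) C (dia X)},
     Hom = pro_hom C,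
     Idn = (\<lambda>X. \<lambda>j\<in>Obj (idx X). germ C X (dob X j) (j, Idn C (dob X j))),
     Cmp = (\<lambda>X Y Z g f. \<lambda>k\<in>Obj (idx Z).
       \<Union>(j, b)\<in>g k. \<Union>(i, a)\<in>f j.
         germ C X (dob Z k) (i, Cmp C (dob X i) (dob Y j) (dob Z k) b a))\<rparr>"

text \<open>
  The embedding of \<open>C\<close> into \<open>Pro C\<close> by diagrams on the terminal category, and the projections from
  a pro-object to its terms. Throughout, \<open>undefined\<close> serves only as the element of a singleton.
\<close>

definition terminal_cat :: "('i, 'k) cat" where
  "terminal_cat = \<lparr>Obj = {undefined}, Hom = (\<lambda>_ _. {undefined}), Idn = (\<lambda>_. undefined),
     Cmp = (\<lambda>_ _ _ _ _. undefined)\<rparr>"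

definition const_pro :: "('o, 'm) cat \<Rightarrow> 'o \<Rightarrow> ('i, 'k, 'o, 'm) diagram" where
  "const_pro C c =
     \<lparr>idx = terminal_cat, dia = \<lparr>fobj = (\<lambda>_. c), fmor = (\<lambda>_ _ _. Idn C c)\<rparr>\<rparr>"

definition const_pro_mor ::
  "('i \<times> 'k) itself \<Rightarrow> ('o, 'm) cat \<Rightarrow> 'o \<Rightarrow> 'o \<Rightarrow> 'm \<Rightarrow> 'i \<Rightarrow> ('i \<times> 'm) set" where
  "const_pro_mor _ C c d a = (\<lambda>_\<in>{undefined}.
     germ C (const_pro C c :: ('i, 'k, 'o, 'm) diagram) d (undefined, a))"

definition pro_proj ::
  "('o, 'm) cat \<Rightarrow> ('i, 'k, 'o, 'm) diagram \<Rightarrow> 'i \<Rightarrow> 'i \<Rightarrow> ('i \<times> 'm) set" where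
  "pro_proj C Y j = (\<lambda>_\<in>{undefined}. germ C Y (dob Y j) (j, Idn C (dob Y j)))"

section \<open>Finite sets, finite kernels and their pro-objects\<close>

text \<open>
  The objects are the finite sets of elements of an arbitrary type \<open>'a\<close>. A stochastic matrix is
  indexed by source and then target; its entries outside source times target are \<open>0\<close>.
\<close>

definition Fin :: "('a set, 'a \<Rightarrow> 'a) cat" where
  "Fin = \<lparr>
     Obj = {X. finite X},
     Hom = (\<lambda>X Y. X \<rightarrow>\<^sub>E Y),
     Idn = (\<lambda>X. \<lambda>x\<in>X. x),
     Cmp = (\<lambda>X Y Z g f. compose X g f)\<rparr>"

definition FinKer :: "('a set, 'a \<Rightarrow> 'a \<Rightarrow> real) cat" where
  "FinKer = \<lparr>
     Obj = {X. finite X},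
     Hom = (\<lambda>X Y. {k. (\<forall>x y. 0 \<le> k x y) \<and> (\<forall>x\<in>X. (\<Sum>y\<in>Y. k x y) = 1) \<and>
                       (\<forall>x y. x \<notin> X \<or> y \<notin> Y \<longrightarrow> k x y = 0)}),
     Idn = (\<lambda>X x y. if x \<in> X \<and> y = x then 1 else 0),
     Cmp = (\<lambda>X Y Z g f x z. \<Sum>y\<in>Y. f x y * g y z)\<rparr>"

definition det_kernel :: "'a set \<Rightarrow> ('a \<Rightarrow> 'a) \<Rightarrow> 'a \<Rightarrow> 'a \<Rightarrow> real" where
  "det_kernel X f x y = (if x \<in> X \<and> y = f x then 1 else 0)"

text \<open>\<open>E\<close> is a factorization of the diagram \<open>D\<close> through the inclusion of \<open>Fin\<close> into \<open>FinKer\<close>.\<close>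

definition fin_factorization ::
  "('i, 'k, 'a set, 'a \<Rightarrow> 'a \<Rightarrow> real) diagram \<Rightarrow> ('i, 'k, 'a set, 'a \<Rightarrow> 'a) functor_data \<Rightarrow> bool"
  where
  "fin_factorization D E \<longleftrightarrow> cat_functor (idx D) Fin E \<and>
     (\<forall>i\<in>Obj (idx D). dob D i = fobj E i) \<and>
     (\<forall>i\<in>Obj (idx D). \<forall>j\<in>Obj (idx D). \<forall>u\<in>Hom (idx D) i j.
        dmo D i j u = det_kernel (fobj E i) (fmor E i j u))"

definition ProDetFinKer ::
  "(('i, 'k, 'a set, 'a \<Rightarrow> 'a \<Rightarrow> real) diagram, 'i \<Rightarrow> ('i \<times> ('a \<Rightarrow> 'a \<Rightarrow> real)) set) cat" where
  "ProDetFinKer = full_subcat (Pro FinKer) {D. \<exists>E. fin_factorization D E}"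

definition fin_limit :: "('i, 'k) cat \<Rightarrow> ('i, 'k, 'a set, 'a \<Rightarrow> 'a) functor_data \<Rightarrow> ('i \<Rightarrow> 'a) topology"
  where
  "fin_limit I E =
     subtopology (product_topology (\<lambda>i. discrete_topology (fobj E i)) (Obj I))
       {x. \<forall>i\<in>Obj I. \<forall>j\<in>Obj I. \<forall>u\<in>Hom I i j. fmor E i j u (x i) = x j}"

definition stone_space :: "'x topology \<Rightarrow> bool" where
  "stone_space X \<longleftrightarrow> compact_space X \<and> Hausdorff_space X \<and>
     (\<forall>S. connectedin X S \<longrightarrow> (\<exists>a. S \<subseteq> {a}))"

definition fin_one :: "'a set" where
  "fin_one = {undefined}"

text \<open>The deterministic point of a pro-object given by a point \<open>x\<close> of its limit.\<close>

definition pro_point ::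
  "('i, 'k, 'a set, 'a \<Rightarrow> 'a \<Rightarrow> real) diagram \<Rightarrow> ('i \<Rightarrow> 'a)
    \<Rightarrow> 'i \<Rightarrow> ('i \<times> ('a \<Rightarrow> 'a \<Rightarrow> real)) set" where
  "pro_point X x = (\<lambda>i\<in>Obj (idx X).
     germ FinKer (const_pro FinKer fin_one :: ('i, 'k, 'a set, 'a \<Rightarrow> 'a \<Rightarrow> real) diagram) (dob X i)
       (undefined, det_kernel fin_one (\<lambda>_. x i)))"

text \<open>
  \<open>d\<close> is the distribution \<open>p\<^sub>j(x)\<close>: the morphism \<open>1 \<rightarrow> Y\<^sub>j\<close> of \<open>FinKer\<close> that becomes the composite
  \<open>1 \<rightarrow> X \<rightarrow> Y \<rightarrow> Y\<^sub>j\<close> in \<open>Pro FinKer\<close>.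
\<close>

definition is_point_distribution ::
  "('i, 'k, 'a set, 'a \<Rightarrow> 'a \<Rightarrow> real) diagram \<Rightarrow> ('i, 'k, 'a set, 'a \<Rightarrow> 'a \<Rightarrow> real) diagram
    \<Rightarrow> ('i \<Rightarrow> ('i \<times> ('a \<Rightarrow> 'a \<Rightarrow> real)) set) \<Rightarrow> ('i \<Rightarrow> 'a) \<Rightarrow> 'i \<Rightarrow> ('a \<Rightarrow> 'a \<Rightarrow> real) \<Rightarrow> bool" where
  "is_point_distribution X Y f x j d \<longleftrightarrow>
     d \<in> Hom FinKer fin_one (dob Y j) \<and>
     const_pro_mor TYPE('i \<times> 'k) FinKer fin_one (dob Y j) d =
       Cmp (Pro FinKer) (const_pro FinKer fin_one) Y (const_pro FinKer (dob Y j))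
         (pro_proj FinKer Y j)
         (Cmp (Pro FinKer) (const_pro FinKer fin_one) X Y f (pro_point X x))"

section \<open>The Radon monad and its Kleisli category\<close>

definition topology_borel :: "'x topology \<Rightarrow> 'x measure" where
  "topology_borel X = sigma (topspace X) {U. openin X U}"

definition radon_measures :: "'x topology \<Rightarrow> 'x measure set" where
  "radon_measures X = {\<mu>. prob_space \<mu> \<and> sets \<mu> = sets (topology_borel X) \<and>
     (\<forall>A\<in>sets \<mu>. emeasure \<mu> A = (SUP K\<in>{K. compactin X K \<and> K \<subseteq> A}. emeasure \<mu> K))}"

text \<open>The coarsest topology for which all \<open>\<mu> \<mapsto> \<integral> f d\<mu>\<close>, \<open>f\<close> continuous, are continuous.\<close>

definition radon_space :: "'x topology \<Rightarrow> 'x measure topology" where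
  "radon_space X = topology_generated_by
     {{\<mu> \<in> radon_measures X. integral\<^sup>L \<mu> f \<in> U} | f U. continuous_map X euclideanreal f \<and> open U}"

definition radon_map :: "'y topology \<Rightarrow> ('x \<Rightarrow> 'y) \<Rightarrow> 'x measure \<Rightarrow> 'y measure" where
  "radon_map Y f \<mu> = distr \<mu> (topology_borel Y) f"

definition radon_unit :: "'x topology \<Rightarrow> 'x \<Rightarrow> 'x measure" where
  "radon_unit X x = return (topology_borel X) x"

definition radon_mult :: "'x topology \<Rightarrow> 'x measure measure \<Rightarrow> 'x measure" where
  "radon_mult X \<rho> = measure_of (topspace X) (sets (topology_borel X))
     (\<lambda>A. \<integral>\<^sup>+ \<mu>. emeasure \<mu> A \<partial>\<rho>)"

definition KleisliR :: "('x topology, 'x \<Rightarrow> 'x measure) cat" where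
  "KleisliR = \<lparr>
     Obj = {X. compact_space X \<and> Hausdorff_space X},
     Hom = (\<lambda>X Y. {f. continuous_map X (radon_space Y) f \<and> f \<in> extensional (topspace X)}),
     Idn = (\<lambda>X. \<lambda>x\<in>topspace X. radon_unit X x),
     Cmp = (\<lambda>X Y Z g f. \<lambda>x\<in>topspace X. radon_mult Z (radon_map (radon_space Z) g (f x)))\<rparr>"

section \<open>Kolmogorov extension\<close>

text \<open>
  For a pro-object \<open>Y\<close> with limit space \<open>L\<close>, the measure \<open>\<mu>\<close> is the Kolmogorov extension of the
  family \<open>p\<close> of morphisms \<open>p j : 1 \<rightarrow> Y\<^sub>j\<close>.
\<close>

definition compatible_family ::
  "('i, 'k, 'a set, 'a \<Rightarrow> 'a \<Rightarrow> real) diagram \<Rightarrow> ('i \<Rightarrow> 'a \<Rightarrow> 'a \<Rightarrow> real) \<Rightarrow> bool" where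
  "compatible_family Y p \<longleftrightarrow>
     (\<forall>j\<in>Obj (idx Y). p j \<in> Hom FinKer fin_one (dob Y j)) \<and>
     (\<forall>j\<in>Obj (idx Y). \<forall>j'\<in>Obj (idx Y). \<forall>w\<in>Hom (idx Y) j j'.
        Cmp FinKer fin_one (dob Y j) (dob Y j') (dmo Y j j' w) (p j) = p j')"

definition extends_family ::
  "('i, 'k, 'a set, 'a \<Rightarrow> 'a \<Rightarrow> real) diagram \<Rightarrow> ('i \<Rightarrow> 'a) topology
    \<Rightarrow> ('i \<Rightarrow> 'a \<Rightarrow> 'a \<Rightarrow> real) \<Rightarrow> ('i \<Rightarrow> 'a) measure \<Rightarrow> bool" where
  "extends_family Y L p \<mu> \<longleftrightarrow> \<mu> \<in> radon_measures L \<and>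
     (\<forall>j\<in>Obj (idx Y). distr \<mu> (count_space (dob Y j)) (\<lambda>y. y j) =
        point_measure (dob Y j) (\<lambda>y. ennreal (p j undefined y)))"

definition is_Kolmogorov_extension ::
  "('i, 'k, 'a set, 'a \<Rightarrow> 'a \<Rightarrow> real) diagram \<Rightarrow> ('i \<Rightarrow> 'a) topology
    \<Rightarrow> ('i \<Rightarrow> 'a \<Rightarrow> 'a \<Rightarrow> real) \<Rightarrow> ('i \<Rightarrow> 'a) measure \<Rightarrow> bool" where
  "is_Kolmogorov_extension Y L p \<mu> \<longleftrightarrow> compatible_family Y p \<and>
     extends_family Y L p \<mu> \<and> (\<forall>\<nu>. extends_family Y L p \<nu> \<longrightarrow> \<nu> = \<mu>)"

end

theory Submission
  imports Defs
begin

text \<open>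
  A point \<open>x\<close> of the limit of \<open>X\<close> picks, for each \<open>j\<close> and each representative \<open>a : X\<^sub>i \<rightarrow> Y\<^sub>j\<close> of the
  \<open>j\<close>-th component of \<open>f\<close>, the row \<open>a (x i)\<close> of a stochastic matrix. Two representatives agree after
  restriction to some \<open>X\<^sub>k\<close>, and the transition maps of \<open>X\<close> are functions that are compatible with \<open>x\<close>,
  so the row depends on \<open>j\<close> and \<open>x\<close> only (\<open>point_value_eq\<close>). The rows form a compatible family of
  distributions on the \<open>Y\<^sub>j\<close>, and the functor sends \<open>f\<close> to the map that takes \<open>x\<close> to its Kolmogorov
  extension. What has to be shown is that this extension exists, that it is continuous in \<open>x\<close>, that the
  assignment is functorial and faithful, and that its target is a category at all.

  Existence. Cylinders form an algebra of clopen sets that is a base of the topology of the limit. A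
  compatible family defines a content on it, because a set that no limit point reaches is already
  missed by some transition map (\<open>limit_point_exists\<close>, a compactness argument) and hence has weight
  zero. Since the index category need not be countable, the Borel sets need not be generated by
  the cylinders, and the usual extension theorem is not enough: as in the Riesz representation theorem,
  the content determines an outer measure via open sets, for which open sets are measurable
  (\<open>radon_extension\<close>). Radon measures are determined by their values on a clopen base, and
  functoriality follows by comparing values on cylinders (\<open>kernel_Idn\<close>, \<open>kernel_Cmp\<close>).

  Continuity. A continuous function on the limit of \<open>Y\<close> is uniformly close to a function of one
  coordinate \<open>y j\<close>, whose integral is a finite sum that depends on one coordinate \<open>x i\<close> only
  (\<open>continuous_kernel\<close>).

  Faithfulness. The image of the limit of \<open>X\<close> in \<open>X\<^sub>i\<close> is the image of a single transition map
  (\<open>stable_image\<close>), so two kernels out of \<open>X\<^sub>i\<close> that agree at the limit points agree after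
  restriction along that map, that is, they are equal in the colimit (\<open>det_morphism_eqI\<close>).

  The Kleisli category. The multiplication of the Radon monad integrates measures over a space of
  measures; on Borel \<open>\<sigma>\<close>-algebras it is the bind of the Giry monad, whose laws then give the category
  laws. The point is that bind stays within Radon measures (\<open>radon_measures_bind\<close>): the measure
  of an open set under a kernel is a directed supremum of continuous functions, indexed by a possibly
  uncountable set, and Radon measures commute with such suprema (\<open>nn_integral_SUP_directed\<close>).
\<close>

section \<open>Radon measures on compact Hausdorff spaces\<close>

lemma space_topology_borel [simp]: "space (topology_borel X) = topspace X"
  unfolding topology_borel_def by (rule space_measure_of) (auto dest: openin_subset)

lemma sets_topology_borel:
  "sets (topology_borel X) = sigma_sets (topspace X) {U. openin X U}"
  unfolding topology_borel_def by (rule sets_measure_of) (auto dest: openin_subset)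

lemma openin_in_sets: "openin X U \<Longrightarrow> U \<in> sets (topology_borel X)"
  by (simp add: sets_topology_borel sigma_sets.Basic)

lemma closedin_in_sets: "closedin X K \<Longrightarrow> K \<in> sets (topology_borel X)"
  using sets.compl_sets[OF openin_in_sets[of X "topspace X - K"]]
  by (simp add: closedin_def double_diff)

lemma compactin_in_sets: "\<lbrakk>Hausdorff_space X; compactin X K\<rbrakk> \<Longrightarrow> K \<in> sets (topology_borel X)"
  by (simp add: closedin_in_sets compactin_imp_closedin)

lemma radon_measuresD:
  assumes "\<mu> \<in> radon_measures X"
  shows "prob_space \<mu>" "sets \<mu> = sets (topology_borel X)" "space \<mu> = topspace X"
    "\<And>A. A \<in> sets (topology_borel X) \<Longrightarrow>
      emeasure \<mu> A = (SUP K\<in>{K. compactin X K \<and> K \<subseteq> A}. emeasure \<mu> K)"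
proof -
  show s: "sets \<mu> = sets (topology_borel X)"
    using assms by (simp add: radon_measures_def)
  show "prob_space \<mu>"
    using assms by (simp add: radon_measures_def)
  show "space \<mu> = topspace X"
    using sets_eq_imp_space_eq[OF s] by simp
  show "emeasure \<mu> A = (SUP K\<in>{K. compactin X K \<and> K \<subseteq> A}. emeasure \<mu> K)"
    if "A \<in> sets (topology_borel X)" for A
    using assms that unfolding radon_measures_def by auto
qed

lemma measurable_topology_borelI:
  assumes "\<And>U. openin Y U \<Longrightarrow> f -` U \<inter> space M \<in> sets M" "f \<in> space M \<rightarrow> topspace Y"
  shows "f \<in> measurable M (topology_borel Y)"
  by (rule measurable_sigma_sets[OF sets_topology_borel])
     (use assms in \<open>auto dest: openin_subset\<close>)

lemma continuous_map_measurable: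
  assumes "continuous_map X Y f"
  shows "f \<in> measurable (topology_borel X) (topology_borel Y)"
proof (rule measurable_topology_borelI)
  fix U assume "openin Y U"
  then have "openin X {x \<in> topspace X. f x \<in> U}"
    using assms openin_continuous_map_preimage by blast
  moreover have "f -` U \<inter> space (topology_borel X) = {x \<in> topspace X. f x \<in> U}" by auto
  ultimately show "f -` U \<inter> space (topology_borel X) \<in> sets (topology_borel X)"
    by (simp add: openin_in_sets)
qed (use assms in \<open>auto simp: continuous_map_def\<close>)

lemma lower_semicontinuous_measurable:
  fixes f :: "'x \<Rightarrow> ennreal"
  assumes "\<And>c. openin X {x \<in> topspace X. c < f x}"
  shows "f \<in> borel_measurable (topology_borel X)"
  by (rule borel_measurableI_greater) (use assms in \<open>simp add: openin_in_sets\<close>)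

lemma continuous_map_borel_measurable:
  fixes f :: "'x \<Rightarrow> real"
  assumes "continuous_map X euclideanreal f"
  shows "f \<in> borel_measurable (topology_borel X)"
proof (rule borel_measurableI)
  fix S :: "real set" assume "open S"
  then have "openin X {x \<in> topspace X. f x \<in> S}"
    using assms openin_continuous_map_preimage by fastforce
  moreover have "f -` S \<inter> space (topology_borel X) = {x \<in> topspace X. f x \<in> S}" by auto
  ultimately show "f -` S \<inter> space (topology_borel X) \<in> sets (topology_borel X)"
    by (simp add: openin_in_sets)
qed

lemma continuous_map_bounded:
  fixes f :: "'x \<Rightarrow> real"
  assumes "compact_space X" "continuous_map X euclideanreal f"
  obtains B where "\<And>x. x \<in> topspace X \<Longrightarrow> \<bar>f x\<bar> \<le> B"
proof -
  have "compactin euclideanreal (f ` topspace X)"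
    using assms image_compactin compact_space_def by blast
  then have "bounded (f ` topspace X)" by (simp add: compact_imp_bounded)
  then show ?thesis using that by (auto simp: bounded_iff)
qed

lemma radon_integrable:
  fixes f :: "'x \<Rightarrow> real"
  assumes "compact_space X" "\<mu> \<in> radon_measures X" "continuous_map X euclideanreal f"
  shows "integrable \<mu> f"
proof -
  obtain B where B: "\<And>x. x \<in> topspace X \<Longrightarrow> \<bar>f x\<bar> \<le> B"
    using continuous_map_bounded assms by blast
  interpret prob_space \<mu> using radon_measuresD[OF assms(2)] by simp
  show ?thesis
    by (rule integrable_const_bound[where B=B])
       (use B assms continuous_map_borel_measurable[OF assms(3)] radon_measuresD[OF assms(2)]
        in \<open>auto cong: measurable_cong_sets\<close>)
qed

text \<open>
  Sets squeezed up to \<open>\<epsilon>\<close> between a closed and an open set form a \<open>\<sigma>\<close>-algebra; an open set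
  belongs to it as soon as it is approximated from inside, and in a compact space closed sets
  are compact.
\<close>

lemma radon_measuresI:
  assumes X: "compact_space X" "Hausdorff_space X"
    and \<mu>: "prob_space \<mu>" "sets \<mu> = sets (topology_borel X)"
    and inner: "\<And>U e. openin X U \<Longrightarrow> 0 < e \<Longrightarrow>
      \<exists>K. closedin X K \<and> K \<subseteq> U \<and> measure \<mu> U < measure \<mu> K + e"
  shows "\<mu> \<in> radon_measures X"
proof -
  interpret prob_space \<mu> by fact
  note [simp] = openin_in_sets closedin_in_sets \<mu>(2)
  have reg: "\<forall>e>0. \<exists>K U. closedin X K \<and> openin X U \<and> K \<subseteq> A \<and> A \<subseteq> U \<and> measure \<mu> (U - K) < e"
    if "A \<in> sigma_sets (topspace X) {U. openin X U}" for A
    using that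
  proof (induction rule: sigma_sets.induct)
    case (Basic U)
    show ?case
    proof (intro allI impI)
      fix e :: real assume "0 < e"
      then obtain K where K: "closedin X K" "K \<subseteq> U" "measure \<mu> U < measure \<mu> K + e"
        using inner Basic by blast
      then have "measure \<mu> (U - K) < e"
        using Basic by (subst finite_measure_Diff) auto
      then show "\<exists>K V. closedin X K \<and> openin X V \<and> K \<subseteq> U \<and> U \<subseteq> V \<and> measure \<mu> (V - K) < e"
        using K Basic by (intro exI[of _ K] exI[of _ U]) simp
    qed
  next
    case Empty
    show ?case
      by (intro allI impI exI[of _ "{}"]) auto
  next
    case (Compl A)
    show ?case
    proof (intro allI impI)
      fix e :: real assume "0 < e"
      then obtain K U where KU: "closedin X K" "openin X U" "K \<subseteq> A" "A \<subseteq> U" "measure \<mu> (U - K) < e"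
        using Compl.IH by meson
      have "(topspace X - K) - (topspace X - U) = U - K"
        using openin_subset[OF KU(2)] by blast
      then have "measure \<mu> ((topspace X - K) - (topspace X - U)) < e"
        using KU(5) by simp
      moreover have "closedin X (topspace X - U)" "openin X (topspace X - K)"
        using KU(1,2) by auto
      ultimately show "\<exists>K U. closedin X K \<and> openin X U \<and> K \<subseteq> topspace X - A \<and> topspace X - A \<subseteq> U
          \<and> measure \<mu> (U - K) < e"
        by (intro exI[of _ "topspace X - U"] exI[of _ "topspace X - K"] conjI)
            (use KU in \<open>blast+\<close>)
    qed
  next
    case (Union A)
    show ?case
    proof (intro allI impI)
      fix e :: real assume e: "0 < e"
      have "\<exists>K U. closedin X K \<and> openin X U \<and> K \<subseteq> A n \<and> A n \<subseteq> U \<and>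
          measure \<mu> (U - K) < e / 2 * (1/2) ^ Suc n" for n
        using Union.IH[of n, rule_format, of "e / 2 * (1/2) ^ Suc n"] e by simp
      then obtain K U where KU: "\<And>n. closedin X (K n)" "\<And>n. openin X (U n)" "\<And>n. K n \<subseteq> A n"
          "\<And>n. A n \<subseteq> U n" "\<And>n. measure \<mu> (U n - K n) < e / 2 * (1/2) ^ Suc n"
        by metis
      have sums: "(\<lambda>n. e / 2 * (1/2) ^ Suc n) sums (e / 2 * 1)"
        by (intro sums_mult power_half_series)
      have summ: "summable (\<lambda>n. measure \<mu> (U n - K n))"
        by (rule summable_comparison_test_ev[OF _ sums_summable[OF sums]])
           (use KU(5) in \<open>auto intro!: always_eventually less_imp_le\<close>)
      have "measure \<mu> ((\<Union>n. U n) - (\<Union>n. K n)) \<le> measure \<mu> (\<Union>n. U n - K n)"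
        by (rule finite_measure_mono) (use KU(1,2) in \<open>auto intro!: sets.countable_UN'' sets.Diff\<close>)
      also have "\<dots> \<le> (\<Sum>n. measure \<mu> (U n - K n))"
        by (rule finite_measure_subadditive_countably) (use KU(1,2) summ in \<open>auto intro!: sets.Diff\<close>)
      also have "\<dots> \<le> (\<Sum>n. e / 2 * (1/2) ^ Suc n)"
        by (rule suminf_le[OF _ summ sums_summable[OF sums]]) (use KU(5) in \<open>auto intro: less_imp_le\<close>)
      also have "\<dots> = e / 2" using sums_unique[OF sums] by simp
      finally have UK: "measure \<mu> ((\<Union>n. U n) - (\<Union>n. K n)) \<le> e / 2" .
      have "(\<lambda>N. measure \<mu> (\<Union>n\<le>N. K n)) \<longlonglongrightarrow> measure \<mu> (\<Union>N. \<Union>n\<le>N. K n)"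
        by (rule finite_Lim_measure_incseq)
           (use KU(1) in \<open>force simp: incseq_def\<close>)+
      moreover have "(\<Union>N. \<Union>n\<le>N. K n) = (\<Union>n. K n)" by auto
      ultimately have "(\<lambda>N. measure \<mu> (\<Union>n\<le>N. K n)) \<longlonglongrightarrow> measure \<mu> (\<Union>n. K n)" by simp
      moreover have "measure \<mu> (\<Union>n. K n) - e / 2 < measure \<mu> (\<Union>n. K n)" using e by simp
      ultimately have "eventually (\<lambda>N. measure \<mu> (\<Union>n. K n) - e / 2 < measure \<mu> (\<Union>n\<le>N. K n)) sequentially"
        by (rule order_tendstoD)
      then obtain N where N: "measure \<mu> (\<Union>n. K n) - e / 2 < measure \<mu> (\<Union>n\<le>N. K n)"
        by (auto simp: eventually_sequentially)
      have KsubU: "(\<Union>n. K n) \<subseteq> (\<Union>n. U n)" "(\<Union>n\<le>N. K n) \<subseteq> (\<Union>n. U n)"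
        using KU(3,4) by blast+
      have m: "(\<Union>n. U n) \<in> sets \<mu>" "(\<Union>n. K n) \<in> sets \<mu>" "(\<Union>n\<le>N. K n) \<in> sets \<mu>"
        using KU(1,2) by auto
      have "measure \<mu> ((\<Union>n. U n) - (\<Union>n\<le>N. K n)) = measure \<mu> (\<Union>n. U n) - measure \<mu> (\<Union>n\<le>N. K n)"
        using finite_measure_Diff[OF m(1,3) KsubU(2)] .
      moreover have "measure \<mu> ((\<Union>n. U n) - (\<Union>n. K n)) = measure \<mu> (\<Union>n. U n) - measure \<mu> (\<Union>n. K n)"
        using finite_measure_Diff[OF m(1,2) KsubU(1)] .
      ultimately have "measure \<mu> ((\<Union>n. U n) - (\<Union>n\<le>N. K n)) < e"
        using N UK by linarith
      moreover have "closedin X (\<Union>n\<le>N. K n)" "openin X (\<Union>n. U n)"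
        using KU(1,2) by (auto intro!: closedin_Union openin_Union)
      moreover have "(\<Union>n\<le>N. K n) \<subseteq> (\<Union>n. A n)" "(\<Union>n. A n) \<subseteq> (\<Union>n. U n)"
        using KU(3,4) by blast+
      ultimately show "\<exists>K U. closedin X K \<and> openin X U \<and> K \<subseteq> (\<Union>n. A n) \<and> (\<Union>n. A n) \<subseteq> U \<and>
          measure \<mu> (U - K) < e"
        by blast
    qed
  qed
  show ?thesis
    unfolding radon_measures_def
  proof (intro CollectI conjI ballI)
    fix A assume A: "A \<in> sets \<mu>"
    show "emeasure \<mu> A = (SUP K\<in>{K. compactin X K \<and> K \<subseteq> A}. emeasure \<mu> K)"
    proof (rule antisym)
      show "(SUP K\<in>{K. compactin X K \<and> K \<subseteq> A}. emeasure \<mu> K) \<le> emeasure \<mu> A"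
        using A by (auto intro!: SUP_least emeasure_mono)
      show "emeasure \<mu> A \<le> (SUP K\<in>{K. compactin X K \<and> K \<subseteq> A}. emeasure \<mu> K)"
      proof (rule ennreal_le_epsilon)
        fix e :: real assume e: "0 < e"
        obtain K U where KU: "closedin X K" "openin X U" "K \<subseteq> A" "A \<subseteq> U" "measure \<mu> (U - K) < e"
          using reg[of A] A e by (auto simp: sets_topology_borel)
        have "measure \<mu> (A - K) \<le> measure \<mu> (U - K)"
          by (rule finite_measure_mono) (use KU in auto)
        moreover have "measure \<mu> (A - K) = measure \<mu> A - measure \<mu> K"
          using KU A by (intro finite_measure_Diff) auto
        ultimately have "measure \<mu> A \<le> measure \<mu> K + e" using KU by linarith
        then have "emeasure \<mu> A \<le> emeasure \<mu> K + ennreal e"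
          using e by (simp add: emeasure_eq_measure flip: ennreal_plus)
        also have "emeasure \<mu> K \<le> (SUP K\<in>{K. compactin X K \<and> K \<subseteq> A}. emeasure \<mu> K)"
          using KU X by (auto intro!: SUP_upper closedin_compact_space)
        finally show "emeasure \<mu> A \<le> (SUP K\<in>{K. compactin X K \<and> K \<subseteq> A}. emeasure \<mu> K) + ennreal e"
          by (simp add: add_right_mono)
      qed
    qed
  qed (use \<mu> in auto)
qed

lemma radon_inner_compact:
  assumes "\<mu> \<in> radon_measures X" "A \<in> sets (topology_borel X)" "c < emeasure \<mu> A"
  obtains K where "compactin X K" "K \<subseteq> A" "c < emeasure \<mu> K"
  using assms radon_measuresD(4)[OF assms(1,2)] by (auto simp: less_SUP_iff)

definition cont_below :: "'x topology \<Rightarrow> 'x set \<Rightarrow> ('x \<Rightarrow> real) set" where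
  "cont_below X U = {h. continuous_map X euclideanreal h \<and>
     (\<forall>x\<in>topspace X. 0 \<le> h x \<and> h x \<le> indicator U x)}"

lemma cont_below_Urysohn:
  assumes "compact_space X" "Hausdorff_space X" "closedin X K" "openin X U" "K \<subseteq> U"
  obtains h where "h \<in> cont_below X U" "\<And>x. x \<in> K \<Longrightarrow> h x = 1"
proof -
  have "normal_space X"
    using assms compact_Hausdorff_or_regular_imp_normal_space by blast
  moreover have "closedin X (topspace X - U)" "disjnt (topspace X - U) K"
    using assms by (auto simp: disjnt_def)
  ultimately obtain h where h: "continuous_map X (subtopology euclideanreal {0..1}) h"
      "h ` (topspace X - U) \<subseteq> {0}" "h ` K \<subseteq> {1::real}"
    using Urysohn_lemma[of X "topspace X - U" K 0 1] assms by auto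
  have "h \<in> cont_below X U"
    using h unfolding cont_below_def continuous_map_in_subtopology
    by (fastforce simp: indicator_def)
  then show ?thesis using that h by blast
qed

lemma cont_below_zero: "(\<lambda>_. 0) \<in> cont_below X U"
  by (simp add: cont_below_def)

lemma cont_below_max:
  "\<lbrakk>f \<in> cont_below X U; g \<in> cont_below X U\<rbrakk> \<Longrightarrow> (\<lambda>x. max (f x) (g x)) \<in> cont_below X U"
  by (auto simp: cont_below_def intro!: continuous_map_real_max)

lemma cont_below_continuous: "h \<in> cont_below X U \<Longrightarrow> continuous_map X euclideanreal h"
  by (simp add: cont_below_def)

lemma cont_below_nn_integral:
  assumes "compact_space X" "\<mu> \<in> radon_measures X" "h \<in> cont_below X U"
  shows "(\<integral>\<^sup>+x. ennreal (h x) \<partial>\<mu>) = ennreal (integral\<^sup>L \<mu> h)"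
  by (rule nn_integral_eq_integral)
     (use assms radon_measuresD(3)[OF assms(2)] radon_integrable[OF assms(1,2)]
      in \<open>auto simp: cont_below_def\<close>)

text \<open>
  Urysohn functions interpolate between an open set and the compact sets inside it, so inner
  regularity expresses the measure of an open set by integrals of continuous functions.
\<close>

lemma emeasure_open_eq_SUP:
  assumes X: "compact_space X" "Hausdorff_space X" and \<mu>: "\<mu> \<in> radon_measures X"
    and U: "openin X U"
  shows "emeasure \<mu> U = (SUP h\<in>cont_below X U. ennreal (integral\<^sup>L \<mu> h))"
proof (rule antisym)
  show "emeasure \<mu> U \<le> (SUP h\<in>cont_below X U. ennreal (integral\<^sup>L \<mu> h))"
  proof (rule dense_le)
    fix c assume "c < emeasure \<mu> U"
    then obtain K where K: "compactin X K" "K \<subseteq> U" "c < emeasure \<mu> K"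
      using radon_inner_compact[OF \<mu>] U openin_in_sets by metis
    then have clK: "closedin X K" using X compactin_imp_closedin by blast
    obtain h where h: "h \<in> cont_below X U" "\<And>x. x \<in> K \<Longrightarrow> h x = 1"
      using cont_below_Urysohn[OF X clK U K(2)] by blast
    have "emeasure \<mu> K = (\<integral>\<^sup>+x. indicator K x \<partial>\<mu>)"
      using clK by (simp add: closedin_in_sets radon_measuresD(2)[OF \<mu>])
    also have "\<dots> \<le> (\<integral>\<^sup>+x. ennreal (h x) \<partial>\<mu>)"
      by (rule nn_integral_mono) (use h(2) in \<open>auto simp: indicator_def\<close>)
    also have "\<dots> = ennreal (integral\<^sup>L \<mu> h)"
      by (rule cont_below_nn_integral[OF X(1) \<mu> h(1)])
    finally have "c \<le> ennreal (integral\<^sup>L \<mu> h)" using K(3) by simp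
    also have "\<dots> \<le> (SUP h\<in>cont_below X U. ennreal (integral\<^sup>L \<mu> h))"
      using h(1) by (rule SUP_upper)
    finally show "c \<le> (SUP h\<in>cont_below X U. ennreal (integral\<^sup>L \<mu> h))" .
  qed
  show "(SUP h\<in>cont_below X U. ennreal (integral\<^sup>L \<mu> h)) \<le> emeasure \<mu> U"
  proof (rule SUP_least)
    fix h assume h: "h \<in> cont_below X U"
    have "ennreal (integral\<^sup>L \<mu> h) = (\<integral>\<^sup>+x. ennreal (h x) \<partial>\<mu>)"
      by (rule cont_below_nn_integral[OF X(1) \<mu> h, symmetric])
    also have "\<dots> \<le> (\<integral>\<^sup>+x. indicator U x \<partial>\<mu>)"
    proof (rule nn_integral_mono)
      fix x assume "x \<in> space \<mu>"
      then have "h x \<le> indicator U x"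
        using h radon_measuresD(3)[OF \<mu>] by (simp add: cont_below_def)
      then have "ennreal (h x) \<le> ennreal (indicator U x)" by (rule ennreal_leI)
      then show "ennreal (h x) \<le> indicator U x" by (simp add: ennreal_indicator)
    qed
    also have "\<dots> = emeasure \<mu> U"
      using U by (simp add: openin_in_sets radon_measuresD(2)[OF \<mu>])
    finally show "ennreal (integral\<^sup>L \<mu> h) \<le> emeasure \<mu> U" .
  qed
qed


lemma compactin_finite_subcover:
  assumes "compactin X K" "\<And>i. i \<in> I \<Longrightarrow> openin X (U i)" "K \<subseteq> (\<Union>i\<in>I. U i)"
  obtains J where "J \<subseteq> I" "finite J" "K \<subseteq> (\<Union>i\<in>J. U i)"
proof -
  obtain V where V: "finite V" "V \<subseteq> U ` I" "K \<subseteq> \<Union>V"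
    using compactinD[OF assms(1), of "U ` I"] assms(2,3) by auto
  then obtain J where "J \<subseteq> I" "finite J" "V = U ` J"
    using finite_subset_image[of V U I] by blast
  then show ?thesis using that V(3) by blast
qed

lemma AE_le_if_nn_integral_max_le:
  fixes f g :: "'x \<Rightarrow> ennreal"
  assumes f: "f \<in> borel_measurable M" and g: "g \<in> borel_measurable M"
    and fin: "(\<integral>\<^sup>+x. g x \<partial>M) \<noteq> \<infinity>"
    and le: "(\<integral>\<^sup>+x. max (f x) (g x) \<partial>M) \<le> (\<integral>\<^sup>+x. g x \<partial>M)"
  shows "AE x in M. f x \<le> g x"
proof -
  have "(\<integral>\<^sup>+x. max (f x) (g x) - g x \<partial>M) = (\<integral>\<^sup>+x. max (f x) (g x) \<partial>M) - (\<integral>\<^sup>+x. g x \<partial>M)"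
    by (rule nn_integral_diff) (use fin f g in auto)
  also have "\<dots> = 0"
    using le fin by (intro diff_eq_0_ennreal) (auto simp: top.not_eq_extremum)
  finally have "AE x in M. max (f x) (g x) - g x = 0"
    using f g by (subst (asm) nn_integral_0_iff_AE) auto
  moreover have "AE x in M. g x \<noteq> \<infinity>"
    by (rule nn_integral_PInf_AE[OF g fin])
  ultimately show ?thesis
  proof eventually_elim
    case (elim x)
    then have "max (f x) (g x) \<le> g x" by (simp add: diff_eq_0_iff_ennreal)
    then show ?case by simp
  qed
qed

text \<open>
  A sequence in the directed family \<open>F\<close> exhausts the supremum of the integrals. Its pointwise supremum
  \<open>g\<close> dominates every single member of \<open>F\<close> almost everywhere, since otherwise directedness would push
  the integral higher.
\<close>

lemma directed_nn_integral_exhaustion: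
  fixes F :: "('x \<Rightarrow> ennreal) set"
  assumes meas: "\<And>f. f \<in> F \<Longrightarrow> f \<in> borel_measurable M"
    and F: "F \<noteq> {}"
    and directed: "\<And>f g. \<lbrakk>f \<in> F; g \<in> F\<rbrakk> \<Longrightarrow> \<exists>h\<in>F. \<forall>x\<in>space M. f x \<le> h x \<and> g x \<le> h x"
    and fin: "(SUP f\<in>F. \<integral>\<^sup>+x. f x \<partial>M) \<noteq> \<infinity>"
  obtains g where "g \<in> borel_measurable M"
    "(\<integral>\<^sup>+x. g x \<partial>M) \<le> (SUP f\<in>F. \<integral>\<^sup>+x. f x \<partial>M)" "\<And>f. f \<in> F \<Longrightarrow> AE x in M. f x \<le> g x"
proof -
  define s where "s = (SUP f\<in>F. \<integral>\<^sup>+x. f x \<partial>M)"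
  obtain I :: "nat \<Rightarrow> ennreal" where I: "incseq I" "range I \<subseteq> (\<lambda>f. \<integral>\<^sup>+x. f x \<partial>M) ` F" "s = (SUP n. I n)"
    unfolding s_def using ennreal_Sup_countable_SUP[of "(\<lambda>f. \<integral>\<^sup>+x. f x \<partial>M) ` F"] F by auto
  have "\<exists>f\<in>F. I n = (\<integral>\<^sup>+x. f x \<partial>M)" for n
    using I(2) by blast
  then obtain f where f: "\<And>n. f n \<in> F" "\<And>n. I n = (\<integral>\<^sup>+x. f n x \<partial>M)" by metis
  define g where "g = (\<lambda>x. SUP n. f n x)"
  have g_meas: "g \<in> borel_measurable M"
    unfolding g_def by (intro borel_measurable_SUP) (auto simp: meas f)
  have bound: "\<exists>h\<in>F. \<forall>x\<in>space M. k x \<le> h x \<and> (\<forall>n\<le>N. f n x \<le> h x)" if "k \<in> F" for k N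
  proof (induction N)
    case 0
    show ?case using directed[OF that f(1)[of 0]] by auto
  next
    case (Suc N)
    then obtain h where h: "h \<in> F" "\<And>x. x \<in> space M \<Longrightarrow> k x \<le> h x"
        "\<And>x n. x \<in> space M \<Longrightarrow> n \<le> N \<Longrightarrow> f n x \<le> h x" by blast
    obtain h' where h': "h' \<in> F" "\<And>x. x \<in> space M \<Longrightarrow> h x \<le> h' x"
        "\<And>x. x \<in> space M \<Longrightarrow> f (Suc N) x \<le> h' x"
      using directed[OF h(1) f(1)[of "Suc N"]] by blast
    show ?case
    proof (intro bexI[of _ h'] ballI conjI allI impI h'(1))
      fix x assume x: "x \<in> space M"
      show "k x \<le> h' x" using h(2)[OF x] h'(2)[OF x] by (rule order_trans)
      fix n assume "n \<le> Suc N"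
      then consider "n \<le> N" | "n = Suc N" by linarith
      then show "f n x \<le> h' x"
      proof cases
        case 1
        show ?thesis using h(3)[OF x 1] h'(2)[OF x] by (rule order_trans)
      qed (simp add: h'(3)[OF x])
    qed
  qed
  have max_le: "(\<integral>\<^sup>+x. max (k x) (g x) \<partial>M) \<le> s" if k: "k \<in> F" for k
  proof -
    define G where "G N x = max (k x) (SUP n\<in>{..N}. f n x)" for N :: nat and x
    have Ginc: "incseq G"
      unfolding incseq_def le_fun_def G_def
      by (intro allI impI max.mono SUP_subset_mono) auto
    have SUP_G: "max (k x) (g x) = (SUP N. G N x)" for x
    proof (rule antisym)
      have "k x \<le> (SUP N. G N x)"
        by (rule SUP_upper2[of 0]) (simp_all add: G_def)
      moreover have "f n x \<le> (SUP N. G N x)" for n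
        by (rule SUP_upper2[of n]) (auto simp: G_def intro!: max.coboundedI2 SUP_upper)
      ultimately show "max (k x) (g x) \<le> (SUP N. G N x)"
        unfolding g_def by (intro max.boundedI SUP_least)
      show "(SUP N. G N x) \<le> max (k x) (g x)"
        unfolding G_def g_def by (intro SUP_least max.mono SUP_subset_mono) auto
    qed
    have "(\<integral>\<^sup>+x. max (k x) (g x) \<partial>M) = (SUP N. \<integral>\<^sup>+x. G N x \<partial>M)"
      unfolding SUP_G
      by (rule nn_integral_monotone_convergence_SUP[OF Ginc])
         (unfold G_def, intro borel_measurable_max borel_measurable_SUP meas k f, auto)
    also have "\<dots> \<le> s"
    proof (rule SUP_least)
      fix N
      obtain h where h: "h \<in> F" "\<And>x. x \<in> space M \<Longrightarrow> k x \<le> h x"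
          "\<And>x n. x \<in> space M \<Longrightarrow> n \<le> N \<Longrightarrow> f n x \<le> h x"
        using bound[OF k] by blast
      have "(\<integral>\<^sup>+x. G N x \<partial>M) \<le> (\<integral>\<^sup>+x. h x \<partial>M)"
        unfolding G_def using h(2,3) by (intro nn_integral_mono max.boundedI SUP_least) auto
      also have "\<dots> \<le> s" unfolding s_def using h(1) by (rule SUP_upper)
      finally show "(\<integral>\<^sup>+x. G N x \<partial>M) \<le> s" .
    qed
    finally show ?thesis .
  qed
  have s_le: "s \<le> (\<integral>\<^sup>+x. g x \<partial>M)"
    unfolding I(3) f(2) g_def by (intro SUP_least nn_integral_mono SUP_upper) simp
  obtain k where "k \<in> F" using F by blast
  have g_le: "(\<integral>\<^sup>+x. g x \<partial>M) \<le> s"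
    by (rule order_trans[OF nn_integral_mono max_le[OF \<open>k \<in> F\<close>]]) simp
  show ?thesis
  proof
    show "AE x in M. f x \<le> g x" if "f \<in> F" for f
    proof (rule AE_le_if_nn_integral_max_le[OF meas[OF that] g_meas])
      show "(\<integral>\<^sup>+x. g x \<partial>M) \<noteq> \<infinity>" using g_le fin[folded s_def] neq_top_trans by auto
      show "(\<integral>\<^sup>+x. max (f x) (g x) \<partial>M) \<le> (\<integral>\<^sup>+x. g x \<partial>M)" using max_le[OF that] s_le by simp
    qed
  qed (use g_meas g_le in \<open>simp_all add: s_def\<close>)
qed

text \<open>
  A Radon measure commutes with directed suprema of lower semicontinuous functions, of whatever
  cardinality: let \<open>g\<close> be the supremum of an exhausting sequence in \<open>F\<close>. On a compact subset of
  \<open>{g \<le> q < sup F}\<close> finitely many members of \<open>F\<close> suffice to exceed \<open>q\<close> at each point; each of them is at most \<open>g\<close> almost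
  everywhere, so the compact set is null. Inner regularity then shows that
  \<open>g = sup F\<close> almost everywhere.
\<close>

lemma nn_integral_SUP_directed:
  fixes F :: "('x \<Rightarrow> ennreal) set"
  assumes X: "Hausdorff_space X" and \<mu>: "\<mu> \<in> radon_measures X"
    and lsc: "\<And>f c. f \<in> F \<Longrightarrow> openin X {x \<in> topspace X. c < f x}"
    and F: "F \<noteq> {}"
    and directed: "\<And>f g. \<lbrakk>f \<in> F; g \<in> F\<rbrakk> \<Longrightarrow> \<exists>h\<in>F. \<forall>x\<in>topspace X. f x \<le> h x \<and> g x \<le> h x"
  shows "(\<integral>\<^sup>+x. (SUP f\<in>F. f x) \<partial>\<mu>) = (SUP f\<in>F. \<integral>\<^sup>+x. f x \<partial>\<mu>)"
proof (rule antisym)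
  define s where "s = (SUP f\<in>F. \<integral>\<^sup>+x. f x \<partial>\<mu>)"
  have meas: "f \<in> borel_measurable \<mu>" if "f \<in> F" for f
    using lower_semicontinuous_measurable[of X f] lsc[OF that] radon_measuresD(2)[OF \<mu>]
    by (simp cong: measurable_cong_sets)
  have sp: "space \<mu> = topspace X" by (rule radon_measuresD(3)[OF \<mu>])
  show "(SUP f\<in>F. \<integral>\<^sup>+x. f x \<partial>\<mu>) \<le> (\<integral>\<^sup>+x. (SUP f\<in>F. f x) \<partial>\<mu>)"
    by (intro SUP_least nn_integral_mono SUP_upper) simp
  show "(\<integral>\<^sup>+x. (SUP f\<in>F. f x) \<partial>\<mu>) \<le> (SUP f\<in>F. \<integral>\<^sup>+x. f x \<partial>\<mu>)"
  proof (cases "s = \<infinity>")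
    case True
    then show ?thesis by (simp only: s_def infinity_ennreal_def top_greatest)
  next
    case False
    obtain g where g_meas: "g \<in> borel_measurable \<mu>" and g_le: "(\<integral>\<^sup>+x. g x \<partial>\<mu>) \<le> s"
      and dom: "\<And>f. f \<in> F \<Longrightarrow> AE x in \<mu>. f x \<le> g x"
    proof (rule directed_nn_integral_exhaustion[of F \<mu>])
      show "(SUP f\<in>F. \<integral>\<^sup>+x. f x \<partial>\<mu>) \<noteq> \<infinity>" using False unfolding s_def .
    qed (use meas F directed sp in \<open>auto simp: s_def\<close>)
    define A where "A q = {x \<in> space \<mu>. g x \<le> q \<and> q < (SUP f\<in>F. f x)}" for q
    have Aset: "A q \<in> sets (topology_borel X)" for q
    proof -
      have "{x \<in> topspace X. q < (SUP f\<in>F. f x)} = (\<Union>f\<in>F. {x \<in> topspace X. q < f x})"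
        by (auto simp: less_SUP_iff)
      then have "openin X {x \<in> topspace X. q < (SUP f\<in>F. f x)}" using lsc by auto
      then have "{x \<in> topspace X. q < (SUP f\<in>F. f x)} \<in> sets \<mu>"
        by (simp add: openin_in_sets radon_measuresD(2)[OF \<mu>])
      moreover have "{x \<in> space \<mu>. g x \<le> q} \<in> sets \<mu>" using g_meas by measurable
      ultimately have "{x \<in> space \<mu>. g x \<le> q} \<inter> {x \<in> topspace X. q < (SUP f\<in>F. f x)} \<in> sets \<mu>" by auto
      moreover have "{x \<in> space \<mu>. g x \<le> q} \<inter> {x \<in> topspace X. q < (SUP f\<in>F. f x)} = A q"
        using sp by (auto simp: A_def)
      ultimately show ?thesis by (simp add: radon_measuresD(2)[OF \<mu>])
    qed
    have null: "emeasure \<mu> (A q) = 0" for q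
    proof -
      have "emeasure \<mu> K = 0" if K: "compactin X K" "K \<subseteq> A q" for K
      proof -
        have "K \<subseteq> (\<Union>f\<in>F. {x \<in> topspace X. q < f x})"
          using K sp by (auto simp: less_SUP_iff A_def)
        then obtain F0 where F0: "F0 \<subseteq> F" "finite F0" "K \<subseteq> (\<Union>f\<in>F0. {x \<in> topspace X. q < f x})"
          using compactin_finite_subcover[OF K(1), of F "\<lambda>f. {x \<in> topspace X. q < f x}"] lsc by auto
        have "AE x in \<mu>. \<forall>k\<in>F0. k x \<le> g x"
          using F0 dom by (subst AE_finite_all) auto
        moreover have "AE x in \<mu>. x \<in> space \<mu>" by simp
        ultimately have "AE x in \<mu>. x \<notin> K"
        proof eventually_elim
          case (elim x)
          show ?case
          proof
            assume "x \<in> K"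
            then have "g x \<le> q" using K(2) by (auto simp: A_def)
            moreover obtain k where "k \<in> F0" "q < k x" using \<open>x \<in> K\<close> F0(3) by auto
            ultimately show False using elim by fastforce
          qed
        qed
        then have "{x \<in> space \<mu>. x \<in> K} \<in> null_sets \<mu>"
          by (subst (asm) AE_iff_null)
             (use K(1) X sp compactin_subset_topspace[OF K(1)] in
               \<open>auto simp: Int_absorb1 radon_measuresD(2)[OF \<mu>] compactin_in_sets Collect_conj_eq\<close>)
        moreover have "{x \<in> space \<mu>. x \<in> K} = K"
          using compactin_subset_topspace[OF K(1)] sp by blast
        ultimately show ?thesis by auto
      qed
      then show ?thesis
        unfolding radon_measuresD(4)[OF \<mu> Aset[of q]] by (auto intro!: antisym SUP_least)
    qed
    have "AE x in \<mu>. \<forall>q\<in>range (\<lambda>r::rat. ennreal (of_rat r)). \<not> (g x \<le> q \<and> q < (SUP f\<in>F. f x))"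
    proof (subst AE_ball_countable, simp, intro ballI)
      fix q
      have "A q \<in> null_sets \<mu>"
        using null[of q] Aset[of q] radon_measuresD(2)[OF \<mu>] by (simp add: null_sets_def)
      then show "AE x in \<mu>. \<not> (g x \<le> q \<and> q < (SUP f\<in>F. f x))"
        by (rule AE_I') (auto simp: A_def)
    qed
    then have "AE x in \<mu>. (SUP f\<in>F. f x) \<le> g x"
    proof eventually_elim
      case (elim x)
      show ?case
      proof (rule ccontr)
        assume "\<not> (SUP f\<in>F. f x) \<le> g x"
        then obtain r where "g x < ennreal (of_rat r)" "ennreal (of_rat r) < (SUP f\<in>F. f x)"
          using ennreal_rat_dense[of "g x"] by (auto simp: not_le)
        then show False using elim by (auto dest: less_imp_le)
      qed
    qed
    then have "(\<integral>\<^sup>+x. (SUP f\<in>F. f x) \<partial>\<mu>) \<le> (\<integral>\<^sup>+x. g x \<partial>\<mu>)" by (rule nn_integral_mono_AE)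
    also have "\<dots> \<le> s" by (rule g_le)
    finally show ?thesis by (simp add: s_def)
  qed
qed

section \<open>The Kleisli category of the Radon monad\<close>

lemma topspace_radon_space: "topspace (radon_space X) = radon_measures X"
proof
  show "topspace (radon_space X) \<subseteq> radon_measures X"
    unfolding radon_space_def topology_generated_by_topspace by blast
  have "{\<mu> \<in> radon_measures X. integral\<^sup>L \<mu> (\<lambda>_. 0 :: real) \<in> UNIV}
      \<in> {{\<mu> \<in> radon_measures X. integral\<^sup>L \<mu> f \<in> U} | f U. continuous_map X euclideanreal f \<and> open U}"
    by (rule CollectI, rule exI[of _ "\<lambda>_. 0"], rule exI[of _ UNIV]) simp
  then show "radon_measures X \<subseteq> topspace (radon_space X)"
    unfolding radon_space_def topology_generated_by_topspace by blast
qed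

lemma continuous_map_radon_space_iff:
  "continuous_map T (radon_space X) g \<longleftrightarrow> g \<in> topspace T \<rightarrow> radon_measures X \<and>
     (\<forall>h. continuous_map X euclideanreal h \<longrightarrow> continuous_map T euclideanreal (\<lambda>t. integral\<^sup>L (g t) h))"
  (is "?L \<longleftrightarrow> ?R")
proof
  assume L: ?L
  show ?R
  proof (intro conjI allI impI)
    show g: "g \<in> topspace T \<rightarrow> radon_measures X"
      using L by (auto simp: continuous_map_def topspace_radon_space)
    fix h assume h: "continuous_map X euclideanreal h"
    show "continuous_map T euclideanreal (\<lambda>t. integral\<^sup>L (g t) h)"
      unfolding continuous_map_def
    proof (intro conjI allI impI)
      fix U :: "real set" assume "openin euclideanreal U"
      then have "openin (radon_space X) {\<mu> \<in> radon_measures X. integral\<^sup>L \<mu> h \<in> U}"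
        unfolding radon_space_def using h by (intro topology_generated_by_Basis) auto
      then have "openin T {t \<in> topspace T. g t \<in> {\<mu> \<in> radon_measures X. integral\<^sup>L \<mu> h \<in> U}}"
        using L openin_continuous_map_preimage by blast
      moreover have "{t \<in> topspace T. g t \<in> {\<mu> \<in> radon_measures X. integral\<^sup>L \<mu> h \<in> U}} =
          {t \<in> topspace T. integral\<^sup>L (g t) h \<in> U}"
        using g by auto
      ultimately show "openin T {t \<in> topspace T. integral\<^sup>L (g t) h \<in> U}" by simp
    qed simp
  qed
next
  assume R: ?R
  show ?L
    unfolding radon_space_def
  proof (rule continuous_on_generated_topo)
    fix V assume "V \<in> {{\<mu> \<in> radon_measures X. integral\<^sup>L \<mu> f \<in> U} | f U.
        continuous_map X euclideanreal f \<and> open U}"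
    then obtain f U where V: "V = {\<mu> \<in> radon_measures X. integral\<^sup>L \<mu> f \<in> U}"
      and f: "continuous_map X euclideanreal f" and U: "open U" by auto
    have "openin T {t \<in> topspace T. integral\<^sup>L (g t) f \<in> U}"
      by (rule openin_continuous_map_preimage[of T euclideanreal]) (use R f U in auto)
    moreover have "{t \<in> topspace T. integral\<^sup>L (g t) f \<in> U} = g -` V \<inter> topspace T"
      unfolding V using R by auto
    ultimately show "openin T (g -` V \<inter> topspace T)" by simp
  next
    have "g ` topspace T \<subseteq> topspace (radon_space X)"
      using R by (auto simp: topspace_radon_space)
    then show "g ` topspace T \<subseteq> \<Union> {{\<mu> \<in> radon_measures X. integral\<^sup>L \<mu> f \<in> U} | f U.
        continuous_map X euclideanreal f \<and> open U}"
      unfolding radon_space_def topology_generated_by_topspace .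
  qed
qed

lemma continuous_map_radonD:
  assumes "continuous_map T (radon_space X) g" "t \<in> topspace T"
  shows "g t \<in> radon_measures X"
  using assms by (auto simp: continuous_map_radon_space_iff)

lemma openin_less_ennreal:
  assumes f: "continuous_map T euclideanreal f"
  shows "openin T {t \<in> topspace T. c < ennreal (f t)}"
proof -
  have "open {r :: real. c < ennreal r}"
    by (intro open_Collect_less continuous_intros continuous_on_ennreal)
  then show ?thesis
    using openin_continuous_map_preimage[OF f, of "{r. c < ennreal r}"] by simp
qed

text \<open>The measure of an open set is a supremum of integrals of continuous functions.\<close>

lemma radon_kernel_lower_semicontinuous:
  assumes X: "compact_space X" "Hausdorff_space X"
    and g: "continuous_map T (radon_space X) g" and U: "openin X U"
  shows "openin T {t \<in> topspace T. c < emeasure (g t) U}"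
proof -
  have "{t \<in> topspace T. c < emeasure (g t) U} =
      (\<Union>h\<in>cont_below X U. {t \<in> topspace T. c < ennreal (integral\<^sup>L (g t) h)})"
    using continuous_map_radonD[OF g] by (auto simp: emeasure_open_eq_SUP[OF X _ U] less_SUP_iff)
  moreover have "openin T {t \<in> topspace T. c < ennreal (integral\<^sup>L (g t) h)}"
    if "h \<in> cont_below X U" for h
    using g cont_below_continuous[OF that]
    by (intro openin_less_ennreal) (simp add: continuous_map_radon_space_iff)
  ultimately show ?thesis by auto
qed

lemma radon_kernel_measurable:
  assumes X: "compact_space X" "Hausdorff_space X" and g: "continuous_map T (radon_space X) g"
  shows "g \<in> topology_borel T \<rightarrow>\<^sub>M prob_algebra (topology_borel X)"
proof (rule measurable_prob_algebra_generated[OF sets_topology_borel])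
  show "Int_stable {U. openin X U}" by (auto simp: Int_stable_def)
  show "{U. openin X U} \<subseteq> Pow (topspace X)" by (auto dest: openin_subset)
next
  fix t assume "t \<in> space (topology_borel T)"
  then have "g t \<in> radon_measures X" using continuous_map_radonD[OF g] by simp
  then show "prob_space (g t)" "sets (g t) = sets (topology_borel X)"
    using radon_measuresD by blast+
next
  fix U assume "U \<in> {U. openin X U}"
  then show "(\<lambda>t. emeasure (g t) U) \<in> borel_measurable (topology_borel T)"
    by (intro lower_semicontinuous_measurable radon_kernel_lower_semicontinuous[OF X g]) simp
qed

lemma radon_in_prob_algebra:
  "\<mu> \<in> radon_measures X \<Longrightarrow> \<mu> \<in> space (prob_algebra (topology_borel X))"
  by (simp add: space_prob_algebra radon_measuresD(1,2))

lemma sets_bind_radon: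
  assumes X: "compact_space X" "Hausdorff_space X"
    and \<mu>: "\<mu> \<in> radon_measures T" and g: "continuous_map T (radon_space X) g"
  shows "prob_space (\<mu> \<bind> g)" "sets (\<mu> \<bind> g) = sets (topology_borel X)"
  using prob_space_bind'[OF radon_in_prob_algebra[OF \<mu>] radon_kernel_measurable[OF X g]]
    sets_bind'[OF radon_in_prob_algebra[OF \<mu>] radon_kernel_measurable[OF X g]] by auto

text \<open>
  The multiplication of the Radon monad is that of the Giry monad, evaluated on Borel
  \<open>\<sigma>\<close>-algebras.
\<close>

lemma radon_mult_map_eq_bind:
  assumes X: "compact_space X" "Hausdorff_space X"
    and \<mu>: "\<mu> \<in> radon_measures T" and g: "continuous_map T (radon_space X) g"
  shows "radon_mult X (radon_map (radon_space X) g \<mu>) = \<mu> \<bind> g"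
proof -
  have id: "(\<lambda>\<nu>. \<nu>) \<in> topology_borel (radon_space X) \<rightarrow>\<^sub>M prob_algebra (topology_borel X)"
    by (rule radon_kernel_measurable[OF X]) simp
  have g_meas: "g \<in> \<mu> \<rightarrow>\<^sub>M topology_borel (radon_space X)"
    using continuous_map_measurable[OF g] radon_measuresD(2)[OF \<mu>]
    by (simp cong: measurable_cong_sets)
  have eq: "(\<integral>\<^sup>+\<nu>. emeasure \<nu> A \<partial>radon_map (radon_space X) g \<mu>) = emeasure (\<mu> \<bind> g) A"
    if A: "A \<in> sets (topology_borel X)" for A
  proof -
    have "(\<integral>\<^sup>+\<nu>. emeasure \<nu> A \<partial>radon_map (radon_space X) g \<mu>) = (\<integral>\<^sup>+t. emeasure (g t) A \<partial>\<mu>)"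
      unfolding radon_map_def
      by (rule nn_integral_distr[OF g_meas])
         (use measurable_emeasure_kernel[OF measurable_prob_algebraD[OF id] A] in simp)
    also have "\<dots> = emeasure (\<mu> \<bind> g) A"
      by (rule emeasure_bind_prob_algebra[OF radon_in_prob_algebra[OF \<mu>] radon_kernel_measurable[OF X g] A,
            symmetric])
    finally show ?thesis .
  qed
  have sets: "sets (\<mu> \<bind> g) = sets (topology_borel X)"
    by (rule sets_bind_radon(2)[OF X \<mu> g])
  have sp: "space (\<mu> \<bind> g) = topspace X"
    using sets_eq_imp_space_eq[OF sets] by simp
  have closed: "sets (topology_borel X) \<subseteq> Pow (topspace X)"
    using sets.space_closed[of "topology_borel X"] by simp
  have "radon_mult X (radon_map (radon_space X) g \<mu>) =
      measure_of (space (\<mu> \<bind> g)) (sets (\<mu> \<bind> g)) (emeasure (\<mu> \<bind> g))"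
    unfolding radon_mult_def sets sp
    by (rule measure_of_eq[OF closed])
       (use eq sets.sigma_sets_eq[of "topology_borel X"] in simp)
  then show ?thesis by (simp add: measure_of_of_measure)
qed

lemma integral_bind_radon:
  assumes X: "compact_space X" "Hausdorff_space X"
    and \<mu>: "\<mu> \<in> radon_measures T" and g: "continuous_map T (radon_space X) g"
    and h: "continuous_map X euclideanreal h"
  shows "integral\<^sup>L (\<mu> \<bind> g) h = (\<integral>t. integral\<^sup>L (g t) h \<partial>\<mu>)"
proof -
  obtain B where B: "\<And>x. x \<in> topspace X \<Longrightarrow> \<bar>h x\<bar> \<le> B"
    using continuous_map_bounded[OF X(1) h] by blast
  have "g \<in> \<mu> \<rightarrow>\<^sub>M subprob_algebra (topology_borel X)"
    using measurable_prob_algebraD[OF radon_kernel_measurable[OF X g]] radon_measuresD(2)[OF \<mu>]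
    by (simp cong: measurable_cong_sets)
  moreover have "AE t in \<mu>. emeasure (g t) (space (g t)) \<le> ennreal 1"
  proof (rule AE_I2)
    fix t assume "t \<in> space \<mu>"
    then have "prob_space (g t)"
      using continuous_map_radonD[OF g] radon_measuresD(1) radon_measuresD(3)[OF \<mu>] by metis
    then show "emeasure (g t) (space (g t)) \<le> ennreal 1"
      by (simp add: prob_space.emeasure_space_1)
  qed
  ultimately show ?thesis
    using B radon_measuresD(1)[OF \<mu>]
    by (intro integral_bind[where B=B and B'=1, OF continuous_map_borel_measurable[OF h]])
       (auto simp: prob_space.finite_measure)
qed

text \<open>
  Only inner regularity on open sets is at stake. The measure of an open \<open>U\<close> under the kernel is a
  directed supremum of continuous functions, which commutes with the integral against the Radon
  measure \<open>\<mu>\<close>; so some continuous \<open>h\<close> below the indicator of \<open>U\<close> has nearly the full integral, and a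
  superlevel set of \<open>h\<close> is the required closed set.
\<close>

lemma radon_measures_bind:
  assumes T: "compact_space T" "Hausdorff_space T" and X: "compact_space X" "Hausdorff_space X"
    and \<mu>: "\<mu> \<in> radon_measures T" and g: "continuous_map T (radon_space X) g"
  shows "\<mu> \<bind> g \<in> radon_measures X"
proof (rule radon_measuresI[OF X sets_bind_radon[OF X \<mu> g]])
  fix U and e :: real assume U: "openin X U" and e: "0 < e"
  let ?\<nu> = "\<mu> \<bind> g"
  interpret \<nu>: prob_space ?\<nu> by (rule sets_bind_radon[OF X \<mu> g])
  note sets_\<nu> = sets_bind_radon(2)[OF X \<mu> g]
  have sp_\<mu>: "space \<mu> = topspace T" by (rule radon_measuresD(3)[OF \<mu>])
  have sp_\<nu>: "space ?\<nu> = topspace X" using sets_eq_imp_space_eq[OF sets_\<nu>] by simp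
  define J where "J h = (\<lambda>t. ennreal (integral\<^sup>L (g t) h))" for h
  have J: "J h t = (\<integral>\<^sup>+x. ennreal (h x) \<partial>g t)" if "h \<in> cont_below X U" "t \<in> topspace T" for h t
    unfolding J_def
    by (rule cont_below_nn_integral[OF X(1) continuous_map_radonD[OF g that(2)] that(1), symmetric])
  have "emeasure ?\<nu> U = (\<integral>\<^sup>+t. emeasure (g t) U \<partial>\<mu>)"
    by (rule emeasure_bind_prob_algebra[OF radon_in_prob_algebra[OF \<mu>] radon_kernel_measurable[OF X g]
          openin_in_sets[OF U]])
  also have "\<dots> = (\<integral>\<^sup>+t. (SUP f\<in>J ` cont_below X U. f t) \<partial>\<mu>)"
    by (rule nn_integral_cong)
       (use emeasure_open_eq_SUP[OF X continuous_map_radonD[OF g] U] sp_\<mu> in \<open>simp add: J_def image_image\<close>)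
  also have "\<dots> = (SUP f\<in>J ` cont_below X U. \<integral>\<^sup>+t. f t \<partial>\<mu>)"
  proof (rule nn_integral_SUP_directed[OF T(2) \<mu>])
    fix f c assume "f \<in> J ` cont_below X U"
    then show "openin T {t \<in> topspace T. c < f t}"
      using g unfolding J_def
      by (auto intro!: openin_less_ennreal dest: cont_below_continuous
          simp: continuous_map_radon_space_iff)
  next
    show "J ` cont_below X U \<noteq> {}" using cont_below_zero by blast
  next
    fix f f' assume "f \<in> J ` cont_below X U" "f' \<in> J ` cont_below X U"
    then obtain h h' where h: "h \<in> cont_below X U" "h' \<in> cont_below X U" "f = J h" "f' = J h'" by blast
    have m: "(\<lambda>x. max (h x) (h' x)) \<in> cont_below X U" by (rule cont_below_max[OF h(1,2)])
    show "\<exists>k\<in>J ` cont_below X U. \<forall>t\<in>topspace T. f t \<le> k t \<and> f' t \<le> k t"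
      by (intro bexI[OF _ imageI[OF m]] ballI conjI)
         (simp_all add: h J[OF m] J[OF h(1)] J[OF h(2)] nn_integral_mono ennreal_leI)
  qed
  also have "\<dots> = (SUP h\<in>cont_below X U. ennreal (integral\<^sup>L ?\<nu> h))"
  proof (simp only: image_image, rule SUP_cong[OF refl])
    fix h assume h: "h \<in> cont_below X U"
    have "continuous_map T euclideanreal (\<lambda>t. integral\<^sup>L (g t) h)"
      using g cont_below_continuous[OF h] by (simp add: continuous_map_radon_space_iff)
    then have "integrable \<mu> (\<lambda>t. integral\<^sup>L (g t) h)" by (rule radon_integrable[OF T(1) \<mu>])
    moreover have "0 \<le> integral\<^sup>L (g t) h" if "t \<in> topspace T" for t
      using h radon_measuresD(3)[OF continuous_map_radonD[OF g that]]
      by (intro integral_nonneg_AE AE_I2) (auto simp: cont_below_def)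
    ultimately have "(\<integral>\<^sup>+t. J h t \<partial>\<mu>) = ennreal (\<integral>t. integral\<^sup>L (g t) h \<partial>\<mu>)"
      unfolding J_def by (intro nn_integral_eq_integral AE_I2) (auto simp: sp_\<mu>)
    then show "(\<integral>\<^sup>+t. J h t \<partial>\<mu>) = ennreal (integral\<^sup>L ?\<nu> h)"
      by (simp add: integral_bind_radon[OF X \<mu> g cont_below_continuous[OF h]])
  qed
  finally have SUP: "emeasure ?\<nu> U = (SUP h\<in>cont_below X U. ennreal (integral\<^sup>L ?\<nu> h))" .
  show "\<exists>K. closedin X K \<and> K \<subseteq> U \<and> measure ?\<nu> U < measure ?\<nu> K + e"
  proof (cases "measure ?\<nu> U < e / 2")
    case True
    then show ?thesis using e by (intro exI[of _ "{}"]) auto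
  next
    case False
    then have "ennreal (measure ?\<nu> U - e / 2) < emeasure ?\<nu> U"
      using e by (simp add: \<nu>.emeasure_eq_measure ennreal_less_iff)
    then obtain h where h: "h \<in> cont_below X U" "ennreal (measure ?\<nu> U - e / 2) < ennreal (integral\<^sup>L ?\<nu> h)"
      unfolding SUP by (auto simp: less_SUP_iff)
    then have h2: "measure ?\<nu> U - e / 2 < integral\<^sup>L ?\<nu> h"
      using False by (simp add: ennreal_less_iff)
    \<comment> \<open>Points with \<open>h x < e / 2\<close> contribute at most \<open>e / 2\<close> to the integral of \<open>h\<close>.\<close>
    define K where "K = {x \<in> topspace X. h x \<in> {e / 2..}}"
    have clK: "closedin X K"
      unfolding K_def by (rule closedin_continuous_map_preimage[OF cont_below_continuous[OF h(1)]]) simp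
    have "integral\<^sup>L ?\<nu> h \<le> (\<integral>x. indicator K x + e / 2 \<partial>?\<nu>)"
    proof (rule integral_mono)
      obtain B where "\<And>x. x \<in> topspace X \<Longrightarrow> \<bar>h x\<bar> \<le> B"
        using continuous_map_bounded[OF X(1) cont_below_continuous[OF h(1)]] by blast
      then show "integrable ?\<nu> h"
        using continuous_map_borel_measurable[OF cont_below_continuous[OF h(1)]] sets_\<nu>
        by (intro \<nu>.integrable_const_bound[where B=B]) (auto simp: sp_\<nu> cong: measurable_cong_sets)
      show "integrable ?\<nu> (\<lambda>x. indicator K x + e / 2)"
        using clK sets_\<nu> by (auto simp: closedin_in_sets \<nu>.emeasure_eq_measure)
      fix x assume "x \<in> space ?\<nu>"
      then show "h x \<le> indicator K x + e / 2"
        using h(1) e sp_\<nu> by (cases "x \<in> U") (auto simp: cont_below_def K_def indicator_def)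
    qed
    also have "\<dots> = measure ?\<nu> K + e / 2"
      using clK sets_\<nu> \<nu>.prob_space closedin_subset[OF clK]
      by (subst Bochner_Integration.integral_add) (auto simp: closedin_in_sets \<nu>.emeasure_eq_measure sp_\<nu> Int_absorb2)
    finally have "measure ?\<nu> U < measure ?\<nu> K + e" using h2 by linarith
    moreover have "K \<subseteq> U"
    proof
      fix x assume "x \<in> K"
      then have "0 < h x" "h x \<le> indicator U x"
        using h(1) e by (auto simp: K_def cont_below_def simp del: indicator_simps)
      then show "x \<in> U" by (cases "x \<in> U") auto
    qed
    ultimately show ?thesis using clK by blast
  qed
qed

lemma radon_unit_in_radon_measures:
  assumes X: "Hausdorff_space X" and x: "x \<in> topspace X"
  shows "radon_unit X x \<in> radon_measures X"
  unfolding radon_measures_def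
proof (intro CollectI conjI ballI)
  show "prob_space (radon_unit X x)"
    unfolding radon_unit_def using x by (intro prob_space_return) simp
  show "sets (radon_unit X x) = sets (topology_borel X)" by (simp add: radon_unit_def)
  fix A assume "A \<in> sets (radon_unit X x)"
  then have A: "A \<in> sets (topology_borel X)" by (simp add: radon_unit_def)
  have em: "emeasure (radon_unit X x) B = indicator B x" if "B \<in> sets (topology_borel X)" for B
    unfolding radon_unit_def using that by (rule emeasure_return)
  show "emeasure (radon_unit X x) A = (SUP K\<in>{K. compactin X K \<and> K \<subseteq> A}. emeasure (radon_unit X x) K)"
  proof (rule antisym)
    show "(SUP K\<in>{K. compactin X K \<and> K \<subseteq> A}. emeasure (radon_unit X x) K) \<le> emeasure (radon_unit X x) A"
    proof (rule SUP_least)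
      fix K assume "K \<in> {K. compactin X K \<and> K \<subseteq> A}"
      then show "emeasure (radon_unit X x) K \<le> emeasure (radon_unit X x) A"
        using A by (intro emeasure_mono) (auto simp: radon_unit_def)
    qed
    show "emeasure (radon_unit X x) A \<le> (SUP K\<in>{K. compactin X K \<and> K \<subseteq> A}. emeasure (radon_unit X x) K)"
    proof (cases "x \<in> A")
      case True
      have "compactin X {x}" using x by simp
      then show ?thesis
        using True A X by (intro SUP_upper2[of "{x}"]) (auto simp: em compactin_in_sets)
    qed (simp add: em[OF A])
  qed
qed

lemma continuous_map_radon_unit:
  assumes X: "Hausdorff_space X"
  shows "continuous_map X (radon_space X) (radon_unit X)"
  unfolding continuous_map_radon_space_iff
proof (intro conjI allI impI funcsetI)
  show "radon_unit X x \<in> radon_measures X" if "x \<in> topspace X" for x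
    by (rule radon_unit_in_radon_measures[OF X that])
  fix h assume h: "continuous_map X euclideanreal h"
  show "continuous_map X euclideanreal (\<lambda>x. integral\<^sup>L (radon_unit X x) h)"
    by (rule continuous_map_eq[OF h])
       (simp add: radon_unit_def integral_return continuous_map_borel_measurable[OF h])
qed

lemma continuous_map_bind_radon:
  assumes Y: "compact_space Y" "Hausdorff_space Y" and Z: "compact_space Z" "Hausdorff_space Z"
    and f: "continuous_map X (radon_space Y) f" and g: "continuous_map Y (radon_space Z) g"
  shows "continuous_map X (radon_space Z) (\<lambda>x. f x \<bind> g)"
  unfolding continuous_map_radon_space_iff
proof (intro conjI allI impI funcsetI)
  fix x assume "x \<in> topspace X"
  then show "f x \<bind> g \<in> radon_measures Z"
    by (intro radon_measures_bind[OF Y Z _ g] continuous_map_radonD[OF f])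
next
  fix h assume h: "continuous_map Z euclideanreal h"
  then have "continuous_map Y euclideanreal (\<lambda>y. integral\<^sup>L (g y) h)"
    using g by (simp add: continuous_map_radon_space_iff)
  then have "continuous_map X euclideanreal (\<lambda>x. \<integral>y. integral\<^sup>L (g y) h \<partial>f x)"
    using f by (simp add: continuous_map_radon_space_iff)
  then show "continuous_map X euclideanreal (\<lambda>x. integral\<^sup>L (f x \<bind> g) h)"
    by (rule continuous_map_eq) (simp add: integral_bind_radon[OF Z continuous_map_radonD[OF f] g h])
qed

lemma KleisliR_simps:
  "Obj KleisliR = {X. compact_space X \<and> Hausdorff_space X}"
  "Hom KleisliR X Y = {f. continuous_map X (radon_space Y) f \<and> f \<in> extensional (topspace X)}"
  "Idn KleisliR X = (\<lambda>x\<in>topspace X. radon_unit X x)"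
  by (simp_all add: KleisliR_def)

lemma Cmp_KleisliR:
  assumes "Z \<in> Obj KleisliR" "f \<in> Hom KleisliR X Y" "g \<in> Hom KleisliR Y Z"
  shows "Cmp KleisliR X Y Z g f = (\<lambda>x\<in>topspace X. f x \<bind> g)"
  unfolding KleisliR_def cat.simps
  by (rule restrict_ext, rule radon_mult_map_eq_bind)
     (use assms in \<open>auto simp: KleisliR_simps intro: continuous_map_radonD\<close>)

lemma continuous_map_restrict_radon:
  "continuous_map X Y (\<lambda>x\<in>topspace X. f x) \<longleftrightarrow> continuous_map X Y f"
  by (metis continuous_map_eq restrict_apply')

theorem category_KleisliR: "category (KleisliR :: ('x topology, 'x \<Rightarrow> 'x measure) cat)"
proof
  fix X :: "'x topology" assume X: "X \<in> Obj KleisliR"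
  then show "Idn KleisliR X \<in> Hom KleisliR X X"
    by (simp add: KleisliR_simps continuous_map_restrict_radon continuous_map_radon_unit)
next
  fix X Y Z :: "'x topology" and f g
  assume *: "X \<in> Obj KleisliR" "Y \<in> Obj KleisliR" "Z \<in> Obj KleisliR"
    "f \<in> Hom KleisliR X Y" "g \<in> Hom KleisliR Y Z"
  then show "Cmp KleisliR X Y Z g f \<in> Hom KleisliR X Z"
    unfolding Cmp_KleisliR[OF *(3-5)]
    by (auto simp: KleisliR_simps continuous_map_restrict_radon intro: continuous_map_bind_radon)
next
  fix X Y :: "'x topology" and f
  assume *: "X \<in> Obj KleisliR" "Y \<in> Obj KleisliR" "f \<in> Hom KleisliR X Y"
  have Idn: "Idn KleisliR Y \<in> Hom KleisliR Y Y" "Idn KleisliR X \<in> Hom KleisliR X X"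
    using *(1,2) by (simp_all add: KleisliR_simps continuous_map_restrict_radon continuous_map_radon_unit)
  have ext: "f \<in> extensional (topspace X)" and rad: "\<And>x. x \<in> topspace X \<Longrightarrow> f x \<in> radon_measures Y"
    using *(3) by (auto simp: KleisliR_simps intro: continuous_map_radonD)
  show "Cmp KleisliR X Y Y (Idn KleisliR Y) f = f"
    unfolding Cmp_KleisliR[OF *(2,3) Idn(1)]
  proof (rule extensionalityI[OF restrict_extensional ext])
    fix x assume x: "x \<in> topspace X"
    have "f x \<bind> (\<lambda>y\<in>topspace Y. radon_unit Y y) = f x \<bind> return (topology_borel Y)"
      by (rule bind_cong) (simp_all add: radon_measuresD(3)[OF rad[OF x]] radon_unit_def)
    also have "\<dots> = f x" by (rule bind_return''[OF radon_measuresD(2)[OF rad[OF x]]])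
    finally show "(\<lambda>x\<in>topspace X. f x \<bind> Idn KleisliR Y) x = f x"
      using x by (simp add: KleisliR_simps)
  qed
  show "Cmp KleisliR X X Y f (Idn KleisliR X) = f"
    unfolding Cmp_KleisliR[OF *(2) Idn(2) *(3)]
  proof (rule extensionalityI[OF restrict_extensional ext])
    fix x assume x: "x \<in> topspace X"
    have "f \<in> topology_borel X \<rightarrow>\<^sub>M subprob_algebra (topology_borel Y)"
      using * by (intro measurable_prob_algebraD radon_kernel_measurable) (auto simp: KleisliR_simps)
    then have "radon_unit X x \<bind> f = f x"
      unfolding radon_unit_def using x by (intro bind_return) simp_all
    then show "(\<lambda>x\<in>topspace X. Idn KleisliR X x \<bind> f) x = f x"
      using x by (simp add: KleisliR_simps)
  qed
next
  fix W X Y Z :: "'x topology" and f g h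
  assume *: "W \<in> Obj KleisliR" "X \<in> Obj KleisliR" "Y \<in> Obj KleisliR" "Z \<in> Obj KleisliR"
    "f \<in> Hom KleisliR W X" "g \<in> Hom KleisliR X Y" "h \<in> Hom KleisliR Y Z"
  have hg: "(\<lambda>x\<in>topspace X. g x \<bind> h) \<in> Hom KleisliR X Z"
    and gf: "(\<lambda>x\<in>topspace W. f x \<bind> g) \<in> Hom KleisliR W Y"
    using * by (auto simp: KleisliR_simps continuous_map_restrict_radon intro: continuous_map_bind_radon)
  have g: "g \<in> topology_borel X \<rightarrow>\<^sub>M subprob_algebra (topology_borel Y)"
    and h: "h \<in> topology_borel Y \<rightarrow>\<^sub>M subprob_algebra (topology_borel Z)"
    using * by (auto simp: KleisliR_simps intro!: measurable_prob_algebraD radon_kernel_measurable)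
  have rad: "f w \<in> radon_measures X" if "w \<in> topspace W" for w
    using *(5) that by (auto simp: KleisliR_simps intro: continuous_map_radonD)
  have "f w \<bind> (\<lambda>x\<in>topspace X. g x \<bind> h) = f w \<bind> g \<bind> h" if w: "w \<in> topspace W" for w
  proof -
    have "f w \<bind> (\<lambda>x\<in>topspace X. g x \<bind> h) = f w \<bind> (\<lambda>x. g x \<bind> h)"
      by (rule bind_cong) (simp_all add: radon_measuresD(3)[OF rad[OF w]])
    also have "\<dots> = f w \<bind> g \<bind> h"
      by (rule bind_assoc[OF _ h, symmetric])
         (use g radon_measuresD(2)[OF rad[OF w]] in \<open>simp cong: measurable_cong_sets\<close>)
    finally show ?thesis .
  qed
  then show "Cmp KleisliR W X Z (Cmp KleisliR X Y Z h g) f = Cmp KleisliR W Y Z h (Cmp KleisliR W X Y g f)"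
    unfolding Cmp_KleisliR[OF *(4,6,7)] Cmp_KleisliR[OF *(3,5,6)] Cmp_KleisliR[OF *(4,5) hg]
      Cmp_KleisliR[OF *(4) gf *(7)]
    by (intro restrict_ext) simp
qed

section \<open>The category of pro-objects\<close>

locale pro_object = C: category C + I: cofiltered "idx X" + F: cat_functor "idx X" C "dia X"
  for C :: "('o, 'm) cat" and X :: "('i, 'k, 'o, 'm) diagram"
begin

text \<open>The action of the transition map of \<open>u : k \<rightarrow> i\<close> on maps \<open>a : X\<^sub>i \<rightarrow> c\<close>.\<close>

definition res :: "'o \<Rightarrow> 'i \<Rightarrow> 'i \<Rightarrow> 'k \<Rightarrow> 'm \<Rightarrow> 'm" where
  "res c k i u a = Cmp C (dob X k) (dob X i) c a (dmo X k i u)"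

lemma res_in_Hom:
  "\<lbrakk>c \<in> Obj C; i \<in> Obj (idx X); k \<in> Obj (idx X); u \<in> Hom (idx X) k i; a \<in> Hom C (dob X i) c\<rbrakk>
    \<Longrightarrow> res c k i u a \<in> Hom C (dob X k) c"
  unfolding res_def by (intro C.Cmp_in_Hom F.fobj_in_Obj F.fmor_in_Hom)

lemma res_res:
  assumes "c \<in> Obj C" "i \<in> Obj (idx X)" "k \<in> Obj (idx X)" "l \<in> Obj (idx X)"
    "u \<in> Hom (idx X) k i" "v \<in> Hom (idx X) l k" "a \<in> Hom C (dob X i) c"
  shows "res c l k v (res c k i u a) = res c l i (Cmp (idx X) l k i u v) a"
  using assms unfolding res_def
  by (simp add: C.Cmp_assoc[of "dob X l" "dob X k" "dob X i" c "dmo X l k v" "dmo X k i u" a]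
      F.fobj_in_Obj F.fmor_in_Hom F.fmor_Cmp)

lemma res_Idn:
  "\<lbrakk>c \<in> Obj C; i \<in> Obj (idx X); a \<in> Hom C (dob X i) c\<rbrakk> \<Longrightarrow> res c i i (Idn (idx X) i) a = a"
  unfolding res_def by (simp add: F.fmor_Idn F.fobj_in_Obj C.Cmp_Idn_right)

lemma res_post:
  "\<lbrakk>c \<in> Obj C; d \<in> Obj C; i \<in> Obj (idx X); k \<in> Obj (idx X); u \<in> Hom (idx X) k i;
    a \<in> Hom C (dob X i) c; b \<in> Hom C c d\<rbrakk>
    \<Longrightarrow> res d k i u (Cmp C (dob X i) c d b a) = Cmp C (dob X k) c d b (res c k i u a)"
  unfolding res_def by (rule C.Cmp_assoc) (auto intro: F.fobj_in_Obj F.fmor_in_Hom)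

abbreviation reps :: "'o \<Rightarrow> ('i \<times> 'm) set" where
  "reps c \<equiv> SIGMA i:Obj (idx X). Hom C (dob X i) c"

lemma germ_rel_iff:
  "((i, a), (i', a')) \<in> germ_rel C X c \<longleftrightarrow> (i, a) \<in> reps c \<and> (i', a') \<in> reps c \<and>
     (\<exists>k\<in>Obj (idx X). \<exists>u\<in>Hom (idx X) k i. \<exists>v\<in>Hom (idx X) k i'. res c k i u a = res c k i' v a')"
  by (auto simp: germ_rel_def res_def)

text \<open>
  Transitivity is where cofilteredness enters: two spans with a common foot \<open>i'\<close> are completed to
  a commutative square.
\<close>

lemma common_refinement:
  assumes "k \<in> Obj (idx X)" "l \<in> Obj (idx X)" "i \<in> Obj (idx X)"
    "u \<in> Hom (idx X) k i" "v \<in> Hom (idx X) l i"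
  obtains m p q where "m \<in> Obj (idx X)" "p \<in> Hom (idx X) m k" "q \<in> Hom (idx X) m l"
    "Cmp (idx X) m k i u p = Cmp (idx X) m l i v q"
proof -
  obtain n p q where n: "n \<in> Obj (idx X)" "p \<in> Hom (idx X) n k" "q \<in> Hom (idx X) n l"
    using I.cone_objects[OF assms(1,2)] by blast
  have "Cmp (idx X) n k i u p \<in> Hom (idx X) n i" "Cmp (idx X) n l i v q \<in> Hom (idx X) n i"
    using assms n by (auto intro: I.Cmp_in_Hom)
  then obtain m e where m: "m \<in> Obj (idx X)" "e \<in> Hom (idx X) m n"
      "Cmp (idx X) m n i (Cmp (idx X) n k i u p) e = Cmp (idx X) m n i (Cmp (idx X) n l i v q) e"
    using I.cone_arrows[OF n(1) assms(3)] by blast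
  then have "Cmp (idx X) m k i u (Cmp (idx X) m n k p e) = Cmp (idx X) m l i v (Cmp (idx X) m n l q e)"
    using assms n by (simp add: I.Cmp_assoc)
  then show ?thesis
    using that[OF m(1)] assms n m by (meson I.Cmp_in_Hom)
qed

lemma equiv_germ_rel:
  assumes c: "c \<in> Obj C"
  shows "equiv (reps c) (germ_rel C X c)"
proof (rule equivI)
  show "germ_rel C X c \<subseteq> reps c \<times> reps c" by (auto simp: germ_rel_def)
  show "refl_on (reps c) (germ_rel C X c)"
    by (auto simp: refl_on_def germ_rel_iff intro: I.Idn_in_Hom)
  show "sym (germ_rel C X c)"
    by (rule symI) (auto simp: germ_rel_iff, metis)
  show "trans (germ_rel C X c)"
  proof (rule transI)
    fix r s t assume rs: "(r, s) \<in> germ_rel C X c" and st: "(s, t) \<in> germ_rel C X c"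
    obtain i a i' a' i'' a'' where [simp]: "r = (i, a)" "s = (i', a')" "t = (i'', a'')"
      by (metis surj_pair)
    obtain k u v where k: "k \<in> Obj (idx X)" "u \<in> Hom (idx X) k i" "v \<in> Hom (idx X) k i'"
      "res c k i u a = res c k i' v a'"
      using rs by (auto simp: germ_rel_iff)
    obtain l w x where l: "l \<in> Obj (idx X)" "w \<in> Hom (idx X) l i'" "x \<in> Hom (idx X) l i''"
      "res c l i' w a' = res c l i'' x a''"
      using st by (auto simp: germ_rel_iff)
    have o: "i \<in> Obj (idx X)" "i' \<in> Obj (idx X)" "i'' \<in> Obj (idx X)" "a \<in> Hom C (dob X i) c"
      "a' \<in> Hom C (dob X i') c" "a'' \<in> Hom C (dob X i'') c"
      using rs st by (auto simp: germ_rel_iff)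
    obtain m p q where m: "m \<in> Obj (idx X)" "p \<in> Hom (idx X) m k" "q \<in> Hom (idx X) m l"
      "Cmp (idx X) m k i' v p = Cmp (idx X) m l i' w q"
      using common_refinement[OF k(1) l(1) o(2) k(3) l(2)] by blast
    have "res c m i (Cmp (idx X) m k i u p) a = res c m k p (res c k i u a)"
      using res_res[OF c o(1) k(1) m(1) k(2) m(2) o(4)] by simp
    also have "\<dots> = res c m i' (Cmp (idx X) m k i' v p) a'"
      unfolding k(4) by (rule res_res[OF c o(2) k(1) m(1) k(3) m(2) o(5)])
    also have "\<dots> = res c m l q (res c l i' w a')"
      unfolding m(4) using res_res[OF c o(2) l(1) m(1) l(2) m(3) o(5)] by simp
    also have "\<dots> = res c m i'' (Cmp (idx X) m l i'' x q) a''"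
      unfolding l(4) by (rule res_res[OF c o(3) l(1) m(1) l(3) m(3) o(6)])
    finally show "(r, t) \<in> germ_rel C X c"
      using o m k l by (auto simp: germ_rel_iff intro!: bexI[of _ m] I.Cmp_in_Hom)
  qed
qed

lemma germ_self: "\<lbrakk>c \<in> Obj C; r \<in> reps c\<rbrakk> \<Longrightarrow> r \<in> germ C X c r"
  unfolding germ_def by (rule equiv_class_self[OF equiv_germ_rel])

lemma germ_in_colim_hom: "r \<in> reps c \<Longrightarrow> germ C X c r \<in> colim_hom C X c"
  unfolding germ_def colim_hom_def by (rule quotientI)

lemma germ_eqI:
  "\<lbrakk>c \<in> Obj C; (r, s) \<in> germ_rel C X c\<rbrakk> \<Longrightarrow> germ C X c r = germ C X c s"
  unfolding germ_def by (rule equiv_class_eq[OF equiv_germ_rel])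

lemma germ_eq_iff:
  "\<lbrakk>c \<in> Obj C; r \<in> reps c; s \<in> reps c\<rbrakk>
    \<Longrightarrow> germ C X c r = germ C X c s \<longleftrightarrow> (r, s) \<in> germ_rel C X c"
  unfolding germ_def using eq_equiv_class_iff[OF equiv_germ_rel] by fast

lemma germ_res:
  assumes "c \<in> Obj C" "i \<in> Obj (idx X)" "k \<in> Obj (idx X)" "u \<in> Hom (idx X) k i" "a \<in> Hom C (dob X i) c"
  shows "germ C X c (k, res c k i u a) = germ C X c (i, a)"
proof (rule germ_eqI[OF assms(1)])
  have r: "res c k i u a \<in> Hom C (dob X k) c" by (rule res_in_Hom[OF assms])
  then have "res c k k (Idn (idx X) k) (res c k i u a) = res c k i u a"
    by (rule res_Idn[OF assms(1,3)])
  then show "((k, res c k i u a), (i, a)) \<in> germ_rel C X c"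
    using assms r I.Idn_in_Hom unfolding germ_rel_iff by blast
qed

lemma colim_homD:
  assumes c: "c \<in> Obj C" and z: "z \<in> colim_hom C X c" "r \<in> z"
  shows "r \<in> reps c" "z = germ C X c r"
proof -
  obtain s where s: "s \<in> reps c" "z = germ_rel C X c `` {s}"
    using z(1) unfolding colim_hom_def by (auto elim: quotientE)
  then have sr: "(s, r) \<in> germ_rel C X c" using z(2) by auto
  then show "r \<in> reps c" by (auto simp: germ_rel_def)
  show "z = germ C X c r" using germ_eqI[OF c sr] s(2) by (simp add: germ_def)
qed

lemma colim_hom_nonempty:
  assumes "c \<in> Obj C" "z \<in> colim_hom C X c"
  obtains i a where "(i, a) \<in> z"
proof -
  have "z \<noteq> {}"
    using in_quotient_imp_non_empty[OF equiv_germ_rel[OF assms(1)]] assms(2)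
    unfolding colim_hom_def by blast
  then show ?thesis using that by auto
qed

lemma germ_post:
  assumes "c \<in> Obj C" "d \<in> Obj C" "(i, a) \<in> reps c" "(i', a') \<in> reps c" "b \<in> Hom C c d"
    and eq: "germ C X c (i, a) = germ C X c (i', a')"
  shows "germ C X d (i, Cmp C (dob X i) c d b a) = germ C X d (i', Cmp C (dob X i') c d b a')"
proof (rule germ_eqI[OF assms(2)])
  have "((i, a), (i', a')) \<in> germ_rel C X c"
    using eq germ_eq_iff[OF assms(1,3,4)] by blast
  then obtain k u v where k: "k \<in> Obj (idx X)" "u \<in> Hom (idx X) k i" "v \<in> Hom (idx X) k i'"
      "res c k i u a = res c k i' v a'"
    by (auto simp: germ_rel_iff)
  moreover have "Cmp C (dob X i) c d b a \<in> Hom C (dob X i) d" "Cmp C (dob X i') c d b a' \<in> Hom C (dob X i') d"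
    using assms by (auto intro!: C.Cmp_in_Hom F.fobj_in_Obj)
  moreover have "res d k i u (Cmp C (dob X i) c d b a) = res d k i' v (Cmp C (dob X i') c d b a')"
    using assms k by (simp add: res_post)
  ultimately show "((i, Cmp C (dob X i) c d b a), (i', Cmp C (dob X i') c d b a')) \<in> germ_rel C X d"
    using assms unfolding germ_rel_iff by auto
qed

end

lemma Obj_Pro_iff: "X \<in> Obj (Pro C) \<longleftrightarrow> pro_object C X"
  by (auto simp: Pro_def pro_object_def cat_functor_def)

lemma Hom_Pro: "Hom (Pro C) = pro_hom C"
  by (simp add: Pro_def)

lemma pro_object_dob: "\<lbrakk>pro_object C X; i \<in> Obj (idx X)\<rbrakk> \<Longrightarrow> dob X i \<in> Obj C"
  unfolding pro_object_def cat_functor_def cat_functor_axioms_def by blast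

locale pro_morphism = X: pro_object C X + Y: pro_object C Y
  for C :: "('o, 'm) cat" and X :: "('i, 'k, 'o, 'm) diagram" and Y :: "('i, 'k, 'o, 'm) diagram" +
  fixes f :: "'i \<Rightarrow> ('i \<times> 'm) set"
  assumes f: "f \<in> pro_hom C X Y"
begin

lemma component: "j \<in> Obj (idx Y) \<Longrightarrow> f j \<in> colim_hom C X (dob Y j)"
  using f by (auto simp: pro_hom_def PiE_def)

lemma rep:
  assumes "j \<in> Obj (idx Y)" "(i, a) \<in> f j"
  shows "i \<in> Obj (idx X)" "a \<in> Hom C (dob X i) (dob Y j)" "f j = germ C X (dob Y j) (i, a)"
  using X.colim_homD[OF Y.F.fobj_in_Obj[OF assms(1)] component[OF assms(1)] assms(2)] by auto

lemma obtain_rep: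
  assumes "j \<in> Obj (idx Y)"
  obtains i a where "(i, a) \<in> f j" "i \<in> Obj (idx X)" "a \<in> Hom C (dob X i) (dob Y j)"
  using X.colim_hom_nonempty[OF Y.F.fobj_in_Obj[OF assms] component[OF assms]] rep[OF assms] by metis

lemma rep_eq:
  assumes "j \<in> Obj (idx Y)" "(i, a) \<in> f j" "(i', a') \<in> f j"
  shows "germ C X (dob Y j) (i, a) = germ C X (dob Y j) (i', a')"
  using rep(3)[OF assms(1,2)] rep(3)[OF assms(1,3)] by simp

lemma compatible:
  assumes "j \<in> Obj (idx Y)" "j' \<in> Obj (idx Y)" "w \<in> Hom (idx Y) j j'" "(i, a) \<in> f j"
  shows "f j' = germ C X (dob Y j') (i, Cmp C (dob X i) (dob Y j) (dob Y j') (dmo Y j j' w) a)"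
    "(i, Cmp C (dob X i) (dob Y j) (dob Y j') (dmo Y j j' w) a) \<in> f j'"
proof -
  have "\<forall>(i, a)\<in>f j. germ C X (dob Y j') (i, Cmp C (dob X i) (dob Y j) (dob Y j') (dmo Y j j' w) a) = f j'"
    using f assms(1-3) unfolding pro_hom_def by blast
  then show eq: "f j' = germ C X (dob Y j') (i, Cmp C (dob X i) (dob Y j) (dob Y j') (dmo Y j j' w) a)"
    using assms(4) by auto
  show "(i, Cmp C (dob X i) (dob Y j) (dob Y j') (dmo Y j j' w) a) \<in> f j'"
    unfolding eq
    by (rule X.germ_self)
       (use rep[OF assms(1,4)] assms in \<open>auto intro!: X.C.Cmp_in_Hom X.F.fobj_in_Obj Y.F.fobj_in_Obj Y.F.fmor_in_Hom\<close>)
qed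

end

definition represents ::
  "('o, 'm) cat \<Rightarrow> ('i, 'k, 'o, 'm) diagram \<Rightarrow> ('i, 'k, 'o, 'm) diagram \<Rightarrow> ('i \<Rightarrow> ('i \<times> 'm) set)
    \<Rightarrow> 'i \<Rightarrow> 'i \<Rightarrow> 'm \<Rightarrow> bool" where
  "represents C X Y f j i a \<longleftrightarrow> i \<in> Obj (idx X) \<and> a \<in> Hom C (dob X i) (dob Y j) \<and>
     f j = germ C X (dob Y j) (i, a) \<and>
     (\<forall>j'\<in>Obj (idx Y). \<forall>w\<in>Hom (idx Y) j j'.
        germ C X (dob Y j') (i, Cmp C (dob X i) (dob Y j) (dob Y j') (dmo Y j j' w) a) = f j')"

text \<open>Compatibility need only be checked on one representative of each component.\<close>

lemma pro_homI:
  assumes X: "pro_object C X" and Y: "pro_object C Y" and ext: "f \<in> extensional (Obj (idx Y))"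
    and rep: "\<And>j. j \<in> Obj (idx Y) \<Longrightarrow> \<exists>i a. represents C X Y f j i a"
  shows "f \<in> pro_hom C X Y"
  unfolding pro_hom_def
proof (intro CollectI conjI PiE_I ballI)
  interpret X: pro_object C X by fact
  interpret Y: pro_object C Y by fact
  show "f j \<in> colim_hom C X (dob Y j)" if "j \<in> Obj (idx Y)" for j
    using rep[OF that] by (auto simp: represents_def intro!: X.germ_in_colim_hom)
  show "f j = undefined" if "j \<notin> Obj (idx Y)" for j
    using ext that by (simp add: extensional_def)
  fix j j' w r
  assume j: "j \<in> Obj (idx Y)" "j' \<in> Obj (idx Y)" "w \<in> Hom (idx Y) j j'" and r: "r \<in> f j"
  obtain i' a' where r': "r = (i', a')" by (cases r)
  obtain i a where ia: "i \<in> Obj (idx X)" "a \<in> Hom C (dob X i) (dob Y j)" "f j = germ C X (dob Y j) (i, a)"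
      "germ C X (dob Y j') (i, Cmp C (dob X i) (dob Y j) (dob Y j') (dmo Y j j' w) a) = f j'"
    using rep[OF j(1)] j unfolding represents_def by metis
  have o: "dob Y j \<in> Obj C" "dob Y j' \<in> Obj C" "dmo Y j j' w \<in> Hom C (dob Y j) (dob Y j')"
    using j by (auto intro: Y.F.fobj_in_Obj Y.F.fmor_in_Hom)
  have "r \<in> X.reps (dob Y j)" "f j = germ C X (dob Y j) r"
    using X.colim_homD[OF o(1) _ r] X.germ_in_colim_hom[of "(i, a)" "dob Y j"] ia by auto
  then show "case r of (i, a) \<Rightarrow>
      germ C X (dob Y j') (i, Cmp C (dob X i) (dob Y j) (dob Y j') (dmo Y j j' w) a) = f j'"
    using X.germ_post[OF o(1,2) _ _ o(3), of i' a' i a] ia r' by auto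
qed

text \<open>
  If \<open>b\<close> and \<open>b'\<close> agree on \<open>Y\<^sub>m\<close>, then both composites are represented by way of a representative
  of the \<open>m\<close>-th component of \<open>f\<close>.
\<close>

lemma pro_comp_well_defined:
  assumes "pro_morphism C X Y f" "pro_morphism C Y Z g" and k: "k \<in> Obj (idx Z)"
    and jb: "(j, b) \<in> g k" "(j', b') \<in> g k" and ia: "(i, a) \<in> f j" "(i', a') \<in> f j'"
  shows "germ C X (dob Z k) (i, Cmp C (dob X i) (dob Y j) (dob Z k) b a) =
         germ C X (dob Z k) (i', Cmp C (dob X i') (dob Y j') (dob Z k) b' a')"
proof -
  interpret f: pro_morphism C X Y f by fact
  interpret g: pro_morphism C Y Z g by fact
  note [simp] = f.X.F.fobj_in_Obj f.Y.F.fobj_in_Obj g.Y.F.fobj_in_Obj f.Y.F.fmor_in_Hom k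
  note gr = g.rep[OF k jb(1)] and gr' = g.rep[OF k jb(2)]
  have "((j, b), (j', b')) \<in> germ_rel C Y (dob Z k)"
    using g.rep_eq[OF k jb] gr gr' by (subst (asm) f.Y.germ_eq_iff) auto
  then obtain m u v where m: "m \<in> Obj (idx Y)" "u \<in> Hom (idx Y) m j" "v \<in> Hom (idx Y) m j'"
      "f.Y.res (dob Z k) m j u b = f.Y.res (dob Z k) m j' v b'"
    by (auto simp: f.Y.germ_rel_iff)
  obtain l c where lc: "(l, c) \<in> f m" "l \<in> Obj (idx X)" "c \<in> Hom C (dob X l) (dob Y m)"
    using f.obtain_rep[OF m(1)] .
  have *: "germ C X (dob Z k) (i, Cmp C (dob X i) (dob Y j) (dob Z k) b a) =
      germ C X (dob Z k) (l, Cmp C (dob X l) (dob Y m) (dob Z k) (f.Y.res (dob Z k) m j u b) c)"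
    if "(j, b) \<in> g k" "(i, a) \<in> f j" "u \<in> Hom (idx Y) m j" for j b i a u
  proof -
    note gr = g.rep[OF k that(1)]
    have "germ C X (dob Z k) (i, Cmp C (dob X i) (dob Y j) (dob Z k) b a) =
        germ C X (dob Z k) (l, Cmp C (dob X l) (dob Y j) (dob Z k) b
          (Cmp C (dob X l) (dob Y m) (dob Y j) (dmo Y m j u) c))"
      by (rule f.X.germ_post[OF _ _ _ _ gr(2) f.rep_eq[OF gr(1) that(2) f.compatible(2)[OF m(1) gr(1) that(3) lc(1)]]])
         (use gr f.rep[OF gr(1) that(2)] lc m that in \<open>auto intro!: f.X.C.Cmp_in_Hom\<close>)
    also have "Cmp C (dob X l) (dob Y j) (dob Z k) b (Cmp C (dob X l) (dob Y m) (dob Y j) (dmo Y m j u) c) =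
        Cmp C (dob X l) (dob Y m) (dob Z k) (f.Y.res (dob Z k) m j u b) c"
      unfolding f.Y.res_def
      by (rule f.X.C.Cmp_assoc[symmetric]) (use gr lc m that in auto)
    finally show ?thesis .
  qed
  show ?thesis
    using *[OF jb(1) ia(1) m(2)] *[OF jb(2) ia(2) m(3)] m(4) by simp
qed

lemma Cmp_Pro_eq:
  assumes f: "pro_morphism C X Y f" and g: "pro_morphism C Y Z g" and k: "k \<in> Obj (idx Z)"
    and jb: "(j, b) \<in> g k" and ia: "(i, a) \<in> f j"
  shows "Cmp (Pro C) X Y Z g f k = germ C X (dob Z k) (i, Cmp C (dob X i) (dob Y j) (dob Z k) b a)"
proof -
  have "Cmp (Pro C) X Y Z g f k = (\<Union>(j, b)\<in>g k. \<Union>(i, a)\<in>f j.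
      germ C X (dob Z k) (i, Cmp C (dob X i) (dob Y j) (dob Z k) b a))"
    using k by (simp add: Pro_def)
  also have "\<dots> = germ C X (dob Z k) (i, Cmp C (dob X i) (dob Y j) (dob Z k) b a)"
    using pro_comp_well_defined[OF f g k _ jb _ ia] jb ia by fast
  finally show ?thesis .
qed

lemma extensional_Cmp_Pro: "Cmp (Pro C) X Y Z g f \<in> extensional (Obj (idx Z))"
  by (simp add: Pro_def)

lemma Idn_Pro: "Idn (Pro C) X = (\<lambda>j\<in>Obj (idx X). germ C X (dob X j) (j, Idn C (dob X j)))"
  by (simp add: Pro_def)

lemma pro_morphism_Idn:
  assumes "pro_object C X"
  shows "pro_morphism C X X (Idn (Pro C) X)"
proof -
  interpret X: pro_object C X by fact
  have "Idn (Pro C) X \<in> pro_hom C X X"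
  proof (rule pro_homI[OF assms assms])
    fix j assume j: "j \<in> Obj (idx X)"
    show "\<exists>i a. represents C X X (Idn (Pro C) X) j i a"
      unfolding represents_def
    proof (intro exI conjI ballI)
      show "j \<in> Obj (idx X)" by fact
      show id: "Idn C (dob X j) \<in> Hom C (dob X j) (dob X j)"
        using j by (intro X.C.Idn_in_Hom X.F.fobj_in_Obj)
      show "Idn (Pro C) X j = germ C X (dob X j) (j, Idn C (dob X j))"
        using j by (simp add: Idn_Pro)
      fix j' w assume j': "j' \<in> Obj (idx X)" and w: "w \<in> Hom (idx X) j j'"
      have o: "dob X j \<in> Obj C" "dob X j' \<in> Obj C" "dmo X j j' w \<in> Hom C (dob X j) (dob X j')"
        using j j' w by (auto intro: X.F.fobj_in_Obj X.F.fmor_in_Hom)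
      have "Cmp C (dob X j) (dob X j) (dob X j') (dmo X j j' w) (Idn C (dob X j)) =
          X.res (dob X j') j j' w (Idn C (dob X j'))"
        unfolding X.res_def using o by (simp add: X.C.Cmp_Idn_left X.C.Cmp_Idn_right)
      then show "germ C X (dob X j') (j, Cmp C (dob X j) (dob X j) (dob X j') (dmo X j j' w) (Idn C (dob X j)))
          = Idn (Pro C) X j'"
        using X.germ_res[OF o(2) j' j w X.C.Idn_in_Hom[OF o(2)]] j' by (simp add: Idn_Pro)
    qed
  qed (simp add: Idn_Pro)
  then show ?thesis by unfold_locales
qed

lemma Idn_Pro_rep:
  assumes "pro_object C X" "j \<in> Obj (idx X)"
  shows "(j, Idn C (dob X j)) \<in> Idn (Pro C) X j"
proof -
  interpret X: pro_object C X by fact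
  show ?thesis
    using assms X.germ_self[of "dob X j" "(j, Idn C (dob X j))"] X.F.fobj_in_Obj X.C.Idn_in_Hom
    by (simp add: Idn_Pro)
qed

lemma Cmp_Pro_rep:
  assumes f: "pro_morphism C X Y f" and g: "pro_morphism C Y Z g" and k: "k \<in> Obj (idx Z)"
    and jb: "(j, b) \<in> g k" and ia: "(i, a) \<in> f j"
  shows "(i, Cmp C (dob X i) (dob Y j) (dob Z k) b a) \<in> Cmp (Pro C) X Y Z g f k"
proof -
  interpret f: pro_morphism C X Y f by fact
  interpret g: pro_morphism C Y Z g by fact
  note gr = g.rep[OF k jb]
  note fr = f.rep[OF gr(1) ia]
  show ?thesis
    unfolding Cmp_Pro_eq[OF assms]
    by (rule f.X.germ_self)
       (use k gr fr in \<open>auto intro!: f.X.C.Cmp_in_Hom f.X.F.fobj_in_Obj f.Y.F.fobj_in_Obj g.Y.F.fobj_in_Obj\<close>)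
qed

lemma pro_morphism_Cmp:
  assumes f: "pro_morphism C X Y f" and g: "pro_morphism C Y Z g"
  shows "pro_morphism C X Z (Cmp (Pro C) X Y Z g f)"
proof -
  interpret f: pro_morphism C X Y f by fact
  interpret g: pro_morphism C Y Z g by fact
  note [simp] = f.X.F.fobj_in_Obj f.Y.F.fobj_in_Obj g.Y.F.fobj_in_Obj g.Y.F.fmor_in_Hom
  have "Cmp (Pro C) X Y Z g f \<in> pro_hom C X Z"
  proof (rule pro_homI[OF f.X.pro_object_axioms g.Y.pro_object_axioms extensional_Cmp_Pro])
    fix k assume k: "k \<in> Obj (idx Z)"
    obtain j b where jb: "(j, b) \<in> g k" "j \<in> Obj (idx Y)" "b \<in> Hom C (dob Y j) (dob Z k)"
      using g.obtain_rep[OF k] .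
    obtain i a where ia: "(i, a) \<in> f j" "i \<in> Obj (idx X)" "a \<in> Hom C (dob X i) (dob Y j)"
      using f.obtain_rep[OF jb(2)] .
    let ?ba = "Cmp C (dob X i) (dob Y j) (dob Z k) b a"
    show "\<exists>i a. represents C X Z (Cmp (Pro C) X Y Z g f) k i a"
      unfolding represents_def
    proof (intro exI conjI ballI)
      show "i \<in> Obj (idx X)" by fact
      show "?ba \<in> Hom C (dob X i) (dob Z k)" using k jb ia by (intro f.X.C.Cmp_in_Hom) auto
      show "Cmp (Pro C) X Y Z g f k = germ C X (dob Z k) (i, ?ba)"
        by (rule Cmp_Pro_eq[OF f g k jb(1) ia(1)])
      fix k' w assume k': "k' \<in> Obj (idx Z)" and w: "w \<in> Hom (idx Z) k k'"
      have "Cmp C (dob X i) (dob Z k) (dob Z k') (dmo Z k k' w) ?ba =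
          Cmp C (dob X i) (dob Y j) (dob Z k') (Cmp C (dob Y j) (dob Z k) (dob Z k') (dmo Z k k' w) b) a"
        by (rule f.X.C.Cmp_assoc[symmetric]) (use k k' w jb ia in auto)
      then show "germ C X (dob Z k') (i, Cmp C (dob X i) (dob Z k) (dob Z k') (dmo Z k k' w) ?ba) =
          Cmp (Pro C) X Y Z g f k'"
        using Cmp_Pro_eq[OF f g k' g.compatible(2)[OF k k' w jb(1)] ia(1)] by simp
    qed
  qed
  then show ?thesis by unfold_locales
qed

lemma pro_morphism_iff:
  "\<lbrakk>pro_object C X; pro_object C Y\<rbrakk> \<Longrightarrow> f \<in> Hom (Pro C) X Y \<longleftrightarrow> pro_morphism C X Y f"
  by (simp add: Hom_Pro pro_morphism_def pro_morphism_axioms_def)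

text \<open>The components are equivalence classes, so one common element makes them equal.\<close>

lemma pro_morphism_eqI:
  assumes f: "pro_morphism C X Y f" and g: "pro_morphism C X Y g"
    and common: "\<And>j. j \<in> Obj (idx Y) \<Longrightarrow> f j \<inter> g j \<noteq> {}"
  shows "f = g"
proof (rule extensionalityI[of _ "Obj (idx Y)"])
  interpret f: pro_morphism C X Y f by fact
  interpret g: pro_morphism C X Y g by fact
  show "f \<in> extensional (Obj (idx Y))" "g \<in> extensional (Obj (idx Y))"
    using f.f g.f by (auto simp: pro_hom_def PiE_def)
  show "f j = g j" if j: "j \<in> Obj (idx Y)" for j
  proof -
    obtain i a where "(i, a) \<in> f j" "(i, a) \<in> g j" using common[OF j] by auto
    then show ?thesis using f.rep(3)[OF j] g.rep(3)[OF j] by metis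
  qed
qed

theorem category_Pro:
  assumes "category C"
  shows "category (Pro C :: (('i, 'k, 'o, 'm) diagram, 'i \<Rightarrow> ('i \<times> 'm) set) cat)"
proof -
  interpret C: category C by fact
  show ?thesis
  proof
    fix X :: "('i, 'k, 'o, 'm) diagram" assume "X \<in> Obj (Pro C)"
    then show "Idn (Pro C) X \<in> Hom (Pro C) X X"
      using pro_morphism_Idn by (simp add: Obj_Pro_iff pro_morphism_iff)
  next
    fix X Y Z :: "('i, 'k, 'o, 'm) diagram" and f g
    assume "X \<in> Obj (Pro C)" "Y \<in> Obj (Pro C)" "Z \<in> Obj (Pro C)" "f \<in> Hom (Pro C) X Y" "g \<in> Hom (Pro C) Y Z"
    then show "Cmp (Pro C) X Y Z g f \<in> Hom (Pro C) X Z"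
      using pro_morphism_Cmp by (simp add: Obj_Pro_iff pro_morphism_iff)
  next
    fix X Y :: "('i, 'k, 'o, 'm) diagram" and f
    assume "X \<in> Obj (Pro C)" "Y \<in> Obj (Pro C)" "f \<in> Hom (Pro C) X Y"
    then have X: "pro_object C X" and Y: "pro_object C Y" and f: "pro_morphism C X Y f"
      by (simp_all add: Obj_Pro_iff pro_morphism_iff)
    interpret f: pro_morphism C X Y f by fact
    show "Cmp (Pro C) X Y Y (Idn (Pro C) Y) f = f"
    proof (rule pro_morphism_eqI[OF pro_morphism_Cmp[OF f pro_morphism_Idn[OF Y]] f])
      fix j assume j: "j \<in> Obj (idx Y)"
      obtain i a where ia: "(i, a) \<in> f j" "i \<in> Obj (idx X)" "a \<in> Hom C (dob X i) (dob Y j)"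
        using f.obtain_rep[OF j] .
      have "(i, a) \<in> Cmp (Pro C) X Y Y (Idn (Pro C) Y) f j"
        using Cmp_Pro_rep[OF f pro_morphism_Idn[OF Y] j Idn_Pro_rep[OF Y j] ia(1)] ia j
        by (simp add: C.Cmp_Idn_left f.X.F.fobj_in_Obj f.Y.F.fobj_in_Obj)
      with ia(1) show "Cmp (Pro C) X Y Y (Idn (Pro C) Y) f j \<inter> f j \<noteq> {}" by blast
    qed
    show "Cmp (Pro C) X X Y f (Idn (Pro C) X) = f"
    proof (rule pro_morphism_eqI[OF pro_morphism_Cmp[OF pro_morphism_Idn[OF X] f] f])
      fix j assume j: "j \<in> Obj (idx Y)"
      obtain i a where ia: "(i, a) \<in> f j" "i \<in> Obj (idx X)" "a \<in> Hom C (dob X i) (dob Y j)"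
        using f.obtain_rep[OF j] .
      have "(i, a) \<in> Cmp (Pro C) X X Y f (Idn (Pro C) X) j"
        using Cmp_Pro_rep[OF pro_morphism_Idn[OF X] f j ia(1) Idn_Pro_rep[OF X ia(2)]] ia j
        by (simp add: C.Cmp_Idn_right f.X.F.fobj_in_Obj f.Y.F.fobj_in_Obj)
      with ia(1) show "Cmp (Pro C) X X Y f (Idn (Pro C) X) j \<inter> f j \<noteq> {}" by blast
    qed
  next
    fix W X Y Z :: "('i, 'k, 'o, 'm) diagram" and f g h
    assume "W \<in> Obj (Pro C)" "X \<in> Obj (Pro C)" "Y \<in> Obj (Pro C)" "Z \<in> Obj (Pro C)"
      "f \<in> Hom (Pro C) W X" "g \<in> Hom (Pro C) X Y" "h \<in> Hom (Pro C) Y Z"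
    then have f: "pro_morphism C W X f" and g: "pro_morphism C X Y g" and h: "pro_morphism C Y Z h"
      by (simp_all add: Obj_Pro_iff pro_morphism_iff)
    interpret f: pro_morphism C W X f by fact
    interpret g: pro_morphism C X Y g by fact
    interpret h: pro_morphism C Y Z h by fact
    note hg = pro_morphism_Cmp[OF g h] and gf = pro_morphism_Cmp[OF f g]
    show "Cmp (Pro C) W X Z (Cmp (Pro C) X Y Z h g) f = Cmp (Pro C) W Y Z h (Cmp (Pro C) W X Y g f)"
    proof (rule pro_morphism_eqI[OF pro_morphism_Cmp[OF f hg] pro_morphism_Cmp[OF gf h]])
      fix k assume k: "k \<in> Obj (idx Z)"
      obtain j c where jc: "(j, c) \<in> h k" "j \<in> Obj (idx Y)" "c \<in> Hom C (dob Y j) (dob Z k)"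
        using h.obtain_rep[OF k] .
      obtain i b where ib: "(i, b) \<in> g j" "i \<in> Obj (idx X)" "b \<in> Hom C (dob X i) (dob Y j)"
        using g.obtain_rep[OF jc(2)] .
      obtain l a where la: "(l, a) \<in> f i" "l \<in> Obj (idx W)" "a \<in> Hom C (dob W l) (dob X i)"
        using f.obtain_rep[OF ib(2)] .
      have "Cmp C (dob W l) (dob X i) (dob Z k) (Cmp C (dob X i) (dob Y j) (dob Z k) c b) a =
          Cmp C (dob W l) (dob Y j) (dob Z k) c (Cmp C (dob W l) (dob X i) (dob Y j) b a)"
        using k jc ib la
        by (intro C.Cmp_assoc f.X.F.fobj_in_Obj f.Y.F.fobj_in_Obj g.Y.F.fobj_in_Obj h.Y.F.fobj_in_Obj)
      then show "Cmp (Pro C) W X Z (Cmp (Pro C) X Y Z h g) f k \<inter>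
          Cmp (Pro C) W Y Z h (Cmp (Pro C) W X Y g f) k \<noteq> {}"
        using Cmp_Pro_rep[OF f hg k Cmp_Pro_rep[OF g h k jc(1) ib(1)] la(1)]
          Cmp_Pro_rep[OF gf h k jc(1) Cmp_Pro_rep[OF f g jc(2) ib(1) la(1)]] by auto
    qed
  qed
qed

section \<open>Extension of contents on clopen sets to Radon measures\<close>

text \<open>
  The cylinders of a limit of finite sets are the intended base. Being compact as well as open, its
  members can be interpolated between compact and open sets, so they take over the role of
  Urysohn functions.
\<close>

locale clopen_base = algebra "topspace X" \<C> for X :: "'x topology" and \<C> +
  assumes compact: "compact_space X" and Hausdorff: "Hausdorff_space X"
    and open_\<C>: "C \<in> \<C> \<Longrightarrow> openin X C"
    and base: "\<lbrakk>openin X U; x \<in> U\<rbrakk> \<Longrightarrow> \<exists>C\<in>\<C>. x \<in> C \<and> C \<subseteq> U"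
begin

lemma closed_\<C>: "C \<in> \<C> \<Longrightarrow> closedin X C"
  using open_\<C>[OF compl_sets] sets_into_space by (simp add: closedin_def)

lemma interpolate:
  assumes K: "closedin X K" and U: "openin X U" and KU: "K \<subseteq> U"
  obtains C where "C \<in> \<C>" "K \<subseteq> C" "C \<subseteq> U"
proof -
  have "\<exists>C\<in>\<C>. x \<in> C \<and> C \<subseteq> U" if "x \<in> K" for x
    using base[OF U] KU that by blast
  then obtain N where N: "\<And>x. x \<in> K \<Longrightarrow> N x \<in> \<C> \<and> x \<in> N x \<and> N x \<subseteq> U" by metis
  have "compactin X K" using K compact closedin_compact_space by blast
  then obtain J where J: "J \<subseteq> K" "finite J" "K \<subseteq> (\<Union>x\<in>J. N x)"
    by (rule compactin_finite_subcover[of X K K N]) (use N open_\<C> in auto)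
  show ?thesis
  proof
    show "(\<Union>x\<in>J. N x) \<in> \<C>" using J N by (intro finite_UN) auto
    show "K \<subseteq> (\<Union>x\<in>J. N x)" "(\<Union>x\<in>J. N x) \<subseteq> U" using J N by auto
  qed
qed

lemma emeasure_open_eq_SUP_clopen:
  assumes \<mu>: "\<mu> \<in> radon_measures X" and U: "openin X U"
  shows "emeasure \<mu> U = (SUP C\<in>{C \<in> \<C>. C \<subseteq> U}. emeasure \<mu> C)"
proof (rule antisym)
  note s = radon_measuresD(2)[OF \<mu>]
  show "(SUP C\<in>{C \<in> \<C>. C \<subseteq> U}. emeasure \<mu> C) \<le> emeasure \<mu> U"
    using U by (auto intro!: SUP_least emeasure_mono simp: s openin_in_sets)
  show "emeasure \<mu> U \<le> (SUP C\<in>{C \<in> \<C>. C \<subseteq> U}. emeasure \<mu> C)"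
    unfolding radon_measuresD(4)[OF \<mu> openin_in_sets[OF U]]
  proof (rule SUP_least)
    fix K assume "K \<in> {K. compactin X K \<and> K \<subseteq> U}"
    then have K: "closedin X K" "K \<subseteq> U" using Hausdorff compactin_imp_closedin by auto
    obtain C where "C \<in> \<C>" "K \<subseteq> C" "C \<subseteq> U" using interpolate[OF K(1) U K(2)] .
    then show "emeasure \<mu> K \<le> (SUP C\<in>{C \<in> \<C>. C \<subseteq> U}. emeasure \<mu> C)"
      by (intro SUP_upper2[of C] emeasure_mono) (auto simp: s openin_in_sets open_\<C>)
  qed
qed

text \<open>The open sets are a generator that is stable under intersection.\<close>

lemma radon_measures_eqI_clopen:
  assumes \<mu>: "\<mu> \<in> radon_measures X" and \<nu>: "\<nu> \<in> radon_measures X"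
    and eq: "\<And>C. C \<in> \<C> \<Longrightarrow> emeasure \<mu> C = emeasure \<nu> C"
  shows "\<mu> = \<nu>"
proof (rule measure_eqI_generator_eq[of "{U. openin X U}" "topspace X" _ _ "\<lambda>_. topspace X"])
  show "Int_stable {U. openin X U}" by (auto simp: Int_stable_def)
  show "{U. openin X U} \<subseteq> Pow (topspace X)" by (auto dest: openin_subset)
  show "sets \<mu> = sigma_sets (topspace X) {U. openin X U}" "sets \<nu> = sigma_sets (topspace X) {U. openin X U}"
    using radon_measuresD(2)[OF \<mu>] radon_measuresD(2)[OF \<nu>] sets_topology_borel by metis+
  show "emeasure \<mu> U = emeasure \<nu> U" if "U \<in> {U. openin X U}" for U
    using that eq by (simp add: emeasure_open_eq_SUP_clopen[OF \<mu>] emeasure_open_eq_SUP_clopen[OF \<nu>])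
  show "emeasure \<mu> (topspace X) \<noteq> \<infinity>"
    using radon_measuresD(1)[OF \<mu>] radon_measuresD(3)[OF \<mu>]
    by (metis prob_space.emeasure_space_1 ennreal_one_neq_top infinity_ennreal_def)
qed auto

end

text \<open>
  A content on the base is extended as in the proof of the Riesz representation theorem: the
  content determines the measure of open sets from inside, these determine an outer measure from
  outside, and open sets are Caratheodory measurable. Compactness replaces countable additivity
  of the content. Extending along the \<open>\<sigma>\<close>-algebra generated by the base would not suffice, as an open
  set may be an uncountable union of clopen sets.
\<close>

locale clopen_content = clopen_base X \<C> for X :: "'x topology" and \<C> +
  fixes m :: "'x set \<Rightarrow> ennreal"
  assumes positive: "positive \<C> m" and additive: "additive \<C> m" and total: "m (topspace X) = 1"
begin

definition inner :: "'x set \<Rightarrow> ennreal" where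
  "inner U = (SUP C\<in>{C \<in> \<C>. C \<subseteq> U}. m C)"

definition outer :: "'x set \<Rightarrow> ennreal" where
  "outer A = (INF U\<in>{U. openin X U \<and> A \<subseteq> U}. inner U)"

lemma m_empty: "m {} = 0"
  using positive by (simp add: positive_def)

lemma m_mono: "\<lbrakk>A \<in> \<C>; B \<in> \<C>; A \<subseteq> B\<rbrakk> \<Longrightarrow> m A \<le> m B"
  using additive_increasing[OF positive additive] by (rule increasingD)

lemma inner_mono: "U \<subseteq> V \<Longrightarrow> inner U \<le> inner V"
  unfolding inner_def by (rule SUP_subset_mono) auto

lemma inner_\<C>: "C \<in> \<C> \<Longrightarrow> inner C = m C"
  unfolding inner_def by (intro antisym SUP_least SUP_upper) (auto intro: m_mono)

text \<open>
  A clopen set inside \<open>U \<union> V\<close> is cut in two by interpolating between its compact part outside \<open>V\<close> and \<open>U\<close>.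
\<close>

lemma inner_Un:
  assumes U: "openin X U" and V: "openin X V"
  shows "inner (U \<union> V) \<le> inner U + inner V"
  unfolding inner_def[of "U \<union> V"]
proof (rule SUP_least)
  fix C assume "C \<in> {C \<in> \<C>. C \<subseteq> U \<union> V}"
  then have C: "C \<in> \<C>" "C \<subseteq> U \<union> V" by auto
  have "closedin X (C - V)" using closed_\<C>[OF C(1)] V by blast
  then obtain D where D: "D \<in> \<C>" "C - V \<subseteq> D" "D \<subseteq> U"
    using interpolate[of "C - V" U] U C(2) by blast
  have "m C \<le> m (D \<union> (C - D))" using C D by (intro m_mono) auto
  also have "\<dots> = m D + m (C - D)" using C D by (intro additiveD[OF additive]) auto
  also have "\<dots> \<le> inner U + inner V"
    unfolding inner_def using C D by (intro add_mono SUP_upper) auto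
  finally show "m C \<le> inner U + inner V" .
qed

lemma inner_UN:
  fixes U :: "nat \<Rightarrow> 'x set"
  assumes U: "\<And>n. openin X (U n)"
  shows "inner (\<Union>n. U n) \<le> (\<Sum>n. inner (U n))"
  unfolding inner_def[of "\<Union>n. U n"]
proof (rule SUP_least)
  fix C assume "C \<in> {C \<in> \<C>. C \<subseteq> (\<Union>n. U n)}"
  then have C: "C \<in> \<C>" "C \<subseteq> (\<Union>n. U n)" by auto
  have "compactin X C" using closed_\<C>[OF C(1)] compact closedin_compact_space by blast
  then obtain J where J: "finite J" "C \<subseteq> (\<Union>n\<in>J. U n)"
    by (rule compactin_finite_subcover[of X C UNIV U]) (use U C in auto)
  have fin: "inner (\<Union>n\<in>J. U n) \<le> (\<Sum>n\<in>J. inner (U n))"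
    using J(1)
  proof induction
    case empty
    show ?case using inner_\<C>[OF empty_sets] m_empty by simp
  next
    case (insert n J)
    have "inner (U n \<union> (\<Union>n\<in>J. U n)) \<le> inner (U n) + inner (\<Union>n\<in>J. U n)"
      using U by (intro inner_Un) auto
    also have "\<dots> \<le> inner (U n) + (\<Sum>n\<in>J. inner (U n))" by (rule add_left_mono) fact
    finally show ?case using insert by simp
  qed
  have "m C \<le> inner (\<Union>n\<in>J. U n)" unfolding inner_def using C J by (intro SUP_upper) auto
  also note fin
  also have "(\<Sum>n\<in>J. inner (U n)) \<le> (\<Sum>n. inner (U n))" using J by (intro sum_le_suminf) auto
  finally show "m C \<le> (\<Sum>n. inner (U n))" .
qed

lemma outer_open: "openin X U \<Longrightarrow> outer U = inner U"
  unfolding outer_def by (intro antisym INF_greatest INF_lower) (auto intro: inner_mono)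

lemma outer_mono: "A \<subseteq> B \<Longrightarrow> outer A \<le> outer B"
  unfolding outer_def by (rule INF_superset_mono) auto

lemma outer_measure_space_outer: "outer_measure_space (Pow (topspace X)) outer"
  unfolding outer_measure_space_def
proof (intro conjI)
  show "positive (Pow (topspace X)) outer"
    using outer_open[of "{}"] inner_\<C>[OF empty_sets] m_empty by (simp add: positive_def)
  show "increasing (Pow (topspace X)) outer" by (simp add: increasing_def outer_mono)
  show "countably_subadditive (Pow (topspace X)) outer"
    unfolding countably_subadditive_def
  proof (intro allI impI)
    fix A :: "nat \<Rightarrow> 'x set" assume A: "range A \<subseteq> Pow (topspace X)"
    show "outer (\<Union>n. A n) \<le> (\<Sum>n. outer (A n))"
    proof (rule ennreal_le_epsilon)
      fix e :: real assume e: "0 < e" and fin: "(\<Sum>n. outer (A n)) < top"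
      have close: "\<exists>U. openin X U \<and> A n \<subseteq> U \<and> inner U < b" if "outer (A n) < b" for n b
        using that unfolding outer_def by (auto simp: INF_less_iff)
      have "outer (A n) < outer (A n) + e * (1/2) ^ Suc n" for n
        using fin e by (auto simp add: less_top dest!: ennreal_suminf_lessD)
      from close[OF this] have "\<exists>U. openin X U \<and> A n \<subseteq> U \<and>
          inner U < outer (A n) + e * (1/2) ^ Suc n" for n .
      then obtain U where U: "\<And>n. openin X (U n)" "\<And>n. A n \<subseteq> U n"
          "\<And>n. inner (U n) < outer (A n) + e * (1/2) ^ Suc n" by metis
      have "outer (\<Union>n. A n) \<le> inner (\<Union>n. U n)"
        unfolding outer_def using U(1,2) by (intro INF_lower) fast
      also have "\<dots> \<le> (\<Sum>n. inner (U n))" by (rule inner_UN[OF U(1)])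
      also have "\<dots> \<le> (\<Sum>n. outer (A n) + e * (1/2) ^ Suc n)"
        using U(3) by (intro suminf_le less_imp_le) auto
      also have "\<dots> = (\<Sum>n. outer (A n)) + (\<Sum>n. ennreal e * ennreal ((1/2) ^ Suc n))"
        using e by (subst suminf_add[symmetric])
                   (auto simp del: ennreal_suminf_cmult simp add: ennreal_mult[symmetric])
      also have "\<dots> = (\<Sum>n. outer (A n)) + e"
        unfolding ennreal_suminf_cmult
        by (subst suminf_ennreal_eq[OF zero_le_power power_half_series]) auto
      finally show "outer (\<Union>n. A n) \<le> (\<Sum>n. outer (A n)) + e" .
    qed
  qed
qed

text \<open>
  Caratheodory's condition: given an open \<open>V \<supseteq> A\<close>, exhaust \<open>V \<inter> U\<close> by clopen sets \<open>C\<close>; what remains of \<open>A\<close>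
  outside \<open>U\<close> lies in the open set \<open>V - C\<close>, which is exhausted by clopen sets disjoint from \<open>C\<close>.
\<close>

lemma outer_split_le:
  assumes U: "openin X U"
  shows "outer (A \<inter> U) + outer (A - U) \<le> outer A"
  unfolding outer_def[of A]
proof (rule INF_greatest)
  fix V assume "V \<in> {V. openin X V \<and> A \<subseteq> V}"
  then have V: "openin X V" "A \<subseteq> V" by auto
  have *: "m C + outer (A - U) \<le> inner V" if "C \<in> {C \<in> \<C>. C \<subseteq> V \<inter> U}" for C
  proof -
    have C: "C \<in> \<C>" "C \<subseteq> V \<inter> U" using that by auto
    have "openin X (V - C)" using V closed_\<C>[OF C(1)] by (intro openin_diff)
    then have "outer (A - U) \<le> inner (V - C)"
      unfolding outer_def using V C by (intro INF_lower) auto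
    then have "m C + outer (A - U) \<le> m C + inner (V - C)" by (rule add_left_mono)
    also have "\<dots> = (SUP D\<in>{D \<in> \<C>. D \<subseteq> V - C}. m C + m D)"
      unfolding inner_def by (rule ennreal_SUP_add_right) (use empty_sets in blast)
    also have "\<dots> \<le> inner V"
    proof (rule SUP_least)
      fix D assume "D \<in> {D \<in> \<C>. D \<subseteq> V - C}"
      then have D: "D \<in> \<C>" "D \<subseteq> V - C" by auto
      have "m C + m D = m (C \<union> D)"
        using C D by (intro additiveD[OF additive, symmetric]) auto
      also have "\<dots> \<le> inner V" unfolding inner_def using C D by (intro SUP_upper) auto
      finally show "m C + m D \<le> inner V" .
    qed
    finally show ?thesis .
  qed
  have "outer (A \<inter> U) \<le> inner (V \<inter> U)"
    unfolding outer_def using V U by (intro INF_lower) auto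
  then have "outer (A \<inter> U) + outer (A - U) \<le> inner (V \<inter> U) + outer (A - U)"
    by (rule add_right_mono)
  also have "\<dots> = (SUP C\<in>{C \<in> \<C>. C \<subseteq> V \<inter> U}. m C + outer (A - U))"
    unfolding inner_def by (rule ennreal_SUP_add_left[symmetric]) (use empty_sets in blast)
  also have "\<dots> \<le> inner V" by (rule SUP_least) (rule *)
  finally show "outer (A \<inter> U) + outer (A - U) \<le> inner V" .
qed

lemma openin_lambda_system:
  assumes U: "openin X U"
  shows "U \<in> lambda_system (topspace X) (Pow (topspace X)) outer"
  unfolding algebra.lambda_system_eq[OF algebra_Pow]
proof (intro CollectI conjI ballI antisym)
  show "U \<in> Pow (topspace X)" using openin_subset[OF U] by simp
  fix A assume A: "A \<in> Pow (topspace X)"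
  show "outer (A \<inter> U) + outer (A - U) \<le> outer A" by (rule outer_split_le[OF U])
  have oms: "positive (Pow (topspace X)) outer" "countably_subadditive (Pow (topspace X)) outer"
    using outer_measure_space_outer by (auto simp: outer_measure_space_def)
  have "outer (A \<inter> U \<union> (A - U)) \<le> outer (A \<inter> U) + outer (A - U)"
    by (rule subadditiveD[OF ring_of_sets.countably_subadditive_subadditive[OF ring_of_sets_Pow oms]])
       (use A in auto)
  moreover have "A \<inter> U \<union> (A - U) = A" by auto
  ultimately show "outer A \<le> outer (A \<inter> U) + outer (A - U)" by simp
qed

theorem radon_extension:
  "\<exists>\<mu>\<in>radon_measures X. \<forall>C\<in>\<C>. emeasure \<mu> C = m C"
proof -
  define \<mu> where "\<mu> = measure_of (topspace X) (sets (topology_borel X)) outer"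
  have ms: "measure_space (topspace X) (lambda_system (topspace X) (Pow (topspace X)) outer) outer"
    by (rule sigma_algebra.caratheodory_lemma[OF sigma_algebra_Pow outer_measure_space_outer])
  then have "sigma_algebra (topspace X) (lambda_system (topspace X) (Pow (topspace X)) outer)"
    by (simp add: measure_space_def)
  then have "sets (topology_borel X) \<subseteq> lambda_system (topspace X) (Pow (topspace X)) outer"
    unfolding sets_topology_borel
    by (rule sigma_algebra.sigma_sets_subset) (auto intro: openin_lambda_system)
  then have ms': "measure_space (topspace X) (sets (topology_borel X)) outer"
    using sets.sigma_algebra_axioms[of "topology_borel X"] by (intro measure_down[OF ms]) simp_all
  have closed: "sets (topology_borel X) \<subseteq> Pow (topspace X)"
    using sets.space_closed[of "topology_borel X"] by simp
  have sets: "sets \<mu> = sets (topology_borel X)"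
    unfolding \<mu>_def using closed sets.sigma_sets_eq[of "topology_borel X"] by simp
  have sp: "space \<mu> = topspace X" unfolding \<mu>_def using closed by (rule space_measure_of)
  have em: "emeasure \<mu> A = outer A" if "A \<in> sets (topology_borel X)" for A
    unfolding \<mu>_def
    by (rule emeasure_measure_of_sigma) (use ms' that in \<open>auto simp: measure_space_def\<close>)
  have em_open: "emeasure \<mu> U = inner U" if "openin X U" for U
    using em[OF openin_in_sets[OF that]] outer_open[OF that] by simp
  have em_\<C>: "emeasure \<mu> C = m C" if "C \<in> \<C>" for C
    using em_open[OF open_\<C>[OF that]] inner_\<C>[OF that] by simp
  interpret prob_space \<mu>
    using em_\<C>[OF top] total sp by (intro prob_spaceI) simp
  have "\<mu> \<in> radon_measures X"
  proof (rule radon_measuresI[OF compact Hausdorff prob_space_axioms sets])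
    fix U and e :: real assume U: "openin X U" and e: "0 < e"
    show "\<exists>K. closedin X K \<and> K \<subseteq> U \<and> prob U < prob K + e"
    proof (cases "prob U < e")
      case True
      then show ?thesis by (intro exI[of _ "{}"]) auto
    next
      case False
      then have "ennreal (prob U - e) < inner U"
        using e unfolding em_open[OF U, symmetric] by (simp add: emeasure_eq_measure ennreal_less_iff)
      then obtain C where C: "C \<in> \<C>" "C \<subseteq> U" "ennreal (prob U - e) < emeasure \<mu> C"
        unfolding inner_def by (auto simp: less_SUP_iff em_\<C>)
      then have "prob U - e < prob C"
        using False by (simp add: emeasure_eq_measure ennreal_less_iff)
      then have "prob U < prob C + e" by simp
      then show ?thesis using C closed_\<C> by blast
    qed
  qed
  with em_\<C> show ?thesis by blast
qed

end

section \<open>Cofiltered limits of finite sets\<close>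

context cofiltered
begin

lemma finite_cone_objects:
  assumes "finite J" "J \<subseteq> Obj I"
  shows "\<exists>k\<in>Obj I. \<exists>c. \<forall>j\<in>J. c j \<in> Hom I k j"
proof -
  have "\<exists>k\<in>Obj I. \<forall>j\<in>J. Hom I k j \<noteq> {}"
    using assms
  proof (induction J)
    case empty
    then show ?case using nonempty by auto
  next
    case (insert j J)
    then obtain k where k: "k \<in> Obj I" "\<And>j. j \<in> J \<Longrightarrow> Hom I k j \<noteq> {}" by auto
    obtain l where l: "l \<in> Obj I" "Hom I l k \<noteq> {}" "Hom I l j \<noteq> {}"
      using cone_objects[OF k(1)] insert.prems by blast
    have "Hom I l j' \<noteq> {}" if j': "j' \<in> J" for j'
    proof -
      obtain u v where "u \<in> Hom I k j'" "v \<in> Hom I l k" using k(2)[OF j'] l(2) by blast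
      then have "Cmp I l k j' u v \<in> Hom I l j'" using j' insert.prems l k by (intro Cmp_in_Hom) auto
      then show ?thesis by blast
    qed
    then show ?case using l by auto
  qed
  then obtain k where k: "k \<in> Obj I" "\<And>j. j \<in> J \<Longrightarrow> Hom I k j \<noteq> {}" by blast
  then have "\<forall>j\<in>J. (SOME c. c \<in> Hom I k j) \<in> Hom I k j"
    by (simp add: some_in_eq)
  with k(1) show ?thesis by (intro bexI exI)
qed

text \<open>
  A finite diagram in a cofiltered category has a cone: start from a cone over its objects and
  equalize one arrow after the other.
\<close>

lemma finite_cone:
  assumes J: "finite J" "J \<subseteq> Obj I" and G: "finite G"
    and G': "\<And>i j u. (i, j, u) \<in> G \<Longrightarrow> i \<in> J \<and> j \<in> J \<and> u \<in> Hom I i j"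
  shows "\<exists>k\<in>Obj I. \<exists>c. (\<forall>j\<in>J. c j \<in> Hom I k j) \<and> (\<forall>(i, j, u)\<in>G. Cmp I k i j u (c i) = c j)"
  using G G'
proof (induction G)
  case empty
  then show ?case using finite_cone_objects[OF J] by simp
next
  case (insert g G)
  obtain a b w where g: "g = (a, b, w)" by (metis surj_pair)
  have ab: "a \<in> J" "b \<in> J" "w \<in> Hom I a b" "a \<in> Obj I" "b \<in> Obj I"
    using insert.prems[of a b w] J(2) by (auto simp: g)
  have G: "i \<in> J" "j \<in> J" "u \<in> Hom I i j" "i \<in> Obj I" "j \<in> Obj I" if "(i, j, u) \<in> G" for i j u
    using insert.prems[of i j u] that J(2) by auto
  obtain k c where k: "k \<in> Obj I" "\<forall>j\<in>J. c j \<in> Hom I k j"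
      "\<forall>(i, j, u)\<in>G. Cmp I k i j u (c i) = c j"
    using insert.IH[OF insert.prems] by auto
  then have k: "k \<in> Obj I" "\<And>j. j \<in> J \<Longrightarrow> c j \<in> Hom I k j"
      "\<And>i j u. (i, j, u) \<in> G \<Longrightarrow> Cmp I k i j u (c i) = c j"
    by auto
  have "Cmp I k a b w (c a) \<in> Hom I k b" using k(1) k(2)[OF ab(1)] ab by (intro Cmp_in_Hom) auto
  then obtain l e where l: "l \<in> Obj I" "e \<in> Hom I l k"
      "Cmp I l k b (Cmp I k a b w (c a)) e = Cmp I l k b (c b) e"
    using cone_arrows[OF k(1) ab(5) _ k(2)[OF ab(2)]] by blast
  show ?case
  proof (intro bexI[OF _ l(1)] exI[of _ "\<lambda>j. Cmp I l k j (c j) e"] conjI ballI)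
    fix j assume "j \<in> J"
    then show "Cmp I l k j (c j) e \<in> Hom I l j" using l k J(2) by (intro Cmp_in_Hom) auto
  next
    fix t assume t: "t \<in> insert g G"
    obtain i j u where [simp]: "t = (i, j, u)" by (metis surj_pair)
    have "Cmp I l i j u (Cmp I l k i (c i) e) = Cmp I l k j (Cmp I k i j u (c i)) e"
      using t g ab G[of i j u] l k by (intro Cmp_assoc[symmetric]) auto
    also have "\<dots> = Cmp I l k j (c j) e" using t g l(3) k(3)[of i j u] by auto
    finally show "case t of (i, j, u) \<Rightarrow> Cmp I l i j u (Cmp I l k i (c i) e) = Cmp I l k j (c j) e"
      by simp
  qed
qed

end

locale fin_diagram = I: cofiltered I + E: cat_functor I Fin E
  for I :: "('i, 'k) cat" and E :: "('i, 'k, 'a set, 'a \<Rightarrow> 'a) functor_data"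
begin

abbreviation "ob \<equiv> fobj E"
abbreviation "mo \<equiv> fmor E"

definition limit_points :: "('i \<Rightarrow> 'a) set" where
  "limit_points = {x \<in> (\<Pi>\<^sub>E i\<in>Obj I. ob i). \<forall>i\<in>Obj I. \<forall>j\<in>Obj I. \<forall>u\<in>Hom I i j. mo i j u (x i) = x j}"

lemma topspace_fin_limit [simp]: "topspace (fin_limit I E) = limit_points"
  by (auto simp: fin_limit_def limit_points_def)

lemma finite_ob: "i \<in> Obj I \<Longrightarrow> finite (ob i)"
  using E.fobj_in_Obj by (simp add: Fin_def)

lemma mo_in_Hom: "\<lbrakk>i \<in> Obj I; j \<in> Obj I; u \<in> Hom I i j\<rbrakk> \<Longrightarrow> mo i j u \<in> ob i \<rightarrow>\<^sub>E ob j"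
  using E.fmor_in_Hom by (simp add: Fin_def)

lemma mo_mem: "\<lbrakk>i \<in> Obj I; j \<in> Obj I; u \<in> Hom I i j; x \<in> ob i\<rbrakk> \<Longrightarrow> mo i j u x \<in> ob j"
  using mo_in_Hom by (rule PiE_mem)

lemma mo_Cmp:
  "\<lbrakk>i \<in> Obj I; j \<in> Obj I; k \<in> Obj I; u \<in> Hom I i j; v \<in> Hom I j k; x \<in> ob i\<rbrakk>
    \<Longrightarrow> mo i k (Cmp I i j k v u) x = mo j k v (mo i j u x)"
  using E.fmor_Cmp[of i j k u v] by (simp add: Fin_def compose_def)

lemma limit_points_iff:
  "x \<in> limit_points \<longleftrightarrow> x \<in> (\<Pi>\<^sub>E i\<in>Obj I. ob i) \<and>
     (\<forall>i\<in>Obj I. \<forall>j\<in>Obj I. \<forall>u\<in>Hom I i j. mo i j u (x i) = x j)"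
  by (simp add: limit_points_def)

lemma limit_mem: "\<lbrakk>x \<in> limit_points; i \<in> Obj I\<rbrakk> \<Longrightarrow> x i \<in> ob i"
  by (auto simp: limit_points_iff)

lemma limit_compat: "\<lbrakk>x \<in> limit_points; i \<in> Obj I; j \<in> Obj I; u \<in> Hom I i j\<rbrakk> \<Longrightarrow> mo i j u (x i) = x j"
  by (auto simp: limit_points_iff)

abbreviation "prod_space \<equiv> product_topology (\<lambda>i. discrete_topology (ob i)) (Obj I)"

lemma compact_prod_space: "compact_space prod_space"
  by (auto simp: compact_space_product_topology compact_space_discrete_topology finite_ob)

lemma Hausdorff_prod_space: "Hausdorff_space prod_space"
  by (auto simp: Hausdorff_space_product_topology)

lemma openin_coordinate:
  assumes "i \<in> Obj I"
  shows "openin prod_space {x \<in> topspace prod_space. x i \<in> B}"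
proof -
  have "openin prod_space {x \<in> topspace prod_space. x i \<in> B \<inter> ob i}"
    by (rule openin_continuous_map_preimage[OF continuous_map_product_projection[OF assms]]) simp
  moreover have "{x \<in> topspace prod_space. x i \<in> B \<inter> ob i} = {x \<in> topspace prod_space. x i \<in> B}"
    using assms by (auto simp: PiE_mem)
  ultimately show ?thesis by simp
qed

lemma openin_coordinate_relation:
  assumes "i \<in> Obj I" "j \<in> Obj I"
  shows "openin prod_space {x \<in> topspace prod_space. R (x i) (x j)}"
proof -
  have "{x \<in> topspace prod_space. R (x i) (x j)} =
      (\<Union>a. {x \<in> topspace prod_space. x i \<in> {a}} \<inter> {x \<in> topspace prod_space. x j \<in> Collect (R a)})"
    by auto
  also have "openin prod_space \<dots>"
  proof (rule openin_Union, clarify)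
    show "openin prod_space ({x \<in> topspace prod_space. x i \<in> {a}} \<inter>
        {x \<in> topspace prod_space. x j \<in> Collect (R a)})" for a
      by (intro openin_Int openin_coordinate assms)
  qed
  finally show ?thesis .
qed

lemma fin_limit_eq: "fin_limit I E = subtopology prod_space limit_points"
proof -
  have "limit_points = topspace prod_space \<inter>
      {x. \<forall>i\<in>Obj I. \<forall>j\<in>Obj I. \<forall>u\<in>Hom I i j. mo i j u (x i) = x j}"
    by (simp add: limit_points_def Collect_conj_eq)
  then show ?thesis
    unfolding fin_limit_def by (simp only: subtopology_restrict)
qed

definition arrows :: "('i \<times> 'i \<times> 'k) set" where
  "arrows = {(i, j, u). i \<in> Obj I \<and> j \<in> Obj I \<and> u \<in> Hom I i j}"

definition violating :: "'i \<times> 'i \<times> 'k \<Rightarrow> ('i \<Rightarrow> 'a) set" where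
  "violating = (\<lambda>(i, j, u). {x \<in> topspace prod_space. mo i j u (x i) \<noteq> x j})"

lemma openin_violating: "g \<in> arrows \<Longrightarrow> openin prod_space (violating g)"
  unfolding arrows_def violating_def by (clarify, rule openin_coordinate_relation)

lemma limit_points_eq: "limit_points = topspace prod_space - (\<Union>g\<in>arrows. violating g)"
  unfolding limit_points_def arrows_def violating_def by (simp add: set_eq_iff) blast

lemma closedin_limit_points: "closedin prod_space limit_points"
  unfolding limit_points_eq
  by (intro closedin_diff closedin_topspace openin_Union ballI) (metis imageE openin_violating)

lemma compact_fin_limit: "compact_space (fin_limit I E)"
  unfolding fin_limit_eq
  by (intro compact_space_subtopology closedin_compact_space compact_prod_space closedin_limit_points)

lemma Hausdorff_fin_limit: "Hausdorff_space (fin_limit I E)"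
  unfolding fin_limit_eq by (intro Hausdorff_space_subtopology Hausdorff_prod_space)

definition cylinder :: "'i \<Rightarrow> 'a set \<Rightarrow> ('i \<Rightarrow> 'a) set" where
  "cylinder i B = {x \<in> limit_points. x i \<in> B}"

lemma openin_cylinder:
  assumes "i \<in> Obj I"
  shows "openin (fin_limit I E) (cylinder i B)"
proof -
  have "cylinder i B = {x \<in> topspace prod_space. x i \<in> B} \<inter> limit_points"
    using closedin_subset[OF closedin_limit_points] by (auto simp: cylinder_def)
  then show ?thesis
    unfolding fin_limit_eq openin_subtopology
    by (intro exI[of _ "{x \<in> topspace prod_space. x i \<in> B}"] conjI openin_coordinate assms)
qed

lemma cylinder_compl: "limit_points - cylinder i B = cylinder i (- B)"
  by (auto simp: cylinder_def)

lemma cylinder_subset: "cylinder i B \<subseteq> limit_points"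
  by (auto simp: cylinder_def)

lemma closedin_cylinder: "i \<in> Obj I \<Longrightarrow> closedin (fin_limit I E) (cylinder i B)"
  by (simp add: closedin_def cylinder_compl cylinder_subset openin_cylinder)

lemma stone_space_fin_limit: "stone_space (fin_limit I E)"
  unfolding stone_space_def
proof (intro conjI allI impI compact_fin_limit Hausdorff_fin_limit)
  fix S assume S: "connectedin (fin_limit I E) S"
  have "x = y" if xy: "x \<in> S" "y \<in> S" for x y
  proof (rule PiE_ext)
    have L: "x \<in> limit_points" "y \<in> limit_points"
      using connectedin_subset_topspace[OF S] xy by (simp_all add: subset_eq)
    then show "x \<in> (\<Pi>\<^sub>E i\<in>Obj I. ob i)" "y \<in> (\<Pi>\<^sub>E i\<in>Obj I. ob i)"
      by (simp_all add: limit_points_iff)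
    fix i assume i: "i \<in> Obj I"
    have "S \<subseteq> cylinder i {x i} \<or> disjnt S (cylinder i {x i})"
      by (rule connectedin_clopen_cases[OF S closedin_cylinder[OF i] openin_cylinder[OF i]])
    moreover have "x \<in> cylinder i {x i}" using L by (simp add: cylinder_def)
    ultimately have "y \<in> cylinder i {x i}" using xy by (auto simp: disjnt_iff)
    then show "x i = y i" by (simp add: cylinder_def)
  qed
  then show "\<exists>a. S \<subseteq> {a}" by (metis insertCI subsetI)
qed

text \<open>
  Compactness of the limit: finitely many of the equations that define it involve only finitely
  many indices and arrows, over which there is a cone with some apex \<open>k\<close>; an element of \<open>X\<^sub>k\<close>
  then solves these equations.
\<close>

lemma limit_point_exists:
  assumes i: "i \<in> Obj I" and reach: "\<And>k u. \<lbrakk>k \<in> Obj I; u \<in> Hom I k i\<rbrakk> \<Longrightarrow> \<exists>y\<in>ob k. mo k i u y \<in> B"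
  shows "\<exists>x\<in>limit_points. x i \<in> B"
proof (rule ccontr)
  assume none: "\<not> (\<exists>x\<in>limit_points. x i \<in> B)"
  define K where "K = {x \<in> topspace prod_space. x i \<in> B}"
  have "K = topspace prod_space - {x \<in> topspace prod_space. x i \<in> - B}" by (auto simp: K_def)
  also have "closedin prod_space \<dots>"
    by (intro closedin_diff closedin_topspace openin_coordinate i)
  finally have cK: "compactin prod_space K" by (rule closedin_compact_space[OF compact_prod_space])
  have cover: "K \<subseteq> (\<Union>g\<in>arrows. violating g)"
    using none by (auto simp: K_def limit_points_eq)
  obtain G where G: "G \<subseteq> arrows" "finite G" "K \<subseteq> (\<Union>g\<in>G. violating g)"
    by (rule compactin_finite_subcover[OF cK openin_violating cover])
  have ne: "ob j \<noteq> {}" if j: "j \<in> Obj I" for j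
  proof -
    obtain k u v where k: "k \<in> Obj I" "u \<in> Hom I k i" "v \<in> Hom I k j"
      using I.cone_objects[OF i j] by blast
    obtain y where "y \<in> ob k" using reach[OF k(1,2)] by blast
    from mo_mem[OF k(1) j k(3) this] show ?thesis by blast
  qed
  define J where "J = insert i (fst ` G \<union> (fst \<circ> snd) ` G)"
  have J: "finite J" "J \<subseteq> Obj I" using G i by (auto simp: J_def arrows_def)
  have GJ: "a \<in> J \<and> b \<in> J \<and> u \<in> Hom I a b" if "(a, b, u) \<in> G" for a b u
    using that G(1) by (force simp: J_def arrows_def)
  obtain k c where "k \<in> Obj I" "\<forall>j\<in>J. c j \<in> Hom I k j"
    "\<forall>(a, b, u)\<in>G. Cmp I k a b u (c a) = c b"
    using I.finite_cone[OF J G(2) GJ] by auto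
  then have k: "k \<in> Obj I" "\<And>j. j \<in> J \<Longrightarrow> c j \<in> Hom I k j"
    "\<And>a b u. (a, b, u) \<in> G \<Longrightarrow> Cmp I k a b u (c a) = c b"
    by auto
  have "i \<in> J" by (simp add: J_def)
  obtain y where y: "y \<in> ob k" "mo k i (c i) y \<in> B" using reach[OF k(1) k(2)[OF \<open>i \<in> J\<close>]] by blast
  \<comment> \<open>Coordinates that none of the finitely many equations mentions are arbitrary.\<close>
  define x where "x = (\<lambda>j\<in>Obj I. if j \<in> J then mo k j (c j) y else (SOME z. z \<in> ob j))"
  have xJ: "x j = mo k j (c j) y" if "j \<in> J" for j using that J(2) by (auto simp: x_def)
  have "x \<in> (\<Pi>\<^sub>E j\<in>Obj I. ob j)"
  proof (rule PiE_I)
    fix j assume j: "j \<in> Obj I"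
    show "x j \<in> ob j"
    proof (cases "j \<in> J")
      case True
      then show ?thesis using xJ mo_mem[OF k(1) j k(2)[OF True] y(1)] by simp
    next
      case False
      then show ?thesis using ne[OF j] j by (simp add: x_def some_in_eq)
    qed
  qed (simp add: x_def)
  then have xtop: "x \<in> topspace prod_space" by simp
  have "x \<in> K" using xtop y(2) xJ[OF \<open>i \<in> J\<close>] by (simp add: K_def)
  then obtain g where "g \<in> G" "x \<in> violating g" using G(3) by blast
  moreover obtain a b u where g: "g = (a, b, u)" by (metis surj_pair)
  ultimately have abu: "(a, b, u) \<in> G" "mo a b u (x a) \<noteq> x b" by (auto simp: violating_def)
  note ab = GJ[OF abu(1)]
  then have abO: "a \<in> Obj I" "b \<in> Obj I" using J(2) by auto
  have "mo a b u (x a) = mo k b (Cmp I k a b u (c a)) y"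
    using ab abO k(1) k(2)[of a] y(1) xJ[of a] mo_Cmp[of k a b "c a" u y] by simp
  also have "\<dots> = x b" using k(3)[OF abu(1)] xJ[of b] ab by simp
  finally show False using abu(2) by simp
qed

text \<open>
  Otherwise the complement of the image of the limit in \<open>X\<^sub>i\<close> would be met by every transition map and
  so, by \<open>limit_point_exists\<close>, by a limit point. That a single transition map suffices is what lets kernels out of \<open>X\<^sub>i\<close> be recovered, up to the choice of \<open>i\<close>, from their values on limit
  points, and makes compatible weights vanish off the image of the limit.
\<close>

lemma stable_image:
  assumes i: "i \<in> Obj I"
  shows "\<exists>k\<in>Obj I. \<exists>u\<in>Hom I k i. \<forall>y\<in>ob k. \<exists>x\<in>limit_points. x i = mo k i u y"
proof (rule ccontr)
  assume neg: "\<not> ?thesis"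
  have "\<exists>x\<in>limit_points. x i \<in> {z. \<forall>x\<in>limit_points. x i \<noteq> z}"
  proof (rule limit_point_exists[OF i])
    fix k u assume "k \<in> Obj I" "u \<in> Hom I k i"
    then have "\<exists>y\<in>ob k. \<forall>x\<in>limit_points. x i \<noteq> mo k i u y" using neg by fast
    then show "\<exists>y\<in>ob k. mo k i u y \<in> {z. \<forall>x\<in>limit_points. x i \<noteq> z}" by simp
  qed
  then obtain x where "x \<in> limit_points" "\<forall>x'\<in>limit_points. x' i \<noteq> x i" by auto
  then show False by metis
qed

lemma cylinder_pull:
  assumes "i \<in> Obj I" "k \<in> Obj I" "u \<in> Hom I k i"
  shows "cylinder i B = cylinder k {y \<in> ob k. mo k i u y \<in> B}"
  using limit_compat[OF _ assms(2,1,3)] limit_mem[OF _ assms(2)] by (auto simp: cylinder_def)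

text \<open>
  A basic open set of the product constrains finitely many coordinates, all of which are determined by
  a single one.
\<close>

lemma neighbourhood_cylinder:
  assumes U: "openin (fin_limit I E) U" and x: "x \<in> U"
  obtains k where "k \<in> Obj I" "cylinder k {x k} \<subseteq> U"
proof -
  obtain V where V: "openin prod_space V" "U = V \<inter> limit_points"
    using U unfolding fin_limit_eq openin_subtopology by (elim exE conjE) (rule that)
  have xL: "x \<in> limit_points" using x V by blast
  have xV: "x \<in> V" using x V(2) by blast
  have alt: "\<forall>x\<in>V. \<exists>W. finite {i \<in> Obj I. W i \<noteq> topspace (discrete_topology (ob i))} \<and>
      (\<forall>i\<in>Obj I. openin (discrete_topology (ob i)) (W i)) \<and> x \<in> Pi\<^sub>E (Obj I) W \<and> Pi\<^sub>E (Obj I) W \<subseteq> V"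
    using V(1) unfolding openin_product_topology_alt .
  obtain W where "finite {i \<in> Obj I. W i \<noteq> topspace (discrete_topology (ob i))}"
      "x \<in> Pi\<^sub>E (Obj I) W" "Pi\<^sub>E (Obj I) W \<subseteq> V"
    using bspec[OF alt xV] by (elim exE conjE) (rule that)
  then have W: "finite {i \<in> Obj I. W i \<noteq> ob i}" "x \<in> Pi\<^sub>E (Obj I) W" "Pi\<^sub>E (Obj I) W \<subseteq> V"
    by simp_all
  let ?J = "{i \<in> Obj I. W i \<noteq> ob i}"
  have "?J \<subseteq> Obj I" by auto
  then obtain k c where k: "k \<in> Obj I" "\<forall>j\<in>?J. c j \<in> Hom I k j"
    using I.finite_cone_objects[OF W(1)] by auto
  have "y \<in> U" if y: "y \<in> cylinder k {x k}" for y
  proof -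
    have yL: "y \<in> limit_points" and yk: "y k = x k" using y by (auto simp: cylinder_def)
    have "y \<in> Pi\<^sub>E (Obj I) W"
    proof (rule PiE_I)
      fix j assume j: "j \<in> Obj I"
      show "y j \<in> W j"
      proof (cases "W j = ob j")
        case False
        then have c: "c j \<in> Hom I k j" using k(2) j by simp
        have "y j = x j"
          using limit_compat[OF yL k(1) j c] limit_compat[OF xL k(1) j c] yk by simp
        then show ?thesis using W(2) j by (simp add: PiE_mem)
      qed (use limit_mem[OF yL j] in simp)
    next
      fix j assume "j \<notin> Obj I"
      then show "y j = undefined" using yL by (intro PiE_arb[of y _ ob]) (simp_all add: limit_points_iff)
    qed
    then show "y \<in> U" unfolding V(2) using subsetD[OF W(3)] yL by simp
  qed
  then have "cylinder k {x k} \<subseteq> U" by blast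
  then show ?thesis by (rule that[OF k(1)])
qed

definition cylinders :: "('i \<Rightarrow> 'a) set set" where
  "cylinders = {cylinder i B | i B. i \<in> Obj I \<and> B \<subseteq> ob i}"

lemma cylinder_in_cylinders:
  assumes "i \<in> Obj I"
  shows "cylinder i B \<in> cylinders"
proof -
  have "cylinder i B = cylinder i (B \<inter> ob i)" using limit_mem[OF _ assms] by (auto simp: cylinder_def)
  then show ?thesis using assms unfolding cylinders_def by blast
qed

lemma cylinders_common_index:
  assumes "C \<in> cylinders" "D \<in> cylinders"
  obtains k A B where "k \<in> Obj I" "A \<subseteq> ob k" "B \<subseteq> ob k" "C = cylinder k A" "D = cylinder k B"
proof -
  obtain i A j B where ij: "i \<in> Obj I" "C = cylinder i A" "j \<in> Obj I" "D = cylinder j B"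
    using assms by (auto simp: cylinders_def)
  obtain k u v where k: "k \<in> Obj I" "u \<in> Hom I k i" "v \<in> Hom I k j"
    using I.cone_objects[OF ij(1,3)] by blast
  have "C = cylinder k {y \<in> ob k. mo k i u y \<in> A}" "D = cylinder k {y \<in> ob k. mo k j v y \<in> B}"
    unfolding ij(2,4) by (intro cylinder_pull ij k)+
  then show ?thesis by (rule that[OF k(1), rotated 2]) auto
qed

lemma clopen_base_cylinders: "clopen_base (fin_limit I E) cylinders"
proof -
  obtain i0 where i0: "i0 \<in> Obj I" using I.nonempty by blast
  have "algebra limit_points cylinders"
    unfolding algebra_iff_Int
  proof (intro conjI ballI)
    show "cylinders \<subseteq> Pow limit_points" by (auto simp: cylinders_def cylinder_def)
    show "{} \<in> cylinders" using cylinder_in_cylinders[OF i0, of "{}"] by (simp add: cylinder_def)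
    fix C assume C: "C \<in> cylinders"
    then obtain i B where "i \<in> Obj I" "C = cylinder i B" by (auto simp: cylinders_def)
    then show "limit_points - C \<in> cylinders"
      using cylinder_in_cylinders by (simp add: cylinder_compl)
    fix D assume D: "D \<in> cylinders"
    obtain k A B where k: "k \<in> Obj I" "C = cylinder k A" "D = cylinder k B"
      by (rule cylinders_common_index[OF C D])
    have "C \<inter> D = cylinder k (A \<inter> B)" by (auto simp: k cylinder_def)
    then show "C \<inter> D \<in> cylinders" using cylinder_in_cylinders[OF k(1)] by simp
  qed
  moreover have "clopen_base_axioms (fin_limit I E) cylinders"
  proof
    show "\<exists>C\<in>cylinders. x \<in> C \<and> C \<subseteq> U" if U: "openin (fin_limit I E) U" and x: "x \<in> U" for U x
    proof -
      obtain k where k: "k \<in> Obj I" "cylinder k {x k} \<subseteq> U" using neighbourhood_cylinder[OF U x] .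
      moreover have "x \<in> cylinder k {x k}" using openin_subset[OF U] x by (auto simp: cylinder_def)
      ultimately show ?thesis using cylinder_in_cylinders[OF k(1)] by blast
    qed
  qed (auto simp: compact_fin_limit Hausdorff_fin_limit cylinders_def openin_cylinder)
  ultimately show ?thesis by (simp add: clopen_base_def)
qed

text \<open>
  Every point has a cylinder around it on which \<open>h\<close> varies little. By compactness finitely many of
  these suffice, and over a common index \<open>k\<close> each of them is a union of fibres of \<open>x \<mapsto> x k\<close>.
\<close>

lemma continuous_approx_cylinder:
  assumes h: "continuous_map (fin_limit I E) euclideanreal h" and e: "0 < e"
  shows "\<exists>k\<in>Obj I. \<exists>H. \<forall>x\<in>limit_points. \<bar>h x - H (x k)\<bar> < e"
proof -
  have "\<exists>k\<in>Obj I. \<forall>y\<in>cylinder k {x k}. \<bar>h y - h x\<bar> < e / 2" if x: "x \<in> limit_points" for x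
  proof -
    have "openin (fin_limit I E) {y \<in> limit_points. h y \<in> ball (h x) (e / 2)}"
      using openin_continuous_map_preimage[OF h, of "ball (h x) (e / 2)"] by simp
    moreover have "x \<in> {y \<in> limit_points. h y \<in> ball (h x) (e / 2)}" using x e by simp
    ultimately obtain k where "k \<in> Obj I" "cylinder k {x k} \<subseteq> {y \<in> limit_points. h y \<in> ball (h x) (e / 2)}"
      by (rule neighbourhood_cylinder)
    then show ?thesis by (intro bexI[of _ k]) (auto simp: dist_real_def abs_minus_commute)
  qed
  then obtain N where "\<forall>x\<in>limit_points. N x \<in> Obj I \<and> (\<forall>y\<in>cylinder (N x) {x (N x)}. \<bar>h y - h x\<bar> < e / 2)"
    by metis
  then have N: "\<And>x. x \<in> limit_points \<Longrightarrow> N x \<in> Obj I"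
      "\<And>x y. x \<in> limit_points \<Longrightarrow> y \<in> cylinder (N x) {x (N x)} \<Longrightarrow> \<bar>h y - h x\<bar> < e / 2"
    by auto
  have "compactin (fin_limit I E) limit_points"
    using compact_fin_limit by (simp add: compact_space_def)
  then obtain J where J: "J \<subseteq> limit_points" "finite J" "limit_points \<subseteq> (\<Union>x\<in>J. cylinder (N x) {x (N x)})"
  proof (rule compactin_finite_subcover[of _ _ limit_points "\<lambda>x. cylinder (N x) {x (N x)}"])
    show "openin (fin_limit I E) (cylinder (N x) {x (N x)})" if "x \<in> limit_points" for x
      using N(1)[OF that] by (rule openin_cylinder)
    show "limit_points \<subseteq> (\<Union>x\<in>limit_points. cylinder (N x) {x (N x)})"
      by (auto simp: cylinder_def)
  qed
  have "finite (N ` J)" "N ` J \<subseteq> Obj I" using J N(1) by auto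
  then obtain k c where k: "k \<in> Obj I" "\<forall>j\<in>N ` J. c j \<in> Hom I k j"
    using I.finite_cone_objects[of "N ` J"] by auto
  \<comment> \<open>Off the image of the limit the value of \<open>H\<close> is arbitrary.\<close>
  define H where "H z = h (SOME y. y \<in> limit_points \<and> y k = z)" for z
  have "\<bar>h y - H (y k)\<bar> < e" if y: "y \<in> limit_points" for y
  proof -
    define y' where "y' = (SOME y'. y' \<in> limit_points \<and> y' k = y k)"
    have y': "y' \<in> limit_points" "y' k = y k"
      unfolding y'_def using someI[of "\<lambda>y'. y' \<in> limit_points \<and> y' k = y k" y] y by auto
    obtain x where x: "x \<in> J" "y \<in> cylinder (N x) {x (N x)}" using J(3) y by blast
    have xL: "x \<in> limit_points" using x(1) J(1) by blast
    have cx: "c (N x) \<in> Hom I k (N x)" using k(2) x(1) by blast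
    have "y' (N x) = y (N x)"
      using limit_compat[OF y'(1) k(1) N(1)[OF xL] cx] limit_compat[OF y k(1) N(1)[OF xL] cx] y'(2) by simp
    then have "y' \<in> cylinder (N x) {x (N x)}" using x(2) y'(1) by (simp add: cylinder_def)
    then have "\<bar>h y' - h x\<bar> < e / 2" "\<bar>h y - h x\<bar> < e / 2" using N(2)[OF xL] x(2) by auto
    then show ?thesis unfolding H_def y'_def[symmetric] by linarith
  qed
  with k(1) show ?thesis by blast
qed

end

section \<open>Kolmogorov extension on a limit of finite sets\<close>

context fin_diagram
begin

sublocale base: clopen_base "fin_limit I E" cylinders
  by (rule clopen_base_cylinders)

definition is_extension :: "('i \<Rightarrow> 'a \<Rightarrow> real) \<Rightarrow> ('i \<Rightarrow> 'a) measure \<Rightarrow> bool" where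
  "is_extension p \<mu> \<longleftrightarrow> \<mu> \<in> radon_measures (fin_limit I E) \<and>
     (\<forall>i\<in>Obj I. \<forall>B\<subseteq>ob i. emeasure \<mu> (cylinder i B) = ennreal (sum (p i) B))"

lemma is_extensionD:
  assumes "is_extension p \<mu>"
  shows "\<mu> \<in> radon_measures (fin_limit I E)"
    "\<lbrakk>i \<in> Obj I; B \<subseteq> ob i\<rbrakk> \<Longrightarrow> emeasure \<mu> (cylinder i B) = ennreal (sum (p i) B)"
  using assms by (auto simp: is_extension_def)

lemma is_extension_unique:
  assumes "is_extension p \<mu>" "is_extension p \<nu>"
  shows "\<mu> = \<nu>"
proof (rule base.radon_measures_eqI_clopen[OF is_extensionD(1)[OF assms(1)] is_extensionD(1)[OF assms(2)]])
  fix C assume "C \<in> cylinders"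
  then obtain i B where "i \<in> Obj I" "B \<subseteq> ob i" "C = cylinder i B" by (auto simp: cylinders_def)
  then show "emeasure \<mu> C = emeasure \<nu> C"
    using is_extensionD(2)[OF assms(1)] is_extensionD(2)[OF assms(2)] by simp
qed

lemma cylinder_in_sets: "i \<in> Obj I \<Longrightarrow> cylinder i B \<in> sets (topology_borel (fin_limit I E))"
  by (rule openin_in_sets[OF openin_cylinder])

lemma sum_indicator_cylinder:
  fixes H :: "'a \<Rightarrow> 'b :: semiring_1"
  assumes i: "i \<in> Obj I" and x: "x \<in> limit_points"
  shows "(\<Sum>y\<in>ob i. H y * indicator (cylinder i {y}) x) = H (x i)"
proof -
  have "(\<Sum>y\<in>ob i. H y * indicator (cylinder i {y}) x) = (\<Sum>y\<in>ob i. if y = x i then H y else 0)"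
    by (rule sum.cong) (use x in \<open>auto simp: cylinder_def indicator_def\<close>)
  also have "\<dots> = H (x i)" using finite_ob[OF i] limit_mem[OF x i] by simp
  finally show ?thesis .
qed

lemma nn_integral_coordinate:
  assumes \<mu>: "is_extension p \<mu>" and i: "i \<in> Obj I"
  shows "(\<integral>\<^sup>+x. H (x i) \<partial>\<mu>) = (\<Sum>y\<in>ob i. H y * ennreal (p i y))"
proof -
  note r = is_extensionD(1)[OF \<mu>]
  have c: "cylinder i {y} \<in> sets \<mu>" for y
    using cylinder_in_sets[OF i] radon_measuresD(2)[OF r] by simp
  have "(\<integral>\<^sup>+x. H (x i) \<partial>\<mu>) = (\<integral>\<^sup>+x. (\<Sum>y\<in>ob i. H y * indicator (cylinder i {y}) x) \<partial>\<mu>)"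
    by (rule nn_integral_cong) (simp add: sum_indicator_cylinder[OF i] radon_measuresD(3)[OF r])
  also have "\<dots> = (\<Sum>y\<in>ob i. \<integral>\<^sup>+x. H y * indicator (cylinder i {y}) x \<partial>\<mu>)"
    using c by (intro nn_integral_sum) auto
  also have "\<dots> = (\<Sum>y\<in>ob i. H y * ennreal (p i y))"
    by (rule sum.cong) (use c is_extensionD(2)[OF \<mu> i] in \<open>simp_all add: nn_integral_cmult_indicator\<close>)
  finally show ?thesis .
qed

lemma continuous_map_coordinate:
  fixes H :: "'a \<Rightarrow> real"
  assumes "i \<in> Obj I"
  shows "continuous_map (fin_limit I E) euclideanreal (\<lambda>x. H (x i))"
proof -
  have "openin (fin_limit I E) {x \<in> limit_points. H (x i) \<in> U}" for U
    using openin_cylinder[OF assms, of "H -` U"] by (simp add: cylinder_def)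
  then show ?thesis by (simp add: continuous_map_def)
qed

lemma integral_coordinate:
  fixes H :: "'a \<Rightarrow> real"
  assumes \<mu>: "is_extension p \<mu>" and i: "i \<in> Obj I" and p: "\<And>y. y \<in> ob i \<Longrightarrow> 0 \<le> p i y"
  shows "(\<integral>x. H (x i) \<partial>\<mu>) = (\<Sum>y\<in>ob i. H y * p i y)"
proof -
  note r = is_extensionD(1)[OF \<mu>]
  interpret prob_space \<mu> by (rule radon_measuresD(1)[OF r])
  have c: "cylinder i {y} \<in> sets \<mu>" for y
    using cylinder_in_sets[OF i] radon_measuresD(2)[OF r] by simp
  have m: "measure \<mu> (cylinder i {y}) = p i y" if "y \<in> ob i" for y
    using is_extensionD(2)[OF \<mu> i, of "{y}"] that p[OF that] by (simp add: measure_def)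
  have "(\<integral>x. H (x i) \<partial>\<mu>) = (\<integral>x. (\<Sum>y\<in>ob i. H y * indicator (cylinder i {y}) x) \<partial>\<mu>)"
    by (rule Bochner_Integration.integral_cong)
       (simp_all add: sum_indicator_cylinder[OF i] radon_measuresD(3)[OF r])
  also have "\<dots> = (\<Sum>y\<in>ob i. \<integral>x. H y * indicator (cylinder i {y}) x \<partial>\<mu>)"
    using c by (intro Bochner_Integration.integral_sum) (auto simp: emeasure_eq_measure)
  also have "\<dots> = (\<Sum>y\<in>ob i. H y * p i y)"
    by (rule sum.cong) (use c m sets.sets_into_space[OF c] in \<open>simp_all add: Int_absorb2\<close>)
  finally show ?thesis .
qed

end

locale fin_family = fin_diagram I E
  for I :: "('i, 'k) cat" and E :: "('i, 'k, 'a set, 'a \<Rightarrow> 'a) functor_data" +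
  fixes p :: "'i \<Rightarrow> 'a \<Rightarrow> real"
  assumes nonneg: "i \<in> Obj I \<Longrightarrow> y \<in> ob i \<Longrightarrow> 0 \<le> p i y"
    and total: "i \<in> Obj I \<Longrightarrow> (\<Sum>y\<in>ob i. p i y) = 1"
    and compat: "\<lbrakk>i \<in> Obj I; j \<in> Obj I; u \<in> Hom I i j; z \<in> ob j\<rbrakk>
      \<Longrightarrow> p j z = (\<Sum>y\<in>{y \<in> ob i. mo i j u y = z}. p i y)"
begin

lemma weight_pull:
  assumes "i \<in> Obj I" "k \<in> Obj I" "u \<in> Hom I k i" "B \<subseteq> ob i"
  shows "sum (p i) B = sum (p k) {y \<in> ob k. mo k i u y \<in> B}"
proof -
  have "sum (p i) B = (\<Sum>z\<in>B. \<Sum>y\<in>{y \<in> ob k. mo k i u y = z}. p k y)"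
    using compat[OF assms(2,1,3)] assms(4) by (intro sum.cong) auto
  also have "\<dots> = (\<Sum>z\<in>B. \<Sum>y\<in>{y \<in> {y \<in> ob k. mo k i u y \<in> B}. mo k i u y = z}. p k y)"
    by (intro sum.cong) auto
  also have "\<dots> = sum (p k) {y \<in> ob k. mo k i u y \<in> B}"
    by (rule sum.group) (use assms finite_ob in \<open>auto intro: finite_subset\<close>)
  finally show ?thesis .
qed

text \<open>By \<open>stable_image\<close>, some transition map misses \<open>B\<close>; the weight of \<open>B\<close> is that of its empty preimage.\<close>

lemma weight_null:
  assumes i: "i \<in> Obj I" and B: "B \<subseteq> ob i" and empty: "cylinder i B = {}"
  shows "sum (p i) B = 0"
proof -
  obtain k u where k: "k \<in> Obj I" "u \<in> Hom I k i" "\<forall>y\<in>ob k. \<exists>x\<in>limit_points. x i = mo k i u y"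
    using stable_image[OF i] by (elim bexE) (rule that)
  have "{y \<in> ob k. mo k i u y \<in> B} = {}" using k(3) empty by (fastforce simp: cylinder_def)
  then show ?thesis using weight_pull[OF i k(1,2) B] by (simp only: sum.empty)
qed

lemma weight_mono:
  assumes i: "i \<in> Obj I" and A: "A \<subseteq> ob i" and B: "B \<subseteq> ob i" and sub: "cylinder i A \<subseteq> cylinder i B"
  shows "sum (p i) A \<le> sum (p i) B"
proof -
  have fin: "finite A" "finite B" using finite_ob[OF i] A B finite_subset by auto
  have "cylinder i (A - B) = {}" using sub by (auto simp: cylinder_def)
  then have "sum (p i) (A - B) = 0" using A by (intro weight_null[OF i]) auto
  then have "sum (p i) A = sum (p i) (A \<inter> B)"
    using sum.Int_Diff[OF fin(1), of "p i" B] by simp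
  also have "\<dots> \<le> sum (p i) B"
    using fin B nonneg[OF i] by (intro sum_mono2) auto
  finally show ?thesis .
qed

lemma weight_eq:
  assumes i: "i \<in> Obj I" "A \<subseteq> ob i" and j: "j \<in> Obj I" "B \<subseteq> ob j" and eq: "cylinder i A = cylinder j B"
  shows "sum (p i) A = sum (p j) B"
proof -
  obtain k u v where k: "k \<in> Obj I" "u \<in> Hom I k i" "v \<in> Hom I k j"
    using I.cone_objects[OF i(1) j(1)] by blast
  note pu = cylinder_pull[OF i(1) k(1,2), of A] and pv = cylinder_pull[OF j(1) k(1,3), of B]
  have "sum (p k) {y \<in> ob k. mo k i u y \<in> A} = sum (p k) {y \<in> ob k. mo k j v y \<in> B}"
    by (intro antisym weight_mono[OF k(1)]) (use pu pv eq in auto)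
  then show ?thesis
    using weight_pull[OF i(1) k(1,2) i(2)] weight_pull[OF j(1) k(1,3) j(2)] by simp
qed

text \<open>The description is unambiguous by \<open>weight_eq\<close>.\<close>

definition content :: "('i \<Rightarrow> 'a) set \<Rightarrow> ennreal" where
  "content C = (THE r. \<exists>i B. i \<in> Obj I \<and> B \<subseteq> ob i \<and> C = cylinder i B \<and> r = ennreal (sum (p i) B))"

lemma content_cylinder:
  assumes "i \<in> Obj I" "B \<subseteq> ob i"
  shows "content (cylinder i B) = ennreal (sum (p i) B)"
  unfolding content_def
proof (rule the_equality)
  show "\<exists>i' B'. i' \<in> Obj I \<and> B' \<subseteq> ob i' \<and> cylinder i B = cylinder i' B' \<and>
      ennreal (sum (p i) B) = ennreal (sum (p i') B')"
    using assms by (intro exI[of _ i] exI[of _ B]) simp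
  fix r assume "\<exists>i' B'. i' \<in> Obj I \<and> B' \<subseteq> ob i' \<and> cylinder i B = cylinder i' B' \<and> r = ennreal (sum (p i') B')"
  then obtain i' B' where "i' \<in> Obj I" "B' \<subseteq> ob i'" "cylinder i B = cylinder i' B'"
      "r = ennreal (sum (p i') B')" by (elim exE conjE) (rule that)
  then show "r = ennreal (sum (p i) B)" using weight_eq[OF assms] by simp
qed

lemma clopen_content_content: "clopen_content (fin_limit I E) cylinders content"
proof
  obtain i0 where i0: "i0 \<in> Obj I" using I.nonempty by blast
  have empty: "cylinder i0 {} = {}" by (simp add: cylinder_def)
  have full: "cylinder i0 (ob i0) = limit_points" using limit_mem[OF _ i0] by (auto simp: cylinder_def)
  show "positive cylinders content"
    using content_cylinder[OF i0, of "{}"] by (simp add: positive_def empty)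
  show "content (topspace (fin_limit I E)) = 1"
    using content_cylinder[OF i0, of "ob i0"] total[OF i0] by (simp add: full)
  show "additive cylinders content"
    unfolding additive_def
  proof (intro ballI impI)
    fix C D assume C: "C \<in> cylinders" and D: "D \<in> cylinders" and CD: "C \<inter> D = {}"
    obtain k A B where k: "k \<in> Obj I" "A \<subseteq> ob k" "B \<subseteq> ob k" "C = cylinder k A" "D = cylinder k B"
      by (rule cylinders_common_index[OF C D])
    have fin: "finite A" "finite B" using k finite_ob[OF k(1)] finite_subset by auto
    have "cylinder k (A \<inter> B) = {}" using CD by (auto simp: k cylinder_def)
    then have "sum (p k) (A \<inter> B) = 0" using k by (intro weight_null) auto
    then have "sum (p k) (A \<union> B) = sum (p k) A + sum (p k) B"
      using sum.union_inter[OF fin, of "p k"] by simp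
    moreover have "C \<union> D = cylinder k (A \<union> B)" by (auto simp: k cylinder_def)
    moreover have "0 \<le> sum (p k) A" "0 \<le> sum (p k) B"
      using k nonneg[OF k(1)] by (auto intro!: sum_nonneg)
    ultimately show "content (C \<union> D) = content C + content D"
      using k by (simp add: content_cylinder flip: ennreal_plus)
  qed
qed

theorem kolmogorov_extension: "\<exists>\<mu>. is_extension p \<mu>"
proof -
  obtain \<mu> where "\<mu> \<in> radon_measures (fin_limit I E)" "\<forall>C\<in>cylinders. emeasure \<mu> C = content C"
    using clopen_content.radon_extension[OF clopen_content_content] by (elim bexE) (rule that)
  then have "is_extension p \<mu>"
    by (simp add: is_extension_def content_cylinder cylinder_in_cylinders)
  then show ?thesis ..
qed

end

section \<open>Finite kernels and diagrams of functions\<close>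

lemma FinKer_simps:
  "Obj FinKer = {X. finite X}"
  "Hom FinKer X Y = {k. (\<forall>x y. 0 \<le> k x y) \<and> (\<forall>x\<in>X. (\<Sum>y\<in>Y. k x y) = 1) \<and>
     (\<forall>x y. x \<notin> X \<or> y \<notin> Y \<longrightarrow> k x y = 0)}"
  "Idn FinKer X = (\<lambda>x y. if x \<in> X \<and> y = x then 1 else 0)"
  "Cmp FinKer X Y Z g f = (\<lambda>x z. \<Sum>y\<in>Y. f x y * g y z)"
  by (simp_all add: FinKer_def)

lemma FinKerD:
  assumes "k \<in> Hom FinKer X Y"
  shows "0 \<le> k x y" "x \<in> X \<Longrightarrow> (\<Sum>y\<in>Y. k x y) = 1" "x \<notin> X \<Longrightarrow> k x y = 0" "y \<notin> Y \<Longrightarrow> k x y = 0"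
  using assms by (simp_all add: FinKer_simps)

lemma category_FinKer: "category (FinKer :: ('a set, 'a \<Rightarrow> 'a \<Rightarrow> real) cat)"
proof
  fix X :: "'a set" assume "X \<in> Obj FinKer"
  then show "Idn FinKer X \<in> Hom FinKer X X" by (auto simp: FinKer_simps)
next
  fix X Y Z :: "'a set" and f g
  assume fin: "X \<in> Obj FinKer" "Y \<in> Obj FinKer" "Z \<in> Obj FinKer"
    and f: "f \<in> Hom FinKer X Y" and g: "g \<in> Hom FinKer Y Z"
  have "(\<Sum>z\<in>Z. \<Sum>y\<in>Y. f x y * g y z) = 1" if x: "x \<in> X" for x
  proof -
    have "(\<Sum>z\<in>Z. \<Sum>y\<in>Y. f x y * g y z) = (\<Sum>y\<in>Y. f x y * (\<Sum>z\<in>Z. g y z))"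
      by (subst sum.swap) (simp add: sum_distrib_left)
    also have "\<dots> = (\<Sum>y\<in>Y. f x y)" using FinKerD(2)[OF g] by simp
    finally show ?thesis using FinKerD(2)[OF f x] by simp
  qed
  moreover have "0 \<le> (\<Sum>y\<in>Y. f x y * g y z)" for x z
    using FinKerD(1)[OF f] FinKerD(1)[OF g] by (intro sum_nonneg mult_nonneg_nonneg)
  moreover have "(\<Sum>y\<in>Y. f x y * g y z) = 0" if "x \<notin> X \<or> z \<notin> Z" for x z
    using that FinKerD(3)[OF f] FinKerD(4)[OF g] by (intro sum.neutral) auto
  ultimately show "Cmp FinKer X Y Z g f \<in> Hom FinKer X Z" by (simp add: FinKer_simps)
next
  fix X Y :: "'a set" and f assume fin: "X \<in> Obj FinKer" "Y \<in> Obj FinKer" and f: "f \<in> Hom FinKer X Y"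
  show "Cmp FinKer X Y Y (Idn FinKer Y) f = f"
  proof (intro ext)
    fix x z
    have "(\<Sum>y\<in>Y. f x y * (if y \<in> Y \<and> z = y then 1 else 0)) = (\<Sum>y\<in>Y. if y = z then f x y else 0)"
      by (rule sum.cong) auto
    then show "Cmp FinKer X Y Y (Idn FinKer Y) f x z = f x z"
      using fin FinKerD(4)[OF f] by (simp add: FinKer_simps)
  qed
  show "Cmp FinKer X X Y f (Idn FinKer X) = f"
  proof (intro ext)
    fix x z
    have "(\<Sum>y\<in>X. (if x \<in> X \<and> y = x then 1 else 0) * f y z) = (\<Sum>y\<in>X. if y = x then f y z else 0)"
      by (rule sum.cong) auto
    then show "Cmp FinKer X X Y f (Idn FinKer X) x z = f x z"
      using fin FinKerD(3)[OF f] by (simp add: FinKer_simps)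
  qed
next
  fix W X Y Z :: "'a set" and f g h
  show "Cmp FinKer W X Z (Cmp FinKer X Y Z h g) f = Cmp FinKer W Y Z h (Cmp FinKer W X Y g f)"
    unfolding FinKer_simps
    by (intro ext, simp add: sum_distrib_left sum_distrib_right mult.assoc, rule sum.swap)
qed

lemma Cmp_FinKer_det_right:
  assumes "finite B" "f \<in> A \<rightarrow> B"
  shows "Cmp FinKer A B C a (det_kernel A f) = (\<lambda>x z. if x \<in> A then a (f x) z else 0)"
proof (intro ext)
  fix x z
  have "(\<Sum>y\<in>B. det_kernel A f x y * a y z) = (\<Sum>y\<in>B. if y = f x then (if x \<in> A then a y z else 0) else 0)"
    by (rule sum.cong) (auto simp: det_kernel_def)
  also have "\<dots> = (if x \<in> A then a (f x) z else 0)"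
    using assms by (auto simp: Pi_iff)
  finally show "Cmp FinKer A B C a (det_kernel A f) x z = (if x \<in> A then a (f x) z else 0)"
    by (simp add: FinKer_simps)
qed

lemma Cmp_FinKer_det_left:
  assumes "finite B"
  shows "Cmp FinKer A B C (det_kernel B f) a = (\<lambda>x z. \<Sum>y\<in>{y \<in> B. f y = z}. a x y)"
proof (intro ext)
  fix x z
  have "(\<Sum>y\<in>B. a x y * det_kernel B f y z) = (\<Sum>y\<in>B. if f y = z then a x y else 0)"
    by (rule sum.cong) (auto simp: det_kernel_def)
  also have "\<dots> = (\<Sum>y\<in>{y \<in> B. f y = z}. a x y)"
    by (simp add: sum.inter_filter[OF assms])
  finally show "Cmp FinKer A B C (det_kernel B f) a x z = (\<Sum>y\<in>{y \<in> B. f y = z}. a x y)"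
    by (simp add: FinKer_simps)
qed

definition factorization ::
  "('i, 'k, 'a set, 'a \<Rightarrow> 'a \<Rightarrow> real) diagram \<Rightarrow> ('i, 'k, 'a set, 'a \<Rightarrow> 'a) functor_data" where
  "factorization X = (SOME E. fin_factorization X E)"

definition limit_space :: "('i, 'k, 'a set, 'a \<Rightarrow> 'a \<Rightarrow> real) diagram \<Rightarrow> ('i \<Rightarrow> 'a) topology" where
  "limit_space X = fin_limit (idx X) (factorization X)"

lemma det_kernel_eqD:
  assumes "det_kernel A f = det_kernel A g" "x \<in> A"
  shows "f x = g x"
  using fun_cong[OF fun_cong[OF assms(1)], of x "f x"] assms(2)
  by (simp add: det_kernel_def split: if_splits)

lemma product_topology_discrete_cong:
  assumes "\<And>i. i \<in> J \<Longrightarrow> A i = B i"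
  shows "product_topology (\<lambda>i. discrete_topology (A i)) J = product_topology (\<lambda>i. discrete_topology (B i)) J"
  unfolding topology_eq
proof
  fix S
  have fin: "{i \<in> J. U i \<noteq> topspace (discrete_topology (A i))} =
      {i \<in> J. U i \<noteq> topspace (discrete_topology (B i))}" for U
    using assms by (intro Collect_cong conj_cong refl) simp
  have op: "(\<forall>i\<in>J. openin (discrete_topology (A i)) (U i)) \<longleftrightarrow>
      (\<forall>i\<in>J. openin (discrete_topology (B i)) (U i))" for U
    using assms by (intro ball_cong refl) simp
  show "openin (product_topology (\<lambda>i. discrete_topology (A i)) J) S \<longleftrightarrow>
      openin (product_topology (\<lambda>i. discrete_topology (B i)) J) S"
    unfolding openin_product_topology_alt by (subst fin, subst op, rule refl)
qed

text \<open>
  A function on a set is determined by its kernel, so that all factorizations of a diagram have the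
  same transition maps on the elements of its objects, and therefore the same limit.
\<close>

lemma fin_limit_unique:
  assumes E: "fin_factorization D E" and E': "fin_factorization D E'"
  shows "fin_limit (idx D) E = fin_limit (idx D) E'"
proof -
  let ?I = "idx D"
  let ?P = "product_topology (\<lambda>i. discrete_topology (fobj E i)) (Obj ?I)"
  let ?S = "\<lambda>E. {x. \<forall>i\<in>Obj ?I. \<forall>j\<in>Obj ?I. \<forall>u\<in>Hom ?I i j. fmor E i j u (x i) = x j}"
  have ob: "fobj E i = fobj E' i" if "i \<in> Obj ?I" for i
    using E E' that by (simp add: fin_factorization_def)
  have P: "product_topology (\<lambda>i. discrete_topology (fobj E' i)) (Obj ?I) = ?P"
    by (rule product_topology_discrete_cong) (simp add: ob)
  have mor: "fmor E i j u (x i) = fmor E' i j u (x i)"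
    if x: "x \<in> topspace ?P" and i: "i \<in> Obj ?I" and j: "j \<in> Obj ?I" and u: "u \<in> Hom ?I i j" for x i j u
  proof (rule det_kernel_eqD[of "fobj E i" "fmor E i j u" "fmor E' i j u" "x i"])
    have "det_kernel (fobj E i) (fmor E i j u) = dmo D i j u"
      using E i j u by (simp add: fin_factorization_def)
    also have "\<dots> = det_kernel (fobj E i) (fmor E' i j u)"
      using E' i j u by (simp add: fin_factorization_def ob[OF i])
    finally show "det_kernel (fobj E i) (fmor E i j u) = det_kernel (fobj E i) (fmor E' i j u)" .
    show "x i \<in> fobj E i" using x i by auto
  qed
  have "topspace ?P \<inter> ?S E = topspace ?P \<inter> ?S E'"
  proof (rule set_eqI, unfold Int_iff mem_Collect_eq, rule conj_cong[OF refl], intro ball_cong refl)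
    fix x i j u assume x: "x \<in> topspace ?P" and iju: "i \<in> Obj ?I" "j \<in> Obj ?I" "u \<in> Hom ?I i j"
    show "fmor E i j u (x i) = x j \<longleftrightarrow> fmor E' i j u (x i) = x j"
      by (simp only: mor[OF x iju])
  qed
  then have "subtopology ?P (topspace ?P \<inter> ?S E) = subtopology ?P (topspace ?P \<inter> ?S E')"
    by (rule arg_cong)
  then have "subtopology ?P (?S E) = subtopology ?P (?S E')"
    by (simp only: subtopology_restrict)
  then show ?thesis unfolding fin_limit_def P .
qed

locale det_diagram = pro: pro_object FinKer X + fin_diagram "idx X" "factorization X"
  for X :: "('i, 'k, 'a set, 'a \<Rightarrow> 'a \<Rightarrow> real) diagram" +
  assumes dob_eq: "i \<in> Obj (idx X) \<Longrightarrow> dob X i = ob i"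
    and dmo_eq: "\<lbrakk>i \<in> Obj (idx X); j \<in> Obj (idx X); u \<in> Hom (idx X) i j\<rbrakk>
      \<Longrightarrow> dmo X i j u = det_kernel (ob i) (mo i j u)"

lemma ProDetFinKer_simps:
  "Obj ProDetFinKer = Obj (Pro FinKer) \<inter> {D. \<exists>E. fin_factorization D E}"
  "Hom ProDetFinKer = Hom (Pro FinKer)" "Idn ProDetFinKer = Idn (Pro FinKer)"
  "Cmp ProDetFinKer = Cmp (Pro FinKer)"
  by (simp_all add: ProDetFinKer_def full_subcat_def)

lemma ProDetFinKer_factorization:
  "X \<in> Obj ProDetFinKer \<Longrightarrow> fin_factorization X (factorization X)"
  unfolding factorization_def ProDetFinKer_simps by (auto intro: someI_ex)

lemma ProDetFinKer_det_diagram: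
  assumes "X \<in> Obj ProDetFinKer"
  shows "det_diagram X"
proof -
  interpret pro_object FinKer X using assms by (simp add: ProDetFinKer_simps Obj_Pro_iff)
  have "fin_factorization X (factorization X)" by (rule ProDetFinKer_factorization[OF assms])
  then interpret E: cat_functor "idx X" Fin "factorization X"
    by (simp add: fin_factorization_def)
  show ?thesis
    using ProDetFinKer_factorization[OF assms]
    by unfold_locales (simp_all add: fin_factorization_def)
qed

lemma category_full_subcat:
  assumes "category C"
  shows "category (full_subcat C S)"
proof -
  interpret category C by fact
  show ?thesis
    by unfold_locales
       (auto simp: full_subcat_def intro: Idn_in_Hom Cmp_in_Hom Cmp_Idn_left Cmp_Idn_right Cmp_assoc)
qed

lemma category_ProDetFinKer: "category ProDetFinKer"
  unfolding ProDetFinKer_def by (intro category_full_subcat category_Pro category_FinKer)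

context det_diagram
begin

lemma limit_space_eq: "limit_space X = fin_limit (idx X) (factorization X)"
  by (simp add: limit_space_def)

lemma topspace_limit_space: "topspace (limit_space X) = limit_points"
  by (simp add: limit_space_def)

lemma res_eq:
  assumes "i \<in> Obj (idx X)" "k \<in> Obj (idx X)" "u \<in> Hom (idx X) k i"
  shows "pro.res c k i u a = (\<lambda>y z. if y \<in> ob k then a (mo k i u y) z else 0)"
  unfolding pro.res_def
  using Cmp_FinKer_det_right[of "ob i" "mo k i u" "ob k" c a] assms finite_ob mo_mem
  by (simp add: dob_eq dmo_eq Pi_iff)

end

section \<open>The functor\<close>

locale det_morphism = X: det_diagram X + Y: det_diagram Y + pro_morphism FinKer X Y f
  for X :: "('i, 'k, 'a set, 'a \<Rightarrow> 'a \<Rightarrow> real) diagram"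
    and Y :: "('i, 'k, 'a set, 'a \<Rightarrow> 'a \<Rightarrow> real) diagram" and f
begin

text \<open>
  The choice of the representative is immaterial at points of the limit (\<open>point_value_eq\<close> below).
\<close>

definition point_value :: "('i \<Rightarrow> 'a) \<Rightarrow> 'i \<Rightarrow> 'a \<Rightarrow> real" where
  "point_value x j = (let (i, a) = (SOME r. r \<in> f j) in a (x i))"

lemma rep':
  assumes "j \<in> Obj (idx Y)" "(i, a) \<in> f j"
  shows "i \<in> Obj (idx X)" "a \<in> Hom FinKer (X.ob i) (Y.ob j)"
  using rep(1,2)[OF assms] by (simp_all add: X.dob_eq Y.dob_eq assms(1))

lemma obtain_rep':
  assumes "j \<in> Obj (idx Y)"
  obtains i a where "(i, a) \<in> f j" "i \<in> Obj (idx X)" "a \<in> Hom FinKer (X.ob i) (Y.ob j)"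
proof -
  obtain i a where ia: "(i, a) \<in> f j" by (rule obtain_rep[OF assms])
  show ?thesis by (rule that[OF ia rep'[OF assms ia]])
qed

lemma point_value_eq:
  assumes j: "j \<in> Obj (idx Y)" and x: "x \<in> X.limit_points" and ia: "(i, a) \<in> f j"
  shows "point_value x j = a (x i)"
proof -
  define r where "r = (SOME r. r \<in> f j)"
  obtain i' a' where r: "r = (i', a')" by (cases r)
  have "r \<in> f j" unfolding r_def using ia by (rule someI)
  then have ia': "(i', a') \<in> f j" by (simp add: r)
  have "((i, a), (i', a')) \<in> germ_rel FinKer X (dob Y j)"
    using rep_eq[OF j ia ia'] rep(1,2)[OF j ia] rep(1,2)[OF j ia']
    by (subst (asm) X.pro.germ_eq_iff) (auto intro: pro_object_dob[OF Y.pro.pro_object_axioms j])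
  then obtain k u v where k: "k \<in> Obj (idx X)" "u \<in> Hom (idx X) k i" "v \<in> Hom (idx X) k i'"
      and eq: "X.pro.res (dob Y j) k i u a = X.pro.res (dob Y j) k i' v a'"
    unfolding X.pro.germ_rel_iff by auto
  note i = rep(1)[OF j ia] and i' = rep(1)[OF j ia']
  have xk: "x k \<in> X.ob k" by (rule X.limit_mem[OF x k(1)])
  have "a (x i) = X.pro.res (dob Y j) k i u a (x k)"
    using X.limit_compat[OF x k(1) i k(2)] xk by (simp add: X.res_eq[OF i k(1,2)])
  also have "\<dots> = a' (x i')"
    unfolding eq using X.limit_compat[OF x k(1) i' k(3)] xk by (simp add: X.res_eq[OF i' k(1,3)])
  finally show ?thesis by (simp add: point_value_def r_def[symmetric] r)
qed

lemma fin_family_point_value: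
  assumes x: "x \<in> X.limit_points"
  shows "fin_family (idx Y) (factorization Y) (point_value x)"
proof
  fix j assume j: "j \<in> Obj (idx Y)"
  obtain i a where ia: "(i, a) \<in> f j" "i \<in> Obj (idx X)" "a \<in> Hom FinKer (X.ob i) (Y.ob j)"
    by (rule obtain_rep'[OF j])
  note pv = point_value_eq[OF j x ia(1)]
  show "0 \<le> point_value x j y" for y
    unfolding pv by (rule FinKerD(1)[OF ia(3)])
  show "(\<Sum>y\<in>Y.ob j. point_value x j y) = 1"
    unfolding pv by (rule FinKerD(2)[OF ia(3) X.limit_mem[OF x ia(2)]])
  fix j' w z assume j': "j' \<in> Obj (idx Y)" and w: "w \<in> Hom (idx Y) j j'"
  have "point_value x j' =
      Cmp FinKer (dob X i) (dob Y j) (dob Y j') (dmo Y j j' w) a (x i)"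
    by (rule point_value_eq[OF j' x compatible(2)[OF j j' w ia(1)]])
  also have "dmo Y j j' w = det_kernel (dob Y j) (Y.mo j j' w)"
    using j j' w by (simp add: Y.dmo_eq Y.dob_eq)
  finally show "point_value x j' z = (\<Sum>y\<in>{y \<in> Y.ob j. Y.mo j j' w y = z}. point_value x j y)"
    using Y.finite_ob[OF j] j by (simp add: pv Y.dob_eq Cmp_FinKer_det_left)
qed

definition kernel :: "('i \<Rightarrow> 'a) \<Rightarrow> ('i \<Rightarrow> 'a) measure" where
  "kernel x = (THE \<mu>. Y.is_extension (point_value x) \<mu>)"

lemma kernel_is_extension:
  assumes x: "x \<in> X.limit_points"
  shows "Y.is_extension (point_value x) (kernel x)"
proof -
  have "\<exists>\<mu>. Y.is_extension (point_value x) \<mu>"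
    by (rule fin_family.kolmogorov_extension[OF fin_family_point_value[OF x]])
  then have "\<exists>!\<mu>. Y.is_extension (point_value x) \<mu>"
    using Y.is_extension_unique by (auto intro!: ex_ex1I)
  then show ?thesis unfolding kernel_def by (rule theI')
qed

lemma kernel_eqI:
  assumes "x \<in> X.limit_points" "Y.is_extension (point_value x) \<mu>"
  shows "kernel x = \<mu>"
  by (rule Y.is_extension_unique[OF kernel_is_extension[OF assms(1)] assms(2)])

text \<open>
  Up to a uniformly small error, an integrand on the limit of \<open>Y\<close> depends on one coordinate \<open>k\<close> only,
  and its integral then depends on \<open>x\<close> only through one coordinate \<open>x i\<close>.
\<close>

lemma continuous_kernel: "continuous_map (limit_space X) (radon_space (limit_space Y)) kernel"
  unfolding continuous_map_radon_space_iff X.limit_space_eq Y.limit_space_eq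
proof (intro conjI allI impI funcsetI)
  let ?LX = "fin_limit (idx X) (factorization X)" and ?LY = "fin_limit (idx Y) (factorization Y)"
  fix x assume "x \<in> topspace ?LX"
  then show "kernel x \<in> radon_measures ?LY"
    using Y.is_extensionD(1)[OF kernel_is_extension] by simp
next
  let ?LX = "fin_limit (idx X) (factorization X)" and ?LY = "fin_limit (idx Y) (factorization Y)"
  fix h assume h: "continuous_map ?LY euclideanreal h"
  have near: "\<exists>U. openin ?LX U \<and> x \<in> U \<and>
      (\<forall>x'\<in>U. \<bar>integral\<^sup>L (kernel x') h - integral\<^sup>L (kernel x) h\<bar> < e)"
    if x: "x \<in> X.limit_points" and e: "0 < e" for x e
  proof -
    have e3: "0 < e / 3" using e by simp
    obtain k H where k: "k \<in> Obj (idx Y)" and H: "\<forall>y\<in>Y.limit_points. \<bar>h y - H (y k)\<bar> < e / 3"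
      using Y.continuous_approx_cylinder[OF h e3] by (elim bexE exE) (rule that)
    obtain i a where ia: "(i, a) \<in> f k" "i \<in> Obj (idx X)" "a \<in> Hom FinKer (X.ob i) (Y.ob k)"
      by (rule obtain_rep'[OF k])
    have close: "\<bar>integral\<^sup>L (kernel x') h - (\<Sum>y\<in>Y.ob k. H y * a (x' i) y)\<bar> \<le> e / 3"
      if x': "x' \<in> X.limit_points" for x'
    proof -
      note ext = kernel_is_extension[OF x']
      note r = Y.is_extensionD(1)[OF ext]
      interpret prob_space "kernel x'" by (rule radon_measuresD(1)[OF r])
      have int: "integrable (kernel x') h" "integrable (kernel x') (\<lambda>y. H (y k))"
        by (rule radon_integrable[OF Y.compact_fin_limit r h],
            rule radon_integrable[OF Y.compact_fin_limit r Y.continuous_map_coordinate[OF k]])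
      have "(\<integral>y. H (y k) \<partial>kernel x') = (\<Sum>y\<in>Y.ob k. H y * a (x' i) y)"
        using Y.integral_coordinate[OF ext k] FinKerD(1)[OF ia(3)]
        by (simp add: point_value_eq[OF k x' ia(1)])
      then have "\<bar>integral\<^sup>L (kernel x') h - (\<Sum>y\<in>Y.ob k. H y * a (x' i) y)\<bar> =
          \<bar>\<integral>y. h y - H (y k) \<partial>kernel x'\<bar>"
        using int by simp
      also have "\<dots> \<le> (\<integral>y. \<bar>h y - H (y k)\<bar> \<partial>kernel x')" by (rule integral_abs_bound)
      also have "\<dots> \<le> (\<integral>y. e / 3 \<partial>kernel x')"
        using int H radon_measuresD(3)[OF r] by (intro integral_mono) (auto intro: less_imp_le)
      also have "\<dots> = e / 3" by (simp add: prob_space)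
      finally show ?thesis .
    qed
    have "\<bar>integral\<^sup>L (kernel x') h - integral\<^sup>L (kernel x) h\<bar> < e" if "x' \<in> X.cylinder i {x i}" for x'
    proof -
      have x': "x' \<in> X.limit_points" "x' i = x i" using that by (auto simp: X.cylinder_def)
      show ?thesis using close[OF x] close[OF x'(1)] e unfolding x'(2) by linarith
    qed
    moreover have "x \<in> X.cylinder i {x i}" using x by (simp add: X.cylinder_def)
    ultimately show ?thesis
      by (intro exI[of _ "X.cylinder i {x i}"] conjI X.openin_cylinder[OF ia(2)] ballI)
  qed
  show "continuous_map ?LX euclideanreal (\<lambda>x. integral\<^sup>L (kernel x) h)"
    unfolding continuous_map_def
  proof (intro conjI allI impI)
    fix S :: "real set" assume "openin euclideanreal S"
    then have S: "open S" by simp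
    show "openin ?LX
        {x \<in> topspace ?LX. integral\<^sup>L (kernel x) h \<in> S}"
    proof (subst openin_subopen, intro ballI)
      fix x assume x: "x \<in> {x \<in> topspace ?LX. integral\<^sup>L (kernel x) h \<in> S}"
      then obtain e where e: "0 < e" "ball (integral\<^sup>L (kernel x) h) e \<subseteq> S"
        using S by (auto simp: open_contains_ball)
      obtain U where U: "openin ?LX U" "x \<in> U"
          "\<forall>x'\<in>U. \<bar>integral\<^sup>L (kernel x') h - integral\<^sup>L (kernel x) h\<bar> < e"
        using near[of x e] x e(1) by auto
      have "U \<subseteq> {x \<in> topspace ?LX. integral\<^sup>L (kernel x) h \<in> S}"
      proof
        fix x' assume x': "x' \<in> U"
        then have "integral\<^sup>L (kernel x') h \<in> ball (integral\<^sup>L (kernel x) h) e"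
          using U(3) by (simp add: dist_real_def abs_minus_commute)
        then show "x' \<in> {x \<in> topspace ?LX. integral\<^sup>L (kernel x) h \<in> S}"
          using e(2) openin_subset[OF U(1)] x' by blast
      qed
      with U show "\<exists>T. openin ?LX T \<and> x \<in> T \<and>
          T \<subseteq> {x \<in> topspace ?LX. integral\<^sup>L (kernel x) h \<in> S}"
        by blast
    qed
  qed simp
qed

end

lemma ProDetFinKer_det_morphism:
  assumes "X \<in> Obj ProDetFinKer" "Y \<in> Obj ProDetFinKer" "f \<in> Hom ProDetFinKer X Y"
  shows "det_morphism X Y f"
proof -
  interpret X: det_diagram X by (rule ProDetFinKer_det_diagram[OF assms(1)])
  interpret Y: det_diagram Y by (rule ProDetFinKer_det_diagram[OF assms(2)])
  interpret pro_morphism FinKer X Y f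
    using assms(3) by unfold_locales (simp add: ProDetFinKer_simps Hom_Pro)
  show ?thesis ..
qed

text \<open>
  Kernels that agree on the image of the limit in \<open>X\<^sub>k\<close> agree after restriction along a transition
  map with the same image.
\<close>

lemma det_morphism_eqI:
  assumes f: "det_morphism X Y f" and g: "det_morphism X Y g"
    and eq: "\<And>x. x \<in> topspace (limit_space X) \<Longrightarrow> det_morphism.kernel Y f x = det_morphism.kernel Y g x"
  shows "f = g"
proof -
  interpret f: det_morphism X Y f by fact
  interpret g: det_morphism X Y g by fact
  have value_eq: "f.point_value x j = g.point_value x j"
    if x: "x \<in> f.X.limit_points" and j: "j \<in> Obj (idx Y)" for x j
  proof
    fix y
    obtain i a where ia: "(i, a) \<in> f j" "i \<in> Obj (idx X)" "a \<in> Hom FinKer (f.X.ob i) (f.Y.ob j)"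
      by (rule f.obtain_rep'[OF j])
    obtain i' a' where ia': "(i', a') \<in> g j" "i' \<in> Obj (idx X)" "a' \<in> Hom FinKer (f.X.ob i') (f.Y.ob j)"
      by (rule g.obtain_rep'[OF j])
    note pv = f.point_value_eq[OF j x ia(1)] g.point_value_eq[OF j x ia'(1)]
    show "f.point_value x j y = g.point_value x j y"
    proof (cases "y \<in> f.Y.ob j")
      case True
      have "f.kernel x = g.kernel x" using eq[of x] x by (simp add: f.X.topspace_limit_space)
      then have "ennreal (f.point_value x j y) = ennreal (g.point_value x j y)"
        using f.Y.is_extensionD(2)[OF f.kernel_is_extension[OF x] j, of "{y}"]
          f.Y.is_extensionD(2)[OF g.kernel_is_extension[OF x] j, of "{y}"] True by simp
      then show ?thesis
        using FinKerD(1)[OF ia(3)] FinKerD(1)[OF ia'(3)] by (simp add: pv)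
    next
      case False
      then show ?thesis using FinKerD(4)[OF ia(3)] FinKerD(4)[OF ia'(3)] by (simp add: pv)
    qed
  qed
  show ?thesis
  proof (rule pro_morphism_eqI[OF f.pro_morphism_axioms g.pro_morphism_axioms])
    fix j assume j: "j \<in> Obj (idx Y)"
    have dj: "dob Y j \<in> Obj FinKer" by (rule pro_object_dob[OF f.Y.pro.pro_object_axioms j])
    obtain i a where ia: "(i, a) \<in> f j" "i \<in> Obj (idx X)" "a \<in> Hom FinKer (dob X i) (dob Y j)"
      by (rule f.obtain_rep[OF j])
    obtain i' a' where ia': "(i', a') \<in> g j" "i' \<in> Obj (idx X)" "a' \<in> Hom FinKer (dob X i') (dob Y j)"
      by (rule g.obtain_rep[OF j])
    obtain k u v where k: "k \<in> Obj (idx X)" "u \<in> Hom (idx X) k i" "v \<in> Hom (idx X) k i'"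
      using f.X.pro.I.cone_objects[OF ia(2) ia'(2)] by blast
    obtain l w where l: "l \<in> Obj (idx X)" "w \<in> Hom (idx X) l k"
      "\<forall>y\<in>f.X.ob l. \<exists>x\<in>f.X.limit_points. x k = f.X.mo l k w y"
      using f.X.stable_image[OF k(1)] by (elim bexE) (rule that)
    have restrict: "f.X.pro.res (dob Y j) l k w (f.X.pro.res (dob Y j) k i u a) y z = a (x i) z"
      if "(i, a) \<in> r j" "det_morphism X Y r" "i \<in> Obj (idx X)" "u \<in> Hom (idx X) k i"
        "y \<in> f.X.ob l" "x \<in> f.X.limit_points" "x k = f.X.mo l k w y" for r i a u x y z
      using that f.X.limit_compat[OF that(6) k(1) that(3,4)] f.X.limit_mem[OF that(6) k(1)]
      by (simp add: f.X.res_eq[OF k(1) l(1,2)] f.X.res_eq[OF that(3) k(1) that(4)])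
    let ?a = "f.X.pro.res (dob Y j) l k w (f.X.pro.res (dob Y j) k i u a)"
    let ?a' = "f.X.pro.res (dob Y j) l k w (f.X.pro.res (dob Y j) k i' v a')"
    have "?a = ?a'"
    proof (intro ext)
      fix y z
      show "?a y z = ?a' y z"
      proof (cases "y \<in> f.X.ob l")
        case True
        then obtain x where x: "x \<in> f.X.limit_points" "x k = f.X.mo l k w y" using l(3) by blast
        have "a (x i) z = a' (x i') z"
          using value_eq[OF x(1) j] f.point_value_eq[OF j x(1) ia(1)] g.point_value_eq[OF j x(1) ia'(1)] by simp
        then show ?thesis
          using restrict[OF ia(1) f ia(2) k(2) True x] restrict[OF ia'(1) g ia'(2) k(3) True x] by simp
      next
        case False
        then show ?thesis by (simp add: f.X.res_eq[OF k(1) l(1,2)])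
      qed
    qed
    have mem: "(l, f.X.pro.res (dob Y j) l k w (f.X.pro.res (dob Y j) k i u a)) \<in> r j"
      if r: "pro_morphism FinKer X Y r" and ia: "(i, a) \<in> r j" "i \<in> Obj (idx X)"
        "a \<in> Hom FinKer (dob X i) (dob Y j)" "u \<in> Hom (idx X) k i" for r i a u
    proof -
      have 1: "f.X.pro.res (dob Y j) k i u a \<in> Hom FinKer (dob X k) (dob Y j)"
        by (rule f.X.pro.res_in_Hom[OF dj ia(2) k(1) ia(4,3)])
      have 2: "f.X.pro.res (dob Y j) l k w (f.X.pro.res (dob Y j) k i u a) \<in> Hom FinKer (dob X l) (dob Y j)"
        by (rule f.X.pro.res_in_Hom[OF dj k(1) l(1,2) 1])
      have "r j = germ FinKer X (dob Y j) (i, a)" by (rule pro_morphism.rep(3)[OF r j ia(1)])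
      also have "\<dots> = germ FinKer X (dob Y j) (k, f.X.pro.res (dob Y j) k i u a)"
        by (rule f.X.pro.germ_res[OF dj ia(2) k(1) ia(4,3), symmetric])
      also have "\<dots> = germ FinKer X (dob Y j) (l, f.X.pro.res (dob Y j) l k w (f.X.pro.res (dob Y j) k i u a))"
        by (rule f.X.pro.germ_res[OF dj k(1) l(1,2) 1, symmetric])
      finally show ?thesis
        using f.X.pro.germ_self[OF dj] 2 l(1) by simp
    qed
    have "(l, ?a) \<in> f j" by (rule mem[OF f.pro_morphism_axioms ia k(2)])
    moreover have "(l, ?a) \<in> g j" unfolding \<open>?a = ?a'\<close> by (rule mem[OF g.pro_morphism_axioms ia' k(3)])
    ultimately show "f j \<inter> g j \<noteq> {}" by blast
  qed
qed

definition stone_functor where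
  "stone_functor = \<lparr>fobj = limit_space,
     fmor = (\<lambda>X Y f. \<lambda>x\<in>topspace (limit_space X). det_morphism.kernel Y f x)\<rparr>"

lemma limit_space_in_KleisliR: "X \<in> Obj ProDetFinKer \<Longrightarrow> limit_space X \<in> Obj KleisliR"
proof -
  assume "X \<in> Obj ProDetFinKer"
  then interpret det_diagram X by (rule ProDetFinKer_det_diagram)
  show ?thesis
    by (simp add: KleisliR_simps limit_space_eq compact_fin_limit Hausdorff_fin_limit)
qed

lemma (in det_morphism) kernel_in_Hom:
  "(\<lambda>x\<in>topspace (limit_space X). kernel x) \<in> Hom KleisliR (limit_space X) (limit_space Y)"
  by (simp add: KleisliR_simps continuous_map_restrict_radon continuous_kernel)

lemma kernel_Idn:
  assumes "det_morphism X X (Idn (Pro FinKer) X)" and x: "x \<in> topspace (limit_space X)"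
  shows "det_morphism.kernel X (Idn (Pro FinKer) X) x = radon_unit (limit_space X) x"
proof -
  interpret det_morphism X X "Idn (Pro FinKer) X" by fact
  have xL: "x \<in> X.limit_points" using x by (simp add: X.topspace_limit_space)
  have "X.is_extension (point_value x) (radon_unit (limit_space X) x)"
    unfolding X.is_extension_def X.limit_space_eq
  proof (intro conjI ballI allI impI)
    show "radon_unit (fin_limit (idx X) (factorization X)) x \<in> radon_measures (fin_limit (idx X) (factorization X))"
      using xL by (intro radon_unit_in_radon_measures X.Hausdorff_fin_limit) simp
    fix i B assume i: "i \<in> Obj (idx X)" and B: "B \<subseteq> X.ob i"
    have "point_value x i = Idn FinKer (dob X i) (x i)"
      by (rule point_value_eq[OF i xL Idn_Pro_rep[OF X.pro.pro_object_axioms i]])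
    then have "sum (point_value x i) B = (\<Sum>y\<in>B. if y = x i then 1 else 0)"
      using X.limit_mem[OF xL i] by (simp add: FinKer_simps X.dob_eq[OF i])
    also have "\<dots> = indicator B (x i)"
      using finite_subset[OF B X.finite_ob[OF i]] by (simp add: indicator_def)
    finally have "ennreal (sum (point_value x i) B) = indicator (X.cylinder i B) x"
      using xL by (simp add: X.cylinder_def indicator_def)
    then show "emeasure (radon_unit (fin_limit (idx X) (factorization X)) x) (X.cylinder i B) =
        ennreal (sum (point_value x i) B)"
      by (simp add: radon_unit_def X.cylinder_in_sets[OF i])
  qed
  then show ?thesis by (rule kernel_eqI[OF xL])
qed

text \<open>
  The composite of the Kleisli morphisms has the marginals of the composite of \<open>f\<close> and \<open>g\<close>: a coordinate of
  \<open>g\<close> depends on a single coordinate of its argument, so that integrating it is a finite sum, namely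
  a matrix product.
\<close>

lemma kernel_Cmp:
  assumes f: "det_morphism X Y f" and g: "det_morphism Y Z g"
    and gf: "det_morphism X Z (Cmp (Pro FinKer) X Y Z g f)" and x: "x \<in> topspace (limit_space X)"
  shows "det_morphism.kernel Z (Cmp (Pro FinKer) X Y Z g f) x =
    det_morphism.kernel Y f x \<bind> (\<lambda>y\<in>topspace (limit_space Y). det_morphism.kernel Z g y)"
proof -
  interpret f: det_morphism X Y f by fact
  interpret g: det_morphism Y Z g by fact
  interpret gf: det_morphism X Z "Cmp (Pro FinKer) X Y Z g f" by fact
  have xL: "x \<in> f.X.limit_points" using x by (simp add: f.X.topspace_limit_space)
  let ?\<mu> = "f.kernel x"
  let ?g = "\<lambda>y\<in>topspace (limit_space Y). g.kernel y"
  have Y: "compact_space (limit_space Y)" "Hausdorff_space (limit_space Y)"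
    by (simp_all add: f.Y.limit_space_eq f.Y.compact_fin_limit f.Y.Hausdorff_fin_limit)
  have Z: "compact_space (limit_space Z)" "Hausdorff_space (limit_space Z)"
    by (simp_all add: g.Y.limit_space_eq g.Y.compact_fin_limit g.Y.Hausdorff_fin_limit)
  note ext = f.kernel_is_extension[OF xL]
  have r: "?\<mu> \<in> radon_measures (limit_space Y)"
    using f.Y.is_extensionD(1)[OF ext] by (simp add: f.Y.limit_space_eq)
  have cont: "continuous_map (limit_space Y) (radon_space (limit_space Z)) ?g"
    by (simp add: continuous_map_restrict_radon g.continuous_kernel)
  have "g.Y.is_extension (gf.point_value x) (?\<mu> \<bind> ?g)"
    unfolding g.Y.is_extension_def
  proof (intro conjI ballI allI impI)
    show "?\<mu> \<bind> ?g \<in> radon_measures (fin_limit (idx Z) (factorization Z))"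
      using radon_measures_bind[OF Y Z r cont] by (simp add: g.Y.limit_space_eq)
    fix k B assume k: "k \<in> Obj (idx Z)" and B: "B \<subseteq> g.Y.ob k"
    obtain j b where jb: "(j, b) \<in> g k" "j \<in> Obj (idx Y)" "b \<in> Hom FinKer (f.Y.ob j) (g.Y.ob k)"
      by (rule g.obtain_rep'[OF k])
    obtain i a where ia: "(i, a) \<in> f j" "i \<in> Obj (idx X)" "a \<in> Hom FinKer (f.X.ob i) (f.Y.ob j)"
      by (rule f.obtain_rep'[OF jb(2)])
    have cyl: "g.Y.cylinder k B \<in> sets (topology_borel (limit_space Z))"
      using g.Y.cylinder_in_sets[OF k] by (simp add: g.Y.limit_space_eq)
    have "emeasure (?\<mu> \<bind> ?g) (g.Y.cylinder k B) = (\<integral>\<^sup>+y. emeasure (?g y) (g.Y.cylinder k B) \<partial>?\<mu>)"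
      by (rule emeasure_bind_prob_algebra[OF radon_in_prob_algebra[OF r] radon_kernel_measurable[OF Z cont] cyl])
    also have "\<dots> = (\<integral>\<^sup>+y. ennreal (sum (b (y j)) B) \<partial>?\<mu>)"
    proof (rule nn_integral_cong)
      fix y assume "y \<in> space ?\<mu>"
      then have y: "y \<in> f.Y.limit_points"
        using radon_measuresD(3)[OF r] by (simp add: f.Y.topspace_limit_space)
      then show "emeasure (?g y) (g.Y.cylinder k B) = ennreal (sum (b (y j)) B)"
        using g.Y.is_extensionD(2)[OF g.kernel_is_extension[OF y] k B]
        by (simp add: f.Y.topspace_limit_space g.point_value_eq[OF k y jb(1)])
    qed
    also have "\<dots> = (\<Sum>y\<in>f.Y.ob j. ennreal (sum (b y) B) * ennreal (f.point_value x j y))"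
      by (rule f.Y.nn_integral_coordinate[OF ext jb(2)])
    also have "\<dots> = (\<Sum>y\<in>f.Y.ob j. ennreal (a (x i) y * sum (b y) B))"
      using FinKerD(1)[OF jb(3)] FinKerD(1)[OF ia(3)]
      by (intro sum.cong) (simp_all add: f.point_value_eq[OF jb(2) xL ia(1)] sum_nonneg ennreal_mult mult.commute)
    also have "\<dots> = ennreal (\<Sum>y\<in>f.Y.ob j. a (x i) y * sum (b y) B)"
      using FinKerD(1)[OF jb(3)] FinKerD(1)[OF ia(3)] by (intro sum_ennreal) (simp add: sum_nonneg)
    also have "(\<Sum>y\<in>f.Y.ob j. a (x i) y * sum (b y) B) = (\<Sum>z\<in>B. \<Sum>y\<in>f.Y.ob j. a (x i) y * b y z)"
      by (subst sum.swap) (simp add: sum_distrib_left)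
    also have "\<dots> = sum (gf.point_value x k) B"
    proof -
      have "gf.point_value x k = Cmp FinKer (dob X i) (dob Y j) (dob Z k) b a (x i)"
        by (rule gf.point_value_eq[OF k xL
              Cmp_Pro_rep[OF f.pro_morphism_axioms g.pro_morphism_axioms k jb(1) ia(1)]])
      then show ?thesis by (simp add: FinKer_simps f.Y.dob_eq[OF jb(2)])
    qed
    finally show "emeasure (?\<mu> \<bind> ?g) (g.Y.cylinder k B) = ennreal (sum (gf.point_value x k) B)" .
  qed
  then show ?thesis by (rule gf.kernel_eqI[OF xL])
qed

lemma faithful_stone_functor: "faithful_functor ProDetFinKer KleisliR stone_functor"
proof -
  interpret S: category ProDetFinKer by (rule category_ProDetFinKer)
  interpret K: category KleisliR by (rule category_KleisliR)
  note mor = ProDetFinKer_det_morphism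
  show ?thesis
  proof
    show "fobj stone_functor X \<in> Obj KleisliR" if "X \<in> Obj ProDetFinKer" for X
      using limit_space_in_KleisliR[OF that] by (simp add: stone_functor_def)
    show hom: "fmor stone_functor X Y f \<in> Hom KleisliR (fobj stone_functor X) (fobj stone_functor Y)"
      if "X \<in> Obj ProDetFinKer" "Y \<in> Obj ProDetFinKer" "f \<in> Hom ProDetFinKer X Y" for X Y f
      using det_morphism.kernel_in_Hom[OF mor[OF that]] by (simp add: stone_functor_def)
    show "fmor stone_functor X X (Idn ProDetFinKer X) = Idn KleisliR (fobj stone_functor X)"
      if X: "X \<in> Obj ProDetFinKer" for X
      using kernel_Idn[OF mor[OF X X S.Idn_in_Hom[OF X], unfolded ProDetFinKer_simps(3)]]
      by (simp add: stone_functor_def KleisliR_simps ProDetFinKer_simps(3) cong: restrict_cong)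
    show "fmor stone_functor X Z (Cmp ProDetFinKer X Y Z g f) =
        Cmp KleisliR (fobj stone_functor X) (fobj stone_functor Y) (fobj stone_functor Z)
          (fmor stone_functor Y Z g) (fmor stone_functor X Y f)"
      if "X \<in> Obj ProDetFinKer" "Y \<in> Obj ProDetFinKer" "Z \<in> Obj ProDetFinKer"
        "f \<in> Hom ProDetFinKer X Y" "g \<in> Hom ProDetFinKer Y Z" for X Y Z f g
    proof -
      note F = mor[OF that(1,2,4)] and G = mor[OF that(2,3,5)]
      note GF = mor[OF that(1,3) S.Cmp_in_Hom[OF that], unfolded ProDetFinKer_simps(4)]
      have "Cmp KleisliR (limit_space X) (limit_space Y) (limit_space Z)
          (\<lambda>y\<in>topspace (limit_space Y). det_morphism.kernel Z g y)
          (\<lambda>x\<in>topspace (limit_space X). det_morphism.kernel Y f x) =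
        (\<lambda>x\<in>topspace (limit_space X). (\<lambda>x\<in>topspace (limit_space X). det_morphism.kernel Y f x) x \<bind>
          (\<lambda>y\<in>topspace (limit_space Y). det_morphism.kernel Z g y))"
        by (rule Cmp_KleisliR[OF limit_space_in_KleisliR[OF that(3)]
              det_morphism.kernel_in_Hom[OF F] det_morphism.kernel_in_Hom[OF G]])
      also have "\<dots> = (\<lambda>x\<in>topspace (limit_space X). det_morphism.kernel Z (Cmp (Pro FinKer) X Y Z g f) x)"
        by (rule restrict_ext) (simp add: kernel_Cmp[OF F G GF])
      finally show ?thesis by (simp add: stone_functor_def ProDetFinKer_simps(4))
    qed
    show "inj_on (fmor stone_functor X Y) (Hom ProDetFinKer X Y)"
      if "X \<in> Obj ProDetFinKer" "Y \<in> Obj ProDetFinKer" for X Y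
    proof (rule inj_onI)
      fix f g assume f: "f \<in> Hom ProDetFinKer X Y" and g: "g \<in> Hom ProDetFinKer X Y"
        and eq: "fmor stone_functor X Y f = fmor stone_functor X Y g"
      show "f = g"
      proof (rule det_morphism_eqI[OF mor[OF that f] mor[OF that g]])
        fix x assume "x \<in> topspace (limit_space X)"
        then show "det_morphism.kernel Y f x = det_morphism.kernel Y g x"
          using fun_cong[OF eq, of x] by (simp add: stone_functor_def)
      qed
    qed
  qed
qed

section \<open>The distributions of a morphism at a point\<close>

lemma pro_object_const:
  assumes "category C" "c \<in> Obj C"
  shows "pro_object C (const_pro C c)"
proof -
  interpret category C by fact
  show ?thesis
    using assms(2)
    by unfold_locales
       (auto simp: const_pro_def terminal_cat_def Idn_in_Hom Cmp_Idn_left)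
qed

lemma const_pro_simps:
  "Obj (idx (const_pro C c)) = {undefined}" "dob (const_pro C c) i = c"
  "dmo (const_pro C c) i j u = Idn C c"
  by (simp_all add: const_pro_def terminal_cat_def)

lemma pro_morphism_proj:
  fixes Y :: "('i, 'k, 'o, 'm) diagram"
  assumes Y: "pro_object C Y" and j: "j \<in> Obj (idx Y)"
  shows "pro_morphism C Y (const_pro C (dob Y j)) (pro_proj C Y j)"
    "(j, Idn C (dob Y j)) \<in> pro_proj C Y j undefined"
proof -
  let ?c = "const_pro C (dob Y j) :: ('i, 'k, 'o, 'm) diagram"
  interpret Y: pro_object C Y by fact
  have o: "dob Y j \<in> Obj C" by (rule pro_object_dob[OF Y j])
  note id = Y.C.Idn_in_Hom[OF o]
  interpret c: pro_object C ?c by (rule pro_object_const[OF Y.C.category_axioms o])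
  have "pro_proj C Y j \<in> pro_hom C Y ?c"
  proof (rule pro_homI[OF Y c.pro_object_axioms])
    show "pro_proj C Y j \<in> extensional (Obj (idx ?c))"
      by (simp add: pro_proj_def const_pro_simps)
    fix u assume "u \<in> Obj (idx ?c)"
    then show "\<exists>i a. represents C Y ?c (pro_proj C Y j) u i a"
      unfolding represents_def
      using j id o
      by - (rule exI[of _ j], rule exI[of _ "Idn C (dob Y j)"],
         simp add: pro_proj_def const_pro_simps Y.C.Cmp_Idn_left)
  qed
  then show "pro_morphism C Y ?c (pro_proj C Y j)" by unfold_locales
  show "(j, Idn C (dob Y j)) \<in> pro_proj C Y j undefined"
    using Y.germ_self[OF o, of "(j, Idn C (dob Y j))"] j id by (simp add: pro_proj_def)
qed

lemma det_kernel_in_Hom: "f \<in> A \<rightarrow> B \<Longrightarrow> finite B \<Longrightarrow> det_kernel A f \<in> Hom FinKer A B"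
  by (auto simp: FinKer_simps det_kernel_def Pi_iff)

lemma fin_one_in_Obj: "fin_one \<in> Obj FinKer"
  by (simp add: FinKer_simps fin_one_def)

lemma (in det_diagram) pro_morphism_point:
  assumes x: "x \<in> limit_points"
  shows "pro_morphism FinKer (const_pro FinKer fin_one) X (pro_point X x)"
    "i \<in> Obj (idx X) \<Longrightarrow> (undefined, det_kernel fin_one (\<lambda>_. x i)) \<in> pro_point X x i"
proof -
  let ?one = "const_pro FinKer fin_one :: ('i, 'k, 'a set, 'a \<Rightarrow> 'a \<Rightarrow> real) diagram"
  interpret c: pro_object FinKer ?one
    by (rule pro_object_const[OF category_FinKer fin_one_in_Obj])
  have det: "det_kernel fin_one (\<lambda>_. x i) \<in> Hom FinKer fin_one (dob X i)" if "i \<in> Obj (idx X)" for i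
    using limit_mem[OF x that] finite_ob[OF that] by (intro det_kernel_in_Hom) (simp_all add: dob_eq[OF that])
  have "pro_point X x \<in> pro_hom FinKer ?one X"
  proof (rule pro_homI[OF c.pro_object_axioms pro.pro_object_axioms])
    show "pro_point X x \<in> extensional (Obj (idx X))" by (simp add: pro_point_def)
    fix i assume i: "i \<in> Obj (idx X)"
    have "Cmp FinKer fin_one (dob X i) (dob X j) (dmo X i j u) (det_kernel fin_one (\<lambda>_. x i)) =
        det_kernel fin_one (\<lambda>_. x j)" if j: "j \<in> Obj (idx X)" and u: "u \<in> Hom (idx X) i j" for j u
    proof -
      have "Cmp FinKer fin_one (dob X i) (dob X j) (dmo X i j u) (det_kernel fin_one (\<lambda>_. x i)) =
          (\<lambda>t z. if t \<in> fin_one then dmo X i j u (x i) z else 0)"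
        using limit_mem[OF x i] finite_ob[OF i] by (intro Cmp_FinKer_det_right) (simp_all add: dob_eq[OF i])
      also have "\<dots> = det_kernel fin_one (\<lambda>_. x j)"
        using limit_mem[OF x i] limit_compat[OF x i j u]
        by (auto simp: dmo_eq[OF i j u] det_kernel_def fun_eq_iff)
      finally show ?thesis .
    qed
    then show "\<exists>l a. represents FinKer ?one X (pro_point X x) i l a"
      unfolding represents_def
      using i det[OF i]
      by - (rule exI[of _ undefined], rule exI[of _ "det_kernel fin_one (\<lambda>_. x i)"],
         simp add: const_pro_simps pro_point_def)
  qed
  then show "pro_morphism FinKer ?one X (pro_point X x)" by unfold_locales
  assume i: "i \<in> Obj (idx X)"
  show "(undefined, det_kernel fin_one (\<lambda>_. x i)) \<in> pro_point X x i"
    using c.germ_self[OF pro_object_dob[OF pro.pro_object_axioms i],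
        of "(undefined, det_kernel fin_one (\<lambda>_. x i))"] det[OF i] i
    by (simp add: pro_point_def const_pro_simps)
qed

context det_morphism
begin

definition distribution :: "('i \<Rightarrow> 'a) \<Rightarrow> 'i \<Rightarrow> 'a \<Rightarrow> 'a \<Rightarrow> real" where
  "distribution x j = (\<lambda>t y. if t \<in> fin_one then point_value x j y else 0)"

lemma distribution_eq_Cmp:
  assumes x: "x \<in> X.limit_points" and j: "j \<in> Obj (idx Y)" and ia: "(i, a) \<in> f j"
  shows "distribution x j = Cmp FinKer fin_one (dob X i) (dob Y j) a (det_kernel fin_one (\<lambda>_. x i))"
  using Cmp_FinKer_det_right[of "dob X i" "\<lambda>_. x i" fin_one "dob Y j" a] rep'[OF j ia]
    X.limit_mem[OF x rep'(1)[OF j ia]] X.finite_ob[OF rep'(1)[OF j ia]]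
  unfolding distribution_def point_value_eq[OF j x ia] by (simp add: X.dob_eq)

lemma distribution_in_Hom:
  assumes x: "x \<in> X.limit_points" and j: "j \<in> Obj (idx Y)"
  shows "distribution x j \<in> Hom FinKer fin_one (dob Y j)"
proof -
  obtain i a where ia: "(i, a) \<in> f j" "i \<in> Obj (idx X)" "a \<in> Hom FinKer (X.ob i) (Y.ob j)"
    by (rule obtain_rep'[OF j])
  show ?thesis
    using FinKerD[OF ia(3)] X.limit_mem[OF x ia(2)]
    by (simp add: distribution_def FinKer_simps point_value_eq[OF j x ia(1)] Y.dob_eq[OF j])
qed

text \<open>
  The composite in the category of pro-objects is computed on the representatives that \<open>x\<close>, a
  representative of the \<open>j\<close>-th component of \<open>f\<close>, and the identity of \<open>Y\<^sub>j\<close> provide.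
\<close>

lemma is_point_distribution_distribution:
  assumes x: "x \<in> X.limit_points" and j: "j \<in> Obj (idx Y)"
  shows "is_point_distribution X Y f x j (distribution x j)"
  unfolding is_point_distribution_def
proof (intro conjI distribution_in_Hom[OF x j])
  let ?one = "const_pro FinKer fin_one :: ('i, 'k, 'a set, 'a \<Rightarrow> 'a \<Rightarrow> real) diagram"
  obtain i a where ia: "(i, a) \<in> f j" "i \<in> Obj (idx X)" "a \<in> Hom FinKer (dob X i) (dob Y j)"
    by (rule obtain_rep[OF j])
  note pt = X.pro_morphism_point[OF x] and pr = pro_morphism_proj[OF Y.pro.pro_object_axioms j]
  note comp = pro_morphism_Cmp[OF pt(1) pro_morphism_axioms]
  have "(undefined, distribution x j) \<in> Cmp (Pro FinKer) ?one X Y f (pro_point X x) j"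
    using Cmp_Pro_rep[OF pt(1) pro_morphism_axioms j ia(1) pt(2)[OF ia(2)]]
    by (simp add: const_pro_simps distribution_eq_Cmp[OF x j ia(1)])
  then have "Cmp (Pro FinKer) ?one Y (const_pro FinKer (dob Y j)) (pro_proj FinKer Y j)
      (Cmp (Pro FinKer) ?one X Y f (pro_point X x)) undefined =
    germ FinKer ?one (dob Y j)
      (undefined, Cmp FinKer fin_one (dob Y j) (dob Y j) (Idn FinKer (dob Y j)) (distribution x j))"
    using Cmp_Pro_eq[OF comp pr(1) _ pr(2)] by (simp add: const_pro_simps)
  also have "Cmp FinKer fin_one (dob Y j) (dob Y j) (Idn FinKer (dob Y j)) (distribution x j) = distribution x j"
    by (rule X.pro.C.Cmp_Idn_left[OF fin_one_in_Obj pro_object_dob[OF Y.pro.pro_object_axioms j]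
          distribution_in_Hom[OF x j]])
  finally have eq: "Cmp (Pro FinKer) ?one Y (const_pro FinKer (dob Y j)) (pro_proj FinKer Y j)
      (Cmp (Pro FinKer) ?one X Y f (pro_point X x)) undefined =
    germ FinKer ?one (dob Y j) (undefined, distribution x j)" .
  show "const_pro_mor TYPE('i \<times> 'k) FinKer fin_one (dob Y j) (distribution x j) =
      Cmp (Pro FinKer) ?one Y (const_pro FinKer (dob Y j)) (pro_proj FinKer Y j)
        (Cmp (Pro FinKer) ?one X Y f (pro_point X x))"
  proof (rule extensionalityI[of _ "{undefined}"])
    show "const_pro_mor TYPE('i \<times> 'k) FinKer fin_one (dob Y j) (distribution x j) \<in> extensional {undefined}"
      by (simp add: const_pro_mor_def)
    show "Cmp (Pro FinKer) ?one Y (const_pro FinKer (dob Y j)) (pro_proj FinKer Y j)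
        (Cmp (Pro FinKer) ?one X Y f (pro_point X x)) \<in> extensional {undefined}"
      using extensional_Cmp_Pro[of FinKer ?one Y "const_pro FinKer (dob Y j)"]
      by (simp add: const_pro_simps)
  qed (use eq in \<open>simp add: const_pro_mor_def\<close>)
qed

lemma compatible_family_distribution:
  assumes x: "x \<in> X.limit_points"
  shows "compatible_family Y (distribution x)"
  unfolding compatible_family_def
proof (intro conjI ballI distribution_in_Hom[OF x])
  fix j j' w assume j: "j \<in> Obj (idx Y)" and j': "j' \<in> Obj (idx Y)" and w: "w \<in> Hom (idx Y) j j'"
  interpret p: fin_family "idx Y" "factorization Y" "point_value x" by (rule fin_family_point_value[OF x])
  obtain i a where ia: "(i, a) \<in> f j'" "i \<in> Obj (idx X)" "a \<in> Hom FinKer (X.ob i) (Y.ob j')"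
    by (rule obtain_rep'[OF j'])
  have sum_eq: "(\<Sum>y\<in>{y \<in> Y.ob j. Y.mo j j' w y = z}. point_value x j y) = point_value x j' z" for z
  proof (cases "z \<in> Y.ob j'")
    case True
    then show ?thesis by (rule p.compat[OF j j' w, symmetric])
  next
    case False
    then have "{y \<in> Y.ob j. Y.mo j j' w y = z} = {}" using Y.mo_mem[OF j j' w] by auto
    moreover have "point_value x j' z = 0"
      using FinKerD(4)[OF ia(3) False] by (simp add: point_value_eq[OF j' x ia(1)])
    ultimately show ?thesis by (simp only: sum.empty)
  qed
  have "Cmp FinKer fin_one (dob Y j) (dob Y j') (dmo Y j j' w) (distribution x j) =
      (\<lambda>t z. \<Sum>y\<in>{y \<in> Y.ob j. Y.mo j j' w y = z}. distribution x j t y)"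
    unfolding Y.dob_eq[OF j] Y.dmo_eq[OF j j' w] by (rule Cmp_FinKer_det_left[OF Y.finite_ob[OF j]])
  also have "\<dots> = distribution x j'"
  proof (intro ext)
    fix t z
    show "(\<Sum>y\<in>{y \<in> Y.ob j. Y.mo j j' w y = z}. distribution x j t y) = distribution x j' t z"
      by (cases "t \<in> fin_one") (simp_all add: distribution_def sum_eq)
  qed
  finally show "Cmp FinKer fin_one (dob Y j) (dob Y j') (dmo Y j j' w) (distribution x j) = distribution x j'" .
qed

lemma extends_family_iff_is_extension:
  assumes x: "x \<in> X.limit_points"
  shows "extends_family Y (limit_space Y) (distribution x) \<mu> \<longleftrightarrow> Y.is_extension (point_value x) \<mu>"
proof -
  interpret p: fin_family "idx Y" "factorization Y" "point_value x" by (rule fin_family_point_value[OF x])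
  have key: "distr \<mu> (count_space (dob Y j)) (\<lambda>y. y j) =
        point_measure (dob Y j) (\<lambda>y. ennreal (distribution x j undefined y)) \<longleftrightarrow>
      (\<forall>B\<subseteq>Y.ob j. emeasure \<mu> (Y.cylinder j B) = ennreal (sum (point_value x j) B))" (is "?L = ?P \<longleftrightarrow> _")
    if r: "\<mu> \<in> radon_measures (fin_limit (idx Y) (factorization Y))" and j: "j \<in> Obj (idx Y)" for j
  proof -
    have sp: "space \<mu> = Y.limit_points" using radon_measuresD(3)[OF r] by simp
    have pre: "(\<lambda>y. y j) -` B \<inter> Y.limit_points = Y.cylinder j B" for B
      by (auto simp: Y.cylinder_def)
    have meas: "(\<lambda>y. y j) \<in> \<mu> \<rightarrow>\<^sub>M count_space (Y.ob j)"
      using Y.limit_mem[OF _ j] Y.cylinder_in_sets[OF j] Y.finite_ob[OF j]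
      by (simp add: measurable_count_space_eq2 pre sp radon_measuresD(2)[OF r])
    have L: "emeasure ?L B = emeasure \<mu> (Y.cylinder j B)" if "B \<subseteq> Y.ob j" for B
      using that meas by (simp add: emeasure_distr pre sp Y.dob_eq[OF j])
    have P: "emeasure ?P B = ennreal (sum (point_value x j) B)" if "B \<subseteq> Y.ob j" for B
    proof -
      have "emeasure ?P B = (\<Sum>y\<in>B. ennreal (point_value x j y))"
        using that Y.finite_ob[OF j]
        by (simp add: emeasure_point_measure_finite Y.dob_eq[OF j] distribution_def fin_one_def)
      also have "\<dots> = ennreal (sum (point_value x j) B)"
        using that p.nonneg[OF j] by (intro sum_ennreal) auto
      finally show ?thesis .
    qed
    show ?thesis
    proof
      assume LP: "?L = ?P"
      show "\<forall>B\<subseteq>Y.ob j. emeasure \<mu> (Y.cylinder j B) = ennreal (sum (point_value x j) B)"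
      proof (intro allI impI)
        fix B assume B: "B \<subseteq> Y.ob j"
        show "emeasure \<mu> (Y.cylinder j B) = ennreal (sum (point_value x j) B)"
          unfolding L[OF B, symmetric] P[OF B, symmetric] LP ..
      qed
    next
      assume eq: "\<forall>B\<subseteq>Y.ob j. emeasure \<mu> (Y.cylinder j B) = ennreal (sum (point_value x j) B)"
      show "?L = ?P"
      proof (rule measure_eqI)
        show "sets ?L = sets ?P" by (simp add: sets_point_measure)
        fix B assume "B \<in> sets ?L"
        then have B: "B \<subseteq> Y.ob j" by (simp add: Y.dob_eq[OF j])
        show "emeasure ?L B = emeasure ?P B"
          unfolding L[OF B] P[OF B] using eq B by simp
      qed
    qed
  qed
  show ?thesis
    unfolding extends_family_def Y.is_extension_def Y.limit_space_eq
    by (intro conj_cong ball_cong refl) (rule key)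
qed

lemma is_Kolmogorov_extension_kernel:
  assumes x: "x \<in> X.limit_points"
  shows "is_Kolmogorov_extension Y (limit_space Y) (distribution x) (kernel x)"
  unfolding is_Kolmogorov_extension_def extends_family_iff_is_extension[OF x]
  using compatible_family_distribution[OF x] kernel_is_extension[OF x] kernel_eqI[OF x, symmetric]
  by (intro conjI allI impI)

end

theorem mainTheorem3:
  shows "\<exists>F :: (('i, 'k, 'a set, 'a \<Rightarrow> 'a \<Rightarrow> real) diagram,
               'i \<Rightarrow> ('i \<times> ('a \<Rightarrow> 'a \<Rightarrow> real)) set,
               ('i \<Rightarrow> 'a) topology,
               ('i \<Rightarrow> 'a) \<Rightarrow> ('i \<Rightarrow> 'a) measure) functor_data.
    faithful_functor ProDetFinKer KleisliR F \<and>
    (\<forall>X\<in>Obj ProDetFinKer.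
       stone_space (fobj F X) \<and>
       (\<forall>E. fin_factorization X E \<longrightarrow> fobj F X = fin_limit (idx X) E)) \<and>
    (\<forall>X\<in>Obj ProDetFinKer. \<forall>Y\<in>Obj ProDetFinKer. \<forall>f\<in>Hom ProDetFinKer X Y.
       \<forall>x\<in>topspace (fobj F X).
         \<exists>p. (\<forall>j\<in>Obj (idx Y). is_point_distribution X Y f x j (p j)) \<and>
             is_Kolmogorov_extension Y (fobj F Y) p (fmor F X Y f x))"
proof (intro exI[of _ stone_functor] conjI ballI allI impI faithful_stone_functor)
  fix X :: "('i, 'k, 'a set, 'a \<Rightarrow> 'a \<Rightarrow> real) diagram" assume X: "X \<in> Obj ProDetFinKer"
  interpret det_diagram X by (rule ProDetFinKer_det_diagram[OF X])
  show "stone_space (fobj stone_functor X)"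
    by (simp add: stone_functor_def limit_space_eq stone_space_fin_limit)
  fix E assume "fin_factorization X E"
  then show "fobj stone_functor X = fin_limit (idx X) E"
    using fin_limit_unique[OF ProDetFinKer_factorization[OF X]]
    by (simp add: stone_functor_def limit_space_eq)
next
  fix X Y :: "('i, 'k, 'a set, 'a \<Rightarrow> 'a \<Rightarrow> real) diagram" and f x
  assume X: "X \<in> Obj ProDetFinKer" and Y: "Y \<in> Obj ProDetFinKer" and f: "f \<in> Hom ProDetFinKer X Y"
    and x: "x \<in> topspace (fobj stone_functor X)"
  interpret det_morphism X Y f by (rule ProDetFinKer_det_morphism[OF X Y f])
  have xL: "x \<in> X.limit_points" using x by (simp add: stone_functor_def X.topspace_limit_space)
  show "\<exists>p. (\<forall>j\<in>Obj (idx Y). is_point_distribution X Y f x j (p j)) \<and>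
      is_Kolmogorov_extension Y (fobj stone_functor Y) p (fmor stone_functor X Y f x)"
    using is_point_distribution_distribution[OF xL] is_Kolmogorov_extension_kernel[OF xL] x
    by (intro exI[of _ "distribution x"]) (simp add: stone_functor_def)
qed

end
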